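(* Let $\mathcal B$ be a full subcategory of $d\text{-}\mathrm{Mod}(K(\{T\}))$, consisting of finite-dimensional differential modules, such that for all $\mathcal F_0^\dagger,\mathcal G_0^\dagger\in\mathcal B$ the differential module $\mathrm{Hom}(\mathcal F_0^\dagger,\mathcal G_0^\dagger)$ (internal Hom) has finite-dimensional cohomology groups $\mathrm H^i_{\mathrm{dR}}(K(\{T\}),\mathrm{Hom}(\mathcal F_0^\dagger,\mathcal G_0^\dagger))$ and satisfies $\chi_{\mathrm{dR}}(K(\{T\}),\mathrm{Hom}(\mathcal F_0^\dagger,\mathcal G_0^\dagger))=0$. Then the scalar extension functor $$\mathcal B\longrightarrow d\text{-}\mathrm{Mod}(K((T)))$$ is fully faithful. Moreover, for $\mathcal F_0^\dagger,\mathcal G_0^\dagger\in\mathcal B$ with images $F,G$ in $d\text{-}\mathrm{Mod}(K((T)))$, the natural map of Yoneda extension groups $$\mathrm{Ext}_{d\text{-}\mathrm{Mod}(K(\{T\}))}(\mathcal F_0^\dagger,\mathcal G_0^\dagger)\xrightarrow{\ \sim\ }\mathrm{Ext}_{d\text{-}\mathrm{Mod}(K((T)))}(F,G)$$ is an isomorphism. In particular, if $\mathcal B$ is stable by extensions in $d\text{-}\mathrm{Mod}(K(\{T\}))$, then its essential image is stable by extensions in $d\text{-}\mathrm{Mod}(K((T)))$.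
   Context: $K$ is a field of characteristic $0$, complete for a non-archimedean (possibly trivial) absolute value. $K(\{T\})\subset K((T))$ is the field of Laurent series $\sum_{n\ge n_0}a_nT^n$ with $\sum_{n\ge0}|a_n|T^n$ of positive radius of convergence. For a ring $R$ with derivation $d$ (here $d=d/dT$), $d\text{-}\mathrm{Mod}(R)$ is the category of $R$-modules with a connection $\nabla$ satisfying the Leibniz rule with respect to $d$, with $R$-linear maps commuting with the connections as morphisms. $\mathrm H^0_{\mathrm{dR}}(R,N)=\ker\nabla$, $\mathrm H^1_{\mathrm{dR}}(R,N)=\mathrm{coker}\,\nabla$, $\chi_{\mathrm{dR}}=\dim_K\mathrm H^0_{\mathrm{dR}}-\dim_K\mathrm H^1_{\mathrm{dR}}$. $\mathrm{Ext}(M,N)$ is the group of equivalence classes of exact sequences $0\to N\to E\to M\to0$ in $d\text{-}\mathrm{Mod}(R)$. A subcategory is stable by extensions if, for every exact sequence in $d\text{-}\mathrm{Mod}(R)$ whose outer terms belong to it, the middle term belongs to it. *)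

theory Defs
  imports
    "HOL-Analysis.Analysis"
    "HOL-Algebra.Algebra"
    "HOL-Algebra.Algebraic_Closure_Type"
    "HOL-Computational_Algebra.Formal_Laurent_Series"
begin

section \<open>The base field and the two rings of Laurent series\<close>

locale complete_nonarch_abs =
  fixes v :: "'k::field \<Rightarrow> real"
  assumes nonneg: "0 \<le> v x"
    and eq_0_iff: "v x = 0 \<longleftrightarrow> x = 0"
    and mult: "v (x * y) = v x * v y"
    and ultrametric: "v (x + y) \<le> max (v x) (v y)"
    and complete: "Metric_space.mcomplete UNIV (\<lambda>x y. v (x - y))"

abbreviation const_field :: "'k::field ring" where
  "const_field \<equiv> ring_of_type_algebra"

abbreviation laurent_ring :: "'k::field fls ring" where
  "laurent_ring \<equiv> ring_of_type_algebra"

definition conv_laurent_ring :: "('k::field \<Rightarrow> real) \<Rightarrow> 'k fls ring" where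
  "conv_laurent_ring v =
     laurent_ring \<lparr>carrier := {f. conv_radius (\<lambda>n. v (fls_nth f (int n))) > 0}\<rparr>"


section \<open>Modules and dimension\<close>

text \<open>
  Objects are records over the module records of HOL-Algebra.  Those inherit the fields
  \<open>mult\<close> and \<open>one\<close> of rings, which have no meaning for a module; they are left
  \<open>undefined\<close> in all constructions below.
\<close>

definition mod_span ::
    "('a, 'r) ring_scheme \<Rightarrow> ('a, 'b, 'z) module_scheme \<Rightarrow> 'b set \<Rightarrow> 'b set" where
  "mod_span R M S = \<Inter> {H. submodule H R M \<and> S \<subseteq> H}"

definition mod_basis ::
    "('a, 'r) ring_scheme \<Rightarrow> ('a, 'b, 'z) module_scheme \<Rightarrow> 'b set \<Rightarrow> bool" where
  "mod_basis R M S \<longleftrightarrow> S \<subseteq> carrier M \<and> mod_span R M S = carrier M \<and>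
     (\<forall>s\<in>S. s \<notin> mod_span R M (S - {s}))"

definition fin_dim :: "('a, 'r) ring_scheme \<Rightarrow> ('a, 'b, 'z) module_scheme \<Rightarrow> bool" where
  "fin_dim R M \<longleftrightarrow> (\<exists>S. finite S \<and> mod_basis R M S)"

definition vdim :: "('a, 'r) ring_scheme \<Rightarrow> ('a, 'b, 'z) module_scheme \<Rightarrow> nat" where
  "vdim R M = card (SOME S. mod_basis R M S)"

definition restrict_scalars ::
    "('c \<Rightarrow> 'a) \<Rightarrow> ('a, 'b, 'z) module_scheme \<Rightarrow> ('c, 'b) module" where
  "restrict_scalars \<phi> M =
     \<lparr>carrier = carrier M, monoid.mult = undefined, monoid.one = undefined,
      ring.zero = \<zero>\<^bsub>M\<^esub>, ring.add = ring.add M,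
      module.smult = (\<lambda>c x. \<phi> c \<odot>\<^bsub>M\<^esub> x)\<rparr>"

text \<open>
  In a quotient by \<open>U\<close>, an additive map \<open>h\<close> that preserves \<open>U\<close> induces the map
  sending the coset \<open>C = U + x\<close> to \<open>U + h(C) = U + h x\<close>.
\<close>

definition quot_module ::
    "('a, 'b, 'z) module_scheme \<Rightarrow> 'b set \<Rightarrow> ('a, 'b set) module" where
  "quot_module M U =
     \<lparr>carrier = a_rcosets\<^bsub>M\<^esub> U, monoid.mult = undefined, monoid.one = undefined,
      ring.zero = U, ring.add = set_add M,
      module.smult = (\<lambda>a C. U <+>\<^bsub>M\<^esub> ((\<lambda>x. a \<odot>\<^bsub>M\<^esub> x) ` C))\<rparr>"

definition lin_maps ::
    "('a, 'r) ring_scheme \<Rightarrow> ('a, 'b, 'y) module_scheme \<Rightarrow> ('a, 'c, 'z) module_scheme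
      \<Rightarrow> ('b \<Rightarrow> 'c) set" where
  "lin_maps R M N = {f \<in> carrier M \<rightarrow>\<^sub>E carrier N.
     (\<forall>x\<in>carrier M. \<forall>y\<in>carrier M. f (x \<oplus>\<^bsub>M\<^esub> y) = f x \<oplus>\<^bsub>N\<^esub> f y) \<and>
     (\<forall>a\<in>carrier R. \<forall>x\<in>carrier M. f (a \<odot>\<^bsub>M\<^esub> x) = a \<odot>\<^bsub>N\<^esub> f x)}"


section \<open>Differential modules\<close>

record ('a, 'b) dmod = "('a, 'b) module" +
  nabla :: "'b \<Rightarrow> 'b"

locale diff_module = module R M
  for R (structure) and d :: "'a \<Rightarrow> 'a" and M :: "('a, 'b) dmod" (structure) +
  assumes nabla_closed: "x \<in> carrier M \<Longrightarrow> nabla M x \<in> carrier M"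
    and nabla_add:
      "\<lbrakk>x \<in> carrier M; y \<in> carrier M\<rbrakk>
        \<Longrightarrow> nabla M (x \<oplus>\<^bsub>M\<^esub> y) = nabla M x \<oplus>\<^bsub>M\<^esub> nabla M y"
    and leibniz:
      "\<lbrakk>a \<in> carrier R; x \<in> carrier M\<rbrakk>
        \<Longrightarrow> nabla M (a \<odot>\<^bsub>M\<^esub> x) = d a \<odot>\<^bsub>M\<^esub> x \<oplus>\<^bsub>M\<^esub> a \<odot>\<^bsub>M\<^esub> nabla M x"

text \<open>Morphisms are extensional, so that they are determined by their values on the carrier.\<close>

definition dmod_hom ::
    "('a, 'r) ring_scheme \<Rightarrow> ('a, 'b) dmod \<Rightarrow> ('a, 'c) dmod \<Rightarrow> ('b \<Rightarrow> 'c) set" where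
  "dmod_hom R M N = {f \<in> lin_maps R M N. \<forall>x\<in>carrier M. f (nabla M x) = nabla N (f x)}"

definition dmod_iso ::
    "('a, 'r) ring_scheme \<Rightarrow> ('a, 'b) dmod \<Rightarrow> ('a, 'c) dmod \<Rightarrow> ('b \<Rightarrow> 'c) set" where
  "dmod_iso R M N = {f \<in> dmod_hom R M N. bij_betw f (carrier M) (carrier N)}"

definition internal_hom ::
    "('a, 'r) ring_scheme \<Rightarrow> ('a, 'b) dmod \<Rightarrow> ('a, 'c) dmod \<Rightarrow> ('a, 'b \<Rightarrow> 'c) dmod" where
  "internal_hom R M N =
     \<lparr>carrier = lin_maps R M N, monoid.mult = undefined, monoid.one = undefined,
      ring.zero = (\<lambda>x\<in>carrier M. \<zero>\<^bsub>N\<^esub>),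
      ring.add = (\<lambda>f g. \<lambda>x\<in>carrier M. f x \<oplus>\<^bsub>N\<^esub> g x),
      module.smult = (\<lambda>a f. \<lambda>x\<in>carrier M. a \<odot>\<^bsub>N\<^esub> f x),
      nabla = (\<lambda>f. \<lambda>x\<in>carrier M. nabla N (f x) \<ominus>\<^bsub>N\<^esub> f (nabla M x))\<rparr>"

definition quot_dmod :: "('a, 'b) dmod \<Rightarrow> 'b set \<Rightarrow> ('a, 'b set) dmod" where
  "quot_dmod M U =
     module.extend (quot_module M U) (dmod.fields (\<lambda>C. U <+>\<^bsub>M\<^esub> (nabla M ` C)))"


section \<open>De Rham cohomology over the constants\<close>

definition H0_dR :: "('k::field fls, 'b) dmod \<Rightarrow> ('k, 'b) module" where
  "H0_dR N = (restrict_scalars fls_const N)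
     \<lparr>carrier := {x \<in> carrier N. nabla N x = \<zero>\<^bsub>N\<^esub>}\<rparr>"

definition H1_dR :: "('k::field fls, 'b) dmod \<Rightarrow> ('k, 'b set) module" where
  "H1_dR N = quot_module (restrict_scalars fls_const N) (nabla N ` carrier N)"

definition chi_dR :: "('k::field fls, 'b) dmod \<Rightarrow> int" where
  "chi_dR N = int (vdim const_field (H0_dR N)) - int (vdim const_field (H1_dR N))"


section \<open>Scalar extension\<close>

text \<open>
  For a ring \<open>R\<close> contained in \<open>S\<close>, the module \<open>S \<otimes>\<^sub>R M\<close> is the free abelian group
  on the pairs \<open>(a, x)\<close>, standing for \<open>a \<otimes> x\<close>, modulo the bilinearity relations.  The record
  \<open>tensor_pre\<close> holds this free group together with the operators that induce scalar
  multiplication and connection on the quotient; it is not itself an \<open>S\<close>-module.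
\<close>

definition tensor_pre ::
    "'a ring \<Rightarrow> ('a \<Rightarrow> 'a) \<Rightarrow> ('a, 'b) dmod \<Rightarrow> ('a, ('a \<times> 'b) \<Rightarrow>\<^sub>0 int) dmod" where
  "tensor_pre S d M =
     \<lparr>carrier = carrier (free_Abelian_group (carrier S \<times> carrier M)),
      monoid.mult = undefined, monoid.one = undefined, ring.zero = 0, ring.add = (+),
      module.smult = (\<lambda>s. frag_extend (\<lambda>(a, x). frag_of (s \<otimes>\<^bsub>S\<^esub> a, x))),
      nabla = frag_extend (\<lambda>(a, x). frag_of (d a, x) + frag_of (a, nabla M x))\<rparr>"

definition tensor_rels ::
    "'a ring \<Rightarrow> 'a ring \<Rightarrow> ('a, 'b) dmod \<Rightarrow> (('a \<times> 'b) \<Rightarrow>\<^sub>0 int) set" where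
  "tensor_rels R S M = generate (free_Abelian_group (carrier S \<times> carrier M))
     ({frag_of (a \<oplus>\<^bsub>S\<^esub> b, x) - frag_of (a, x) - frag_of (b, x) | a b x.
         a \<in> carrier S \<and> b \<in> carrier S \<and> x \<in> carrier M} \<union>
      {frag_of (a, x \<oplus>\<^bsub>M\<^esub> y) - frag_of (a, x) - frag_of (a, y) | a x y.
         a \<in> carrier S \<and> x \<in> carrier M \<and> y \<in> carrier M} \<union>
      {frag_of (a \<otimes>\<^bsub>S\<^esub> r, x) - frag_of (a, r \<odot>\<^bsub>M\<^esub> x) | a r x.
         a \<in> carrier S \<and> r \<in> carrier R \<and> x \<in> carrier M})"

definition scalar_ext ::
    "'a ring \<Rightarrow> 'a ring \<Rightarrow> ('a \<Rightarrow> 'a) \<Rightarrow> ('a, 'b) dmod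
      \<Rightarrow> ('a, (('a \<times> 'b) \<Rightarrow>\<^sub>0 int) set) dmod" where
  "scalar_ext R S d M = quot_dmod (tensor_pre S d M) (tensor_rels R S M)"

definition scalar_ext_map ::
    "'a ring \<Rightarrow> 'a ring \<Rightarrow> ('a \<Rightarrow> 'a) \<Rightarrow> ('a, 'b) dmod \<Rightarrow> ('a, 'c) dmod \<Rightarrow> ('b \<Rightarrow> 'c)
      \<Rightarrow> (('a \<times> 'b) \<Rightarrow>\<^sub>0 int) set \<Rightarrow> (('a \<times> 'c) \<Rightarrow>\<^sub>0 int) set" where
  "scalar_ext_map R S d M N f = (\<lambda>C\<in>carrier (scalar_ext R S d M).
     tensor_rels R S N <+>\<^bsub>tensor_pre S d N\<^esub> (frag_extend (\<lambda>(a, x). frag_of (a, f x)) ` C))"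

text \<open>
  \<open>Bs\<close> is the class of objects of a full subcategory.  The essential image may be taken
  among differential modules on any type.
\<close>

definition scalar_ext_fully_faithful ::
    "'a ring \<Rightarrow> 'a ring \<Rightarrow> ('a \<Rightarrow> 'a) \<Rightarrow> ('a, 'b) dmod set \<Rightarrow> bool" where
  "scalar_ext_fully_faithful R S d Bs \<longleftrightarrow> (\<forall>M\<in>Bs. \<forall>N\<in>Bs.
     bij_betw (scalar_ext_map R S d M N) (dmod_hom R M N)
       (dmod_hom S (scalar_ext R S d M) (scalar_ext R S d N)))"

definition scalar_ext_ess_image ::
    "'a ring \<Rightarrow> 'a ring \<Rightarrow> ('a \<Rightarrow> 'a) \<Rightarrow> ('a, 'b) dmod set \<Rightarrow> ('a, 'u) dmod set" where
  "scalar_ext_ess_image R S d Bs =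
     {C. diff_module S d C \<and> (\<exists>M\<in>Bs. dmod_iso S (scalar_ext R S d M) C \<noteq> {})}"


section \<open>Extensions\<close>

definition short_exact ::
    "('a, 'r) ring_scheme \<Rightarrow> ('a, 'n) dmod \<Rightarrow> ('n \<Rightarrow> 'e) \<Rightarrow> ('a, 'e) dmod \<Rightarrow> ('e \<Rightarrow> 'm)
      \<Rightarrow> ('a, 'm) dmod \<Rightarrow> bool" where
  "short_exact R N i E p M \<longleftrightarrow>
     i \<in> dmod_hom R N E \<and> p \<in> dmod_hom R E M \<and>
     inj_on i (carrier N) \<and> i ` carrier N = a_kernel E M p \<and> p ` carrier E = carrier M"

definition stable_by_extensions ::
    "'a ring \<Rightarrow> ('a \<Rightarrow> 'a) \<Rightarrow> ('a, 'b) dmod set \<Rightarrow> bool" where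
  "stable_by_extensions R d Bs \<longleftrightarrow> (\<forall>N\<in>Bs. \<forall>M\<in>Bs. \<forall>E i p.
     diff_module R d E \<and> short_exact R N i E p M \<longrightarrow> E \<in> Bs)"

type_synonym ('a, 'n, 'e, 'm) extn = "('a, 'e) dmod \<times> ('n \<Rightarrow> 'e) \<times> ('e \<Rightarrow> 'm)"

definition extensions ::
    "'a ring \<Rightarrow> ('a \<Rightarrow> 'a) \<Rightarrow> ('a, 'm) dmod \<Rightarrow> ('a, 'n) dmod \<Rightarrow> ('a, 'n, 'e, 'm) extn set"
  where
  "extensions R d M N = {(E, i, p). diff_module R d E \<and> short_exact R N i E p M}"

text \<open>The middle terms may live on different types.\<close>

definition ext_equiv ::
    "'a ring \<Rightarrow> ('a, 'm) dmod \<Rightarrow> ('a, 'n) dmod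
      \<Rightarrow> ('a, 'n, 'e, 'm) extn \<Rightarrow> ('a, 'n, 'f, 'm) extn \<Rightarrow> bool" where
  "ext_equiv R M N = (\<lambda>(E, i, p) (E', i', p'). \<exists>g\<in>dmod_iso R E E'.
     (\<forall>x\<in>carrier N. g (i x) = i' x) \<and> (\<forall>y\<in>carrier E. p' (g y) = p y))"

text \<open>
  Baer sum: the fibre product of \<open>E\<close> and \<open>E'\<close> over \<open>M\<close>, modulo the antidiagonal
  copy of \<open>N\<close>.
\<close>

definition fibre_product ::
    "('a, 'e) dmod \<Rightarrow> ('e \<Rightarrow> 'm) \<Rightarrow> ('a, 'f) dmod \<Rightarrow> ('f \<Rightarrow> 'm) \<Rightarrow> ('a, 'e \<times> 'f) dmod" where
  "fibre_product E p E' p' =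
     \<lparr>carrier = {(x, y). x \<in> carrier E \<and> y \<in> carrier E' \<and> p x = p' y},
      monoid.mult = undefined, monoid.one = undefined, ring.zero = (\<zero>\<^bsub>E\<^esub>, \<zero>\<^bsub>E'\<^esub>),
      ring.add = (\<lambda>(x, y) (x', y'). (x \<oplus>\<^bsub>E\<^esub> x', y \<oplus>\<^bsub>E'\<^esub> y')),
      module.smult = (\<lambda>a (x, y). (a \<odot>\<^bsub>E\<^esub> x, a \<odot>\<^bsub>E'\<^esub> y)),
      nabla = (\<lambda>(x, y). (nabla E x, nabla E' y))\<rparr>"

definition baer_sum ::
    "('a, 'n) dmod \<Rightarrow> ('a, 'n, 'e, 'm) extn \<Rightarrow> ('a, 'n, 'f, 'm) extn
      \<Rightarrow> ('a, 'n, ('e \<times> 'f) set, 'm) extn" where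
  "baer_sum N = (\<lambda>(E, i, p) (E', i', p').
     let P = fibre_product E p E' p';
         U = (\<lambda>x. (i x, \<ominus>\<^bsub>E'\<^esub> i' x)) ` carrier N;
         Q = quot_dmod P U
     in (Q, \<lambda>x\<in>carrier N. U +>\<^bsub>P\<^esub> (i x, \<zero>\<^bsub>E'\<^esub>),
            \<lambda>C\<in>carrier Q. p (fst (SOME z. z \<in> C))))"

text \<open>
  Classes are formed among extensions on the type of \<open>M\<close> and \<open>N\<close>.  This loses nothing:
  the middle term is in bijection with \<open>carrier N \<times> carrier M\<close>, and over a field of Laurent
  series that product is either a point or infinite, so it embeds into the same type.  A Baer
  sum is carried back to this type along equivalences.
\<close>

definition Ext :: "'a ring \<Rightarrow> ('a \<Rightarrow> 'a) \<Rightarrow> ('a, 'b) dmod \<Rightarrow> ('a, 'b) dmod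
    \<Rightarrow> ('a, 'b, 'b, 'b) extn set monoid" where
  "Ext R d M N =
     \<lparr>carrier = extensions R d M N //
        {(e, e'). e \<in> extensions R d M N \<and> e' \<in> extensions R d M N \<and> ext_equiv R M N e e'},
      monoid.mult = (\<lambda>C D. {e \<in> extensions R d M N.
        \<exists>x\<in>C. \<exists>y\<in>D. ext_equiv R M N (baer_sum N x y) e}),
      monoid.one = {(E, i, p) \<in> extensions R d M N.
        \<exists>s\<in>dmod_hom R M E. \<forall>x\<in>carrier M. p (s x) = x}\<rparr>"

definition ext_scalar_ext ::
    "'a ring \<Rightarrow> 'a ring \<Rightarrow> ('a \<Rightarrow> 'a) \<Rightarrow> ('a, 'm) dmod \<Rightarrow> ('a, 'n) dmod
      \<Rightarrow> ('a, 'n, 'e, 'm) extn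
      \<Rightarrow> ('a, (('a \<times> 'n) \<Rightarrow>\<^sub>0 int) set, (('a \<times> 'e) \<Rightarrow>\<^sub>0 int) set, (('a \<times> 'm) \<Rightarrow>\<^sub>0 int) set) extn"
  where
  "ext_scalar_ext R S d M N = (\<lambda>(E, i, p).
     (scalar_ext R S d E, scalar_ext_map R S d N E i, scalar_ext_map R S d E M p))"

definition Ext_map ::
    "'a ring \<Rightarrow> 'a ring \<Rightarrow> ('a \<Rightarrow> 'a) \<Rightarrow> ('a, 'b) dmod \<Rightarrow> ('a, 'b) dmod
      \<Rightarrow> ('a, 'b, 'b, 'b) extn set
      \<Rightarrow> ('a, (('a \<times> 'b) \<Rightarrow>\<^sub>0 int) set, (('a \<times> 'b) \<Rightarrow>\<^sub>0 int) set, (('a \<times> 'b) \<Rightarrow>\<^sub>0 int) set) extn set"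
  where
  "Ext_map R S d M N C =
     {e' \<in> extensions S d (scalar_ext R S d M) (scalar_ext R S d N).
       \<exists>e\<in>C. ext_equiv S (scalar_ext R S d M) (scalar_ext R S d N)
                (ext_scalar_ext R S d M N e) e'}"

end

theory Submission
  imports Defs
begin

text \<open>
  Write \<open>A\<close> for the field of convergent Laurent series and \<open>S = K((T))\<close> for the field of all of
  them.  For \<open>M, N\<close> in the subcategory let \<open>H = Hom(M, N)\<close> and \<open>H* = Hom(N, M)\<close>, its dual.
  Everything follows from the comparison of \<open>H\<close> with \<open>S \<otimes> H\<close>: horizontal elements of
  \<open>S \<otimes> H\<close> are morphisms \<open>S \<otimes> M \<rightarrow> S \<otimes> N\<close>, and the cokernel of the connection on \<open>H\<close> or on
  \<open>S \<otimes> H\<close> classifies extensions.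

  \<^bold>\<open>Degree 0, and injectivity in degree 1.\<close>  The residue of the trace,
  \<open>\<langle>\<phi>, y\<rangle> = res tr(\<phi> y)\<close>, pairs a formal horizontal \<open>\<phi> \<in> S \<otimes> H*\<close> with a convergent \<open>y \<in> H\<close>.
  It kills exact \<open>y\<close>, because a derivative has no residue, and no \<open>\<phi> \<noteq> 0\<close> is orthogonal to all of
  \<open>H\<close>, because \<open>H\<close> contains all monomials.  Hence the formal horizontal elements of \<open>H*\<close> embed into
  the dual of the first cohomology of \<open>H\<close> over \<open>A\<close>.  Together with the vanishing of the two Euler
  characteristics this gives
  \<open>h\<^sup>0(A, H*) \<le> h\<^sup>0(S, H*) \<le> h\<^sup>1(A, H) = h\<^sup>0(A, H) \<le> h\<^sup>0(S, H) \<le> h\<^sup>1(A, H*) = h\<^sup>0(A, H*)\<close>,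
  so all these numbers agree and the pairing is perfect.  Formal horizontal elements are therefore
  convergent, and a convergent element that becomes exact over \<open>S\<close> is orthogonal to the horizontal
  elements of \<open>H*\<close>, hence exact already over \<open>A\<close> (lemma \<open>index_zero_comparison\<close>).

  \<^bold>\<open>Surjectivity in degree 1.\<close>  Over \<open>S\<close> every element is congruent modulo derivatives to one
  with Laurent polynomial, hence convergent, coordinates (lemma
  \<open>coord_conn_onto_modulo_polynomials\<close>).  For a basis vector \<open>e\<close> the elements
  \<open>e, \<nabla> e, \<nabla>\<^sup>2 e, \<dots>\<close> satisfy a linear relation \<open>\<Sum> a\<^sub>i \<nabla>\<^sup>i e = 0\<close>; multiplying by \<open>c\<close> and integrating
  by parts shows that \<open>Q(c) e\<close> is exact, where \<open>Q(c) = \<Sum> (-1)\<^sup>i (a\<^sub>i c)\<^sup>(\<^sup>i\<^sup>)\<close> is the adjoint operator.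
  Its indicial polynomial is not zero, so in characteristic 0 one can solve \<open>Q(c) = u\<close> term by term
  from some exponent on.

  \<^bold>\<open>Extensions.\<close>  Every extension of \<open>M\<close> by \<open>N\<close> splits \<open>A\<close>-linearly, so it is \<open>N \<times> M\<close> with a connection
  \<open>(n, m) \<mapsto> (\<nabla> n + y m, \<nabla> m)\<close> for a linear \<open>y : M \<rightarrow> N\<close>, and \<open>y\<close> matters only up to derivatives
  (lemma \<open>split_ext_equiv_iff\<close>).  Baer sums add these cocycles (lemma \<open>baer_sum_cocycle\<close>) and scalar
  extension extends them to \<open>S\<close> (lemma \<open>scalar_extension_of_extension\<close>), so the map on extension
  groups is the map on first cohomology, which is bijective.  Surjectivity means that every
  extension over \<open>S\<close> comes from one over \<open>A\<close>, whence the stability of the essential image.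
\<close>

notation fls_nth (infixl \<open>$$\<close> 75)

section \<open>Linear systems over a field\<close>

lemma underdetermined_system_solvable:
  fixes f :: "'j \<Rightarrow> 'i \<Rightarrow> 'a::field"
  assumes "finite I" "finite J" "card I < card J"
  shows "\<exists>k. (\<exists>j\<in>J. k j \<noteq> 0) \<and> (\<forall>i\<in>I. (\<Sum>j\<in>J. k j * f j i) = 0)"
  using assms
proof (induction I arbitrary: J f rule: finite_induct)
  case empty
  then obtain j where "j \<in> J" by (metis card.empty ex_in_conv less_irrefl)
  then show ?case by (intro exI[of _ "\<lambda>_. 1"]) auto
next
  case (insert i0 I)
  show ?case
  proof (cases "\<forall>j\<in>J. f j i0 = 0")
    case True
    from insert have "card I < card J" by simp
    from insert.IH[OF insert.prems(1) this, of f] True show ?thesis by auto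
  next
    case False
    then obtain j0 where j0: "j0 \<in> J" "f j0 i0 \<noteq> 0" by blast
    define f' where "f' j i = f j i - f j i0 / f j0 i0 * f j0 i" for j i
    from insert j0 have "card I < card (J - {j0})" "finite (J - {j0})" by auto
    from insert.IH[OF this(2,1), of f'] obtain k where
      k: "\<exists>j\<in>J-{j0}. k j \<noteq> 0" "\<And>i. i \<in> I \<Longrightarrow> (\<Sum>j\<in>J-{j0}. k j * f' j i) = 0" by blast
    \<comment> \<open>The coefficient at \<open>j0\<close> is forced by the equation for \<open>i0\<close>.\<close>
    define k' where "k' j = (if j = j0 then - (\<Sum>j\<in>J-{j0}. k j * f j i0) / f j0 i0 else k j)" for j
    have eq: "(\<Sum>j\<in>J. k' j * f j i) = (\<Sum>j\<in>J-{j0}. k j * f' j i)" for i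
    proof -
      have "(\<Sum>j\<in>J. k' j * f j i) = k' j0 * f j0 i + (\<Sum>j\<in>J-{j0}. k j * f j i)"
        using j0 insert.prems by (simp add: sum.remove[of J j0] k'_def)
      also have "\<dots> = (\<Sum>j\<in>J-{j0}. k j * f' j i)"
        by (simp add: f'_def k'_def right_diff_distrib sum_subtractf sum_divide_distrib
            sum_distrib_left sum_distrib_right algebra_simps)
      finally show ?thesis .
    qed
    have "f' j i0 = 0" for j using j0 by (simp add: f'_def)
    then have "(\<Sum>j\<in>J. k' j * f j i) = 0" if "i \<in> insert i0 I" for i
      using that k(2) by (auto simp: eq)
    moreover have "\<exists>j\<in>J. k' j \<noteq> 0" using k(1) by (auto simp: k'_def)
    ultimately show ?thesis by blast
  qed
qed

lemma independent_square_family_spans: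
  fixes f :: "'j \<Rightarrow> 'i \<Rightarrow> 'a::field"
  assumes "finite I" "finite J" "card I = card J"
    and indep: "\<And>k. \<forall>i\<in>I. (\<Sum>j\<in>J. k j * f j i) = 0 \<Longrightarrow> \<forall>j\<in>J. k j = 0"
  shows "\<exists>k. \<forall>i\<in>I. g i = (\<Sum>j\<in>J. k j * f j i)"
proof -
  define F where "F = case_option g f"
  define J' where "J' = insert None (Some ` J)"
  have sumJ': "(\<Sum>j\<in>J'. k j * F j i) = k None * g i + (\<Sum>j\<in>J. k (Some j) * f j i)" for k i
    using assms by (simp add: J'_def F_def sum.reindex)
  have "card I < card J'" "finite J'"
    using assms by (auto simp: J'_def card_image)
  from underdetermined_system_solvable[OF assms(1) this(2,1), of F]
  obtain k where k: "\<exists>j\<in>J'. k j \<noteq> 0" "\<And>i. i \<in> I \<Longrightarrow> k None * g i + (\<Sum>j\<in>J. k (Some j) * f j i) = 0"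
    unfolding sumJ' by blast
  have "k None \<noteq> 0"
  proof
    assume 0: "k None = 0"
    with k(2) have "\<forall>i\<in>I. (\<Sum>j\<in>J. k (Some j) * f j i) = 0" by simp
    from indep[OF this] k(1) 0 show False by (auto simp: J'_def)
  qed
  moreover have "k None * g i = - (\<Sum>j\<in>J. k (Some j) * f j i)" if "i \<in> I" for i
    using k(2)[OF that] by (simp add: eq_neg_iff_add_eq_0)
  ultimately have "g i = (\<Sum>j\<in>J. - k (Some j) / k None * f j i)" if "i \<in> I" for i
    using that
    by (simp add: sum_divide_distrib[symmetric] sum_negf field_simps)
  then show ?thesis by (intro exI[of _ "\<lambda>j. - k (Some j) / k None"]) blast
qed

section \<open>Differential operators on Laurent series\<close>

text \<open>
  The triangular system \<open>x n = g n + (\<Sum>m<n. k n m * x m)\<close>; it produces the coefficients of a power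
  series one after the other.
\<close>

fun recursive_solution :: "(nat \<Rightarrow> 'a::comm_ring) \<Rightarrow> (nat \<Rightarrow> nat \<Rightarrow> 'a) \<Rightarrow> nat \<Rightarrow> 'a" where
  "recursive_solution g k n = g n + (\<Sum>m<n. k n m * recursive_solution g k m)"

declare recursive_solution.simps [simp del]

lemma fls_times_nth_window:
  fixes f g :: "'a::field fls"
  assumes f: "\<And>t. t < \<alpha> \<Longrightarrow> f $$ t = 0" and g: "\<And>j. j < \<gamma> \<Longrightarrow> g $$ j = 0"
  shows "(f * g) $$ m = (\<Sum>j=\<gamma>..m - \<alpha>. f $$ (m - j) * g $$ j)"
proof (cases "f = 0 \<or> g = 0")
  case False
  then have sub: "\<alpha> \<le> fls_subdegree f" "\<gamma> \<le> fls_subdegree g"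
    using assms nth_fls_subdegree_nonzero by (metis linorder_not_less)+
  have "(g * f) $$ m = (\<Sum>i=fls_subdegree g..m - fls_subdegree f. g $$ i * f $$ (m - i))"
    by (rule fls_times_nth(2))
  also have "\<dots> = (\<Sum>j=\<gamma>..m - \<alpha>. g $$ j * f $$ (m - j))"
  proof (rule sum.mono_neutral_left)
    show "\<forall>i\<in>{\<gamma>..m - \<alpha>} - {fls_subdegree g..m - fls_subdegree f}. g $$ i * f $$ (m - i) = 0"
      by (auto simp: not_le)
  qed (use sub in auto)
  finally show ?thesis by (simp add: mult.commute)
qed auto

lemma fls_higher_deriv_nth:
  fixes f :: "'a::field_char_0 fls"
  shows "(fls_deriv ^^ i) f $$ l = pochhammer (of_int l + 1) i * f $$ (l + int i)"
proof (induction i arbitrary: l)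
  case (Suc i)
  show ?case by (simp add: Suc pochhammer_rec algebra_simps)
qed simp

lemma poly_pochhammer:
  fixes p :: "'a::comm_ring_1 poly"
  shows "poly (pochhammer p i) x = pochhammer (poly p x) i"
  by (induction i arbitrary: p) (simp_all add: pochhammer_rec)

text \<open>
  The rising factorials of different length are linearly independent polynomials, and a nonzero
  polynomial over a field of characteristic 0 has only finitely many integral roots.
\<close>

lemma indicial_polynomial_eventually_nonzero:
  fixes b :: "nat \<Rightarrow> 'a::field_char_0"
  assumes "\<exists>i\<le>n. b i \<noteq> 0"
  shows "\<exists>L::int. \<forall>l\<ge>L. (\<Sum>i\<le>n. b i * pochhammer (of_int l + 1) i) \<noteq> 0"
proof -
  define p where "p = (\<Sum>i\<le>n. Polynomial.smult (b i) (pochhammer [:1, 1:] i))"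
  have poly_p: "poly p x = (\<Sum>i\<le>n. b i * pochhammer (x + 1) i)" for x
    by (simp add: p_def poly_sum poly_pochhammer add.commute)
  define i0 where "i0 = (LEAST i. b i \<noteq> 0)"
  obtain i where i: "i \<le> n" "b i \<noteq> 0" using assms by blast
  have i0: "b i0 \<noteq> 0" unfolding i0_def by (rule LeastI[of _ i]) (fact i)
  have "i0 \<le> i" unfolding i0_def by (rule Least_le) (fact i)
  then have i0_le: "i0 \<le> n" using i by simp
  have below: "b j = 0" if "j < i0" for j
    using not_less_Least[of j "\<lambda>i. b i \<noteq> 0"] that unfolding i0_def by blast
  \<comment> \<open>At \<open>-1 - i0\<close> only the term of index \<open>i0\<close> survives: the rising factorials of larger
    index vanish there.\<close>
  have poch: "pochhammer (- of_nat i0 :: 'a) i = 0" if "i > i0" for i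
    using that by (auto simp: pochhammer_eq_0_iff)
  have "poly p (- 1 - of_nat i0) = (\<Sum>i\<le>n. if i = i0 then b i0 * pochhammer (- of_nat i0) i0 else 0)"
    unfolding poly_p
  proof (intro sum.cong refl)
    fix i
    show "b i * pochhammer (- 1 - of_nat i0 + 1) i = (if i = i0 then b i0 * pochhammer (- of_nat i0) i0 else 0)"
      using below[of i] poch[of i] by (cases i i0 rule: linorder_cases) auto
  qed
  also have "\<dots> \<noteq> 0" using i0 i0_le by (simp add: pochhammer_eq_0_iff)
  finally have "p \<noteq> 0" by (metis poly_0)
  then have "finite {x. poly p x = 0}" by (rule poly_roots_finite)
  then have fin: "finite {l::int. of_int l \<in> {x. poly p x = 0}}"
    by (rule finite_inverse_image) (simp add: inj_on_def)
  have "l \<le> Max {l::int. of_int l \<in> {x. poly p x = 0}}" if "poly p (of_int l) = 0" for l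
    using that by (intro Max_ge fin) simp
  then obtain L :: int where "\<And>l. poly p (of_int l) = 0 \<Longrightarrow> l \<le> L" by blast
  then have "(\<Sum>i\<le>n. b i * pochhammer (of_int l + 1) i) \<noteq> 0" if "l \<ge> L + 1" for l
    using that unfolding poly_p by force
  then show ?thesis by blast
qed

text \<open>
  In lowest order the operator multiplies coefficients by values of its indicial polynomial.
  Beyond the last integral root of that polynomial these values are invertible, so the coefficients
  of \<open>c\<close> can be determined recursively.
\<close>

lemma adjoint_operator_onto_modulo_polynomials:
  fixes a :: "nat \<Rightarrow> 'k::field_char_0 fls" and u :: "'k fls"
  assumes nz: "\<exists>i\<le>n. a i \<noteq> 0"
  shows "\<exists>c L. \<forall>l\<ge>L. (u - (\<Sum>i\<le>n. (- 1) ^ i * (fls_deriv ^^ i) (a i * c))) $$ l = 0"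
proof -
  define Z where "Z = {i \<in> {..n}. a i \<noteq> 0}"
  \<comment> \<open>The operator maps \<open>T^j\<close> to a series starting at \<open>T^(j + s)\<close> or later.\<close>
  define s where "s = Min ((\<lambda>i. fls_subdegree (a i) - int i) ` Z)"
  have Z: "finite Z" "Z \<noteq> {}" using nz by (auto simp: Z_def)
  have low: "a i $$ t = 0" if "i \<le> n" "t < s + int i" for i t
  proof (cases "a i = 0")
    case False
    then have "s \<le> fls_subdegree (a i) - int i"
      unfolding s_def using Z that by (intro Min_le) (auto simp: Z_def)
    then show ?thesis using that by simp
  qed simp
  have "s \<in> (\<lambda>i. fls_subdegree (a i) - int i) ` Z" unfolding s_def using Z by (intro Min_in) auto
  then obtain i1 where i1: "i1 \<le> n" "a i1 $$ (s + int i1) \<noteq> 0" by (auto simp: Z_def)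
  define b where "b i = (- 1) ^ i * a i $$ (s + int i)" for i
  from i1 have "\<exists>i\<le>n. b i \<noteq> 0" by (auto simp: b_def)
  from indicial_polynomial_eventually_nonzero[OF this] obtain L :: int where
    L: "\<And>l. l \<ge> L \<Longrightarrow> (\<Sum>i\<le>n. b i * pochhammer (of_int l + 1) i) \<noteq> 0" by blast
  \<comment> \<open>\<open>K l j\<close> is the coefficient of \<open>T^l\<close> in the image of \<open>T^j\<close>, and \<open>ind l = K l (l - s)\<close> is the
    indicial polynomial.\<close>
  define ind where "ind l = (\<Sum>i\<le>n. b i * pochhammer (of_int l + 1) i)" for l :: int
  define K where "K l j = (\<Sum>i\<le>n. (- 1) ^ i * pochhammer (of_int l + 1) i * a i $$ (l + int i - j))"
    for l j :: int
  define h where "h = recursive_solution (\<lambda>n. u $$ (L + int n) / ind (L + int n))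
      (\<lambda>n m. - K (L + int n) (L - s + int m) / ind (L + int n))"
  have h: "ind (L + int N) * h N = u $$ (L + int N) - (\<Sum>m<N. K (L + int N) (L - s + int m) * h m)" for N
  proof -
    have "ind (L + int N) \<noteq> 0" using L[of "L + int N"] by (simp add: ind_def)
    then show ?thesis unfolding h_def
      by (subst recursive_solution.simps) (simp add: field_simps sum_distrib_left sum_negf)
  qed
  \<comment> \<open>The series \<open>c\<close> starts at \<open>T^(L - s)\<close>, so that its image starts at \<open>T^L\<close>, where the indicial
    polynomial no longer vanishes.\<close>
  define c where "c = fls_shift (s - L) (fps_to_fls (Abs_fps h))"
  have c: "c $$ j = (if j < L - s then 0 else h (nat (j - (L - s))))" for j
    by (auto simp: c_def algebra_simps)
  have prod: "(a i * c) $$ (L + int N + int i)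
      = (\<Sum>m\<le>N. a i $$ (L + int N + int i - (L - s + int m)) * h m)" if "i \<le> n" for i N
  proof -
    have "(a i * c) $$ (L + int N + int i)
        = (\<Sum>j=L - s..L + int N - s. a i $$ (L + int N + int i - j) * c $$ j)"
      using low[OF that] by (subst fls_times_nth_window[of "s + int i" _ "L - s"]) (auto simp: c)
    also have "\<dots> = (\<Sum>m\<le>N. a i $$ (L + int N + int i - (L - s + int m)) * h m)"
      by (rule sum.reindex_bij_witness[of _ "\<lambda>m. L - s + int m" "\<lambda>j. nat (j - (L - s))"]) (auto simp: c)
    finally show ?thesis .
  qed
  have "(\<Sum>i\<le>n. (- 1) ^ i * (fls_deriv ^^ i) (a i * c)) $$ (L + int N) = u $$ (L + int N)" for N
  proof -
    have sgn: "((- 1) ^ i * f) $$ l = (- 1) ^ i * f $$ l" for i l and f :: "'k fls"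
      by (cases "even i") auto
    have "(\<Sum>i\<le>n. (- 1) ^ i * (fls_deriv ^^ i) (a i * c)) $$ (L + int N)
        = (\<Sum>i\<le>n. (- 1) ^ i * (pochhammer (of_int (L + int N) + 1) i *
             (\<Sum>m\<le>N. a i $$ (L + int N + int i - (L - s + int m)) * h m)))"
      by (simp add: fls_nth_sum sgn fls_higher_deriv_nth prod del: of_int_add)
    also have "\<dots> = (\<Sum>m\<le>N. K (L + int N) (L - s + int m) * h m)"
      unfolding K_def sum_distrib_left sum_distrib_right
      by (subst sum.swap) (simp add: mult_ac)
    also have "\<dots> = (\<Sum>m<N. K (L + int N) (L - s + int m) * h m) + ind (L + int N) * h N"
    proof -
      have "K (L + int N) (L - s + int N) = ind (L + int N)"
        by (simp add: K_def ind_def b_def mult_ac algebra_simps)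
      then show ?thesis by (simp add: lessThan_Suc_atMost[symmetric])
    qed
    also have "\<dots> = u $$ (L + int N)" by (simp add: h)
    finally show ?thesis .
  qed
  then have "(u - (\<Sum>i\<le>n. (- 1) ^ i * (fls_deriv ^^ i) (a i * c))) $$ l = 0" if "l \<ge> L" for l
    using that zle_iff_zadd by auto
  then show ?thesis by blast
qed

section \<open>Connections in coordinates\<close>

definition coord_conn :: "'p set \<Rightarrow> ('p \<Rightarrow> 'p \<Rightarrow> 'k::field fls) \<Rightarrow> ('p \<Rightarrow> 'k fls) \<Rightarrow> 'p \<Rightarrow> 'k fls" where
  "coord_conn P G y p = fls_deriv (y p) + (\<Sum>q\<in>P. G p q * y q)"

text \<open>
  The negative transpose: the matrix of the dual connection in the dual basis.
\<close>

abbreviation dual_matrix :: "('p \<Rightarrow> 'p \<Rightarrow> 'k::field fls) \<Rightarrow> 'p \<Rightarrow> 'p \<Rightarrow> 'k fls" where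
  "dual_matrix G \<equiv> \<lambda>p q. - G q p"

lemma coord_conn_add:
  "coord_conn P G (\<lambda>p. x p + y p) p = coord_conn P G x p + coord_conn P G y p"
  by (simp add: coord_conn_def algebra_simps sum.distrib)

lemma coord_conn_diff:
  "coord_conn P G (\<lambda>p. x p - y p) p = coord_conn P G x p - coord_conn P G y p"
  by (simp add: coord_conn_def algebra_simps sum_subtractf)

lemma coord_conn_scale:
  "coord_conn P G (\<lambda>p. c * y p) p = c * coord_conn P G y p + fls_deriv c * y p"
  by (simp add: coord_conn_def algebra_simps sum_distrib_left)

lemma coord_conn_zero: "coord_conn P G (\<lambda>p. 0) p = 0"
  by (simp add: coord_conn_def)

lemma coord_conn_sum:
  "finite J \<Longrightarrow> coord_conn P G (\<lambda>p. \<Sum>j\<in>J. y j p) p = (\<Sum>j\<in>J. coord_conn P G (y j) p)"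
  by (induction J rule: finite_induct) (simp_all add: coord_conn_zero coord_conn_add)

text \<open>
  Integration by parts: modulo derivatives, the operator \<open>\<nabla>\<close> acting on the vector can be moved to
  the scalar \<open>c\<close> at the price of a sign.
\<close>

lemma iterated_coord_conn_integration_by_parts:
  fixes e :: "'p \<Rightarrow> 'k::field_char_0 fls"
  shows "\<exists>x. \<forall>p. c * (coord_conn P G ^^ i) e p - (- 1) ^ i * (fls_deriv ^^ i) c * e p = coord_conn P G x p"
proof (induction i arbitrary: c)
  case 0
  show ?case by (intro exI[of _ "\<lambda>_. 0"]) (simp add: coord_conn_zero)
next
  case (Suc i)
  let ?y = "(coord_conn P G ^^ i) e"
  from Suc[of "fls_deriv c"] obtain x where
    x: "\<And>p. fls_deriv c * ?y p - (- 1) ^ i * (fls_deriv ^^ i) (fls_deriv c) * e p = coord_conn P G x p" by blast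
  have "c * (coord_conn P G ^^ Suc i) e p - (- 1) ^ Suc i * (fls_deriv ^^ Suc i) c * e p
      = coord_conn P G (\<lambda>p. c * ?y p - x p) p" for p
    unfolding coord_conn_diff coord_conn_scale x[symmetric]
    by (simp add: funpow_swap1 algebra_simps)
  then show ?case by blast
qed

text \<open>
  By additivity it suffices to treat a multiple \<open>u e\<close> of a basis vector.  There are more iterated
  derivatives of \<open>e\<close> than coordinates, hence a relation \<open>\<Sum> a\<^sub>i \<nabla>\<^sup>i e = 0\<close>, and integration by parts
  makes \<open>Q(c) e\<close> exact for the adjoint operator \<open>Q\<close>, which reaches \<open>u\<close> up to a Laurent polynomial.
\<close>

lemma coord_conn_onto_modulo_polynomials:
  fixes y :: "'p \<Rightarrow> 'k::field_char_0 fls"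
  assumes P: "finite P"
  shows "\<exists>x. \<forall>p\<in>P. \<exists>L. \<forall>l\<ge>L. (y p - coord_conn P G x p) $$ l = 0"
proof -
  have unit: "\<exists>x r. (\<exists>L. \<forall>l\<ge>L. r $$ l = 0) \<and>
      (\<forall>p\<in>P. (if p = p0 then u else 0) - coord_conn P G x p = (if p = p0 then r else 0))"
    for p0 :: 'p and u :: "'k fls"
  proof -
    define e :: "'p \<Rightarrow> 'k fls" where "e p = (if p = p0 then 1 else 0)" for p
    define n where "n = card P"
    have "card P < card {..n}" by (simp add: n_def)
    from underdetermined_system_solvable[OF P _ this, of "\<lambda>i. (coord_conn P G ^^ i) e"]
    obtain a where a: "\<exists>i\<le>n. a i \<noteq> 0"
      "\<And>p. p \<in> P \<Longrightarrow> (\<Sum>i\<le>n. a i * (coord_conn P G ^^ i) e p) = 0" by auto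
    from adjoint_operator_onto_modulo_polynomials[OF a(1), of u] obtain c L where
      c: "\<And>l. l \<ge> L \<Longrightarrow> (u - (\<Sum>i\<le>n. (- 1) ^ i * (fls_deriv ^^ i) (a i * c))) $$ l = 0" by blast
    define Q where "Q = (\<Sum>i\<le>n. (- 1) ^ i * (fls_deriv ^^ i) (a i * c))"
    have "\<forall>i. \<exists>x. \<forall>p. (a i * c) * (coord_conn P G ^^ i) e p
        - (- 1) ^ i * (fls_deriv ^^ i) (a i * c) * e p = coord_conn P G x p"
      using iterated_coord_conn_integration_by_parts by blast
    then obtain x where x: "\<And>i p. coord_conn P G (x i) p = (a i * c) * (coord_conn P G ^^ i) e p
        - (- 1) ^ i * (fls_deriv ^^ i) (a i * c) * e p" by metis
    have "coord_conn P G (\<lambda>p. \<Sum>i\<le>n. - x i p) p = Q * e p" if "p \<in> P" for p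
    proof -
      have "coord_conn P G (\<lambda>p. - x i p) p = - coord_conn P G (x i) p" for i
        using coord_conn_diff[of P G "\<lambda>_. 0" "x i" p] by (simp add: coord_conn_zero)
      then have "coord_conn P G (\<lambda>p. \<Sum>i\<le>n. - x i p) p = (\<Sum>i\<le>n. - coord_conn P G (x i) p)"
        by (simp add: coord_conn_sum)
      also have "\<dots> = Q * e p - c * (\<Sum>i\<le>n. a i * (coord_conn P G ^^ i) e p)"
        by (simp add: x Q_def sum_distrib_left sum_distrib_right sum_subtractf mult_ac)
      finally show ?thesis using a(2)[OF that] by simp
    qed
    then show ?thesis using c unfolding Q_def[symmetric]
      by (intro exI[of _ "\<lambda>p. \<Sum>i\<le>n. - x i p"] exI[of _ "u - Q"]) (auto simp: e_def)
  qed
  have "\<forall>p0. \<exists>x r. (\<exists>L. \<forall>l\<ge>L. r $$ l = 0) \<and>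
      (\<forall>p\<in>P. (if p = p0 then y p0 else 0) - coord_conn P G x p = (if p = p0 then r else 0))"
    using unit by blast
  then obtain x r where r: "\<And>p0. \<exists>L. \<forall>l\<ge>L. r p0 $$ l = 0"
    and x: "\<And>p0 p. p \<in> P \<Longrightarrow> (if p = p0 then y p0 else 0) - coord_conn P G (x p0) p = (if p = p0 then r p0 else 0)"
    by metis
  have "y p - coord_conn P G (\<lambda>p. \<Sum>p0\<in>P. x p0 p) p = r p" if "p \<in> P" for p
  proof -
    have "y p - coord_conn P G (\<lambda>p. \<Sum>p0\<in>P. x p0 p) p
        = (\<Sum>p0\<in>P. (if p = p0 then y p0 else 0) - coord_conn P G (x p0) p)"
      using P that by (simp add: coord_conn_sum sum_subtractf)
    also have "\<dots> = r p" using P that by (simp add: x)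
    finally show ?thesis .
  qed
  then show ?thesis using r by (intro exI[of _ "\<lambda>p. \<Sum>p0\<in>P. x p0 p"]) simp
qed

text \<open>
  Euler characteristic 0 over \<open>A\<close> for the connection with matrix \<open>G\<close>: the \<open>u j\<close> are linearly
  independent horizontal vectors, the classes of the \<open>w j\<close> span the cokernel, and there are equally
  many of both.
\<close>

definition coord_index_zero_bases ::
    "'k::field fls set \<Rightarrow> 'p set \<Rightarrow> ('p \<Rightarrow> 'p \<Rightarrow> 'k fls) \<Rightarrow> nat
      \<Rightarrow> (nat \<Rightarrow> 'p \<Rightarrow> 'k fls) \<Rightarrow> (nat \<Rightarrow> 'p \<Rightarrow> 'k fls) \<Rightarrow> bool" where
  "coord_index_zero_bases A P G d u w \<longleftrightarrow>
     (\<forall>j<d. \<forall>p\<in>P. u j p \<in> A \<and> coord_conn P G (u j) p = 0) \<and>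
     (\<forall>k. (\<forall>p\<in>P. (\<Sum>j<d. fls_const (k j) * u j p) = 0) \<longrightarrow> (\<forall>j<d. k j = 0)) \<and>
     (\<forall>y. (\<forall>p\<in>P. y p \<in> A) \<longrightarrow> (\<exists>k z. (\<forall>p\<in>P. z p \<in> A) \<and>
        (\<forall>p\<in>P. y p = (\<Sum>j<d. fls_const (k j) * w j p) + coord_conn P G z p)))"

definition coord_index_zero ::
    "'k::field fls set \<Rightarrow> 'p set \<Rightarrow> ('p \<Rightarrow> 'p \<Rightarrow> 'k fls) \<Rightarrow> bool" where
  "coord_index_zero A P G \<longleftrightarrow> (\<exists>d u w. coord_index_zero_bases A P G d u w)"

section \<open>The residue pairing\<close>

definition residue_pairing :: "'p set \<Rightarrow> ('p \<Rightarrow> 'k::field fls) \<Rightarrow> ('p \<Rightarrow> 'k fls) \<Rightarrow> 'k" where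
  "residue_pairing P \<phi> y = (\<Sum>p\<in>P. \<phi> p * y p) $$ -1"

text \<open>
  If \<open>\<phi>\<close> is horizontal for the dual connection, then \<open>\<phi> \<cdot> \<nabla> y\<close> is the derivative of \<open>\<phi> \<cdot> y\<close>, and
  derivatives have no residue.
\<close>

lemma residue_pairing_horizontal:
  assumes "finite P" "\<And>p. p \<in> P \<Longrightarrow> coord_conn P (dual_matrix G) \<phi> p = 0"
  shows "residue_pairing P \<phi> (coord_conn P G y) = 0"
proof -
  have d: "fls_deriv (\<phi> p) = (\<Sum>q\<in>P. G q p * \<phi> q)" if "p \<in> P" for p
    using assms(2)[OF that] by (simp add: coord_conn_def sum_negf)
  have "(\<Sum>p\<in>P. fls_deriv (\<phi> p) * y p) = (\<Sum>p\<in>P. \<Sum>q\<in>P. G q p * \<phi> q * y p)"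
    by (intro sum.cong) (simp_all add: d sum_distrib_right)
  also have "\<dots> = (\<Sum>q\<in>P. \<phi> q * (\<Sum>p\<in>P. G q p * y p))"
    by (subst sum.swap) (simp add: sum_distrib_left mult_ac)
  finally have "(\<Sum>p\<in>P. \<phi> p * coord_conn P G y p) = fls_deriv (\<Sum>p\<in>P. \<phi> p * y p)"
    using assms(1) by (simp add: coord_conn_def fls_deriv_sum sum.distrib distrib_left)
  then show ?thesis by (simp add: residue_pairing_def)
qed

lemma residue_pairing_cong:
  "(\<And>p. p \<in> P \<Longrightarrow> \<phi> p = \<phi>' p) \<Longrightarrow> (\<And>p. p \<in> P \<Longrightarrow> y p = y' p) \<Longrightarrow>
    residue_pairing P \<phi> y = residue_pairing P \<phi>' y'"
  by (simp add: residue_pairing_def)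

lemma residue_pairing_sum_right:
  "finite J \<Longrightarrow> residue_pairing P \<phi> (\<lambda>p. \<Sum>j\<in>J. fls_const (k j) * w j p)
     = (\<Sum>j\<in>J. k j * residue_pairing P \<phi> (w j))"
  by (simp add: residue_pairing_def fls_nth_sum sum_distrib_left mult.left_commute[of _ "fls_const _"])
     (rule sum.swap)

lemma residue_pairing_sum_left:
  "finite J \<Longrightarrow> residue_pairing P (\<lambda>p. \<Sum>j\<in>J. fls_const (k j) * u j p) y
     = (\<Sum>j\<in>J. k j * residue_pairing P (u j) y)"
  by (simp add: residue_pairing_def fls_nth_sum sum_distrib_left sum_distrib_right mult.assoc)
     (rule sum.swap)

lemma residue_pairing_add_right:
  "residue_pairing P \<phi> (\<lambda>p. x p + y p) = residue_pairing P \<phi> x + residue_pairing P \<phi> y"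
  by (simp add: residue_pairing_def sum.distrib distrib_left)

lemma residue_pairing_diff_left:
  "residue_pairing P (\<lambda>p. \<phi> p - \<psi> p) y = residue_pairing P \<phi> y - residue_pairing P \<psi> y"
  by (simp add: residue_pairing_def sum_subtractf left_diff_distrib)

text \<open>
  Pairing with monomials reads off the coefficients of \<open>\<phi>\<close>.
\<close>

lemma residue_pairing_nondegenerate:
  assumes "finite P" and A: "0 \<in> A" "\<And>n. fls_X_intpow n \<in> A"
    and 0: "\<And>y. (\<And>p. p \<in> P \<Longrightarrow> y p \<in> A) \<Longrightarrow> residue_pairing P \<phi> y = 0"
    and p: "p \<in> P"
  shows "\<phi> p = 0"
proof (rule fls_eqI)
  fix n
  let ?y = "\<lambda>q. if q = p then fls_X_intpow (- n - 1) else 0"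
  have "fls_X_intpow (- n - 1) \<in> A" by (rule A)
  then have "residue_pairing P \<phi> ?y = 0" using A(1) by (intro 0) auto
  moreover have "(\<Sum>q\<in>P. \<phi> q * ?y q) = (\<Sum>q\<in>P. if q = p then \<phi> p * fls_X_intpow (- n - 1) else 0)"
    by (intro sum.cong) auto
  moreover have "(\<phi> p * fls_X_intpow (- n - 1)) $$ -1 = \<phi> p $$ n"
    by (subst fls_X_intpow_times_conv_shift(2)) simp
  ultimately show "\<phi> p $$ n = 0 $$ n"
    using assms(1) p by (simp add: residue_pairing_def)
qed

lemma horizontal_dual_vanishing_on_complement:
  assumes P: "finite P" and A: "0 \<in> A" "\<And>n. fls_X_intpow n \<in> A"
    and \<phi>: "\<And>p. p \<in> P \<Longrightarrow> coord_conn P (dual_matrix G) \<phi> p = 0"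
    and w: "\<And>y. (\<forall>p\<in>P. y p \<in> A) \<Longrightarrow> (\<exists>k z.
        (\<forall>p\<in>P. y p = (\<Sum>j<d. fls_const (k j) * w j p) + coord_conn P G z p))"
    and 0: "\<And>j. j < (d::nat) \<Longrightarrow> residue_pairing P \<phi> (w j) = 0"
    and p: "p \<in> P"
  shows "\<phi> p = 0"
proof (rule residue_pairing_nondegenerate[OF P A _ p])
  fix y :: "'a \<Rightarrow> 'b fls"
  assume "\<And>p. p \<in> P \<Longrightarrow> y p \<in> A"
  then obtain k z where y: "\<forall>p\<in>P. y p = (\<Sum>j<d. fls_const (k j) * w j p) + coord_conn P G z p"
    using w[of y] by blast
  have "residue_pairing P \<phi> y = residue_pairing P \<phi> (\<lambda>p. (\<Sum>j<d. fls_const (k j) * w j p) + coord_conn P G z p)"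
    using y by (intro residue_pairing_cong) auto
  also have "\<dots> = 0"
    using 0 by (simp add: residue_pairing_add_right residue_pairing_sum_right residue_pairing_horizontal[OF P \<phi>])
  finally show "residue_pairing P \<phi> y = 0" .
qed

text \<open>
  A horizontal dual vector that is orthogonal to all \<open>w i\<close> is orthogonal to everything over \<open>A\<close>,
  hence 0.  So the rows of the pairing matrix are independent, and there are at most as many of them
  as columns.  The \<open>u j\<close> may have formal coordinates.
\<close>

lemma residue_pairing_dimension_bound:
  assumes P: "finite P" and A: "0 \<in> A" "\<And>n. fls_X_intpow n \<in> A"
    and u: "\<And>j p. j < (e::nat) \<Longrightarrow> p \<in> P \<Longrightarrow> coord_conn P (dual_matrix G) (u j) p = 0"
    and indep: "\<And>k. (\<forall>p\<in>P. (\<Sum>j<e. fls_const (k j) * u j p) = 0) \<Longrightarrow> \<forall>j<e. k j = 0"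
    and w: "\<And>y. (\<forall>p\<in>P. y p \<in> A) \<Longrightarrow> (\<exists>k z.
        (\<forall>p\<in>P. y p = (\<Sum>j<d. fls_const (k j) * w j p) + coord_conn P G z p))"
  shows residue_pairing_independent:
      "\<And>k. \<forall>i<d. (\<Sum>j<e. k j * residue_pairing P (u j) (w i)) = 0 \<Longrightarrow> \<forall>j<e. k j = 0"
    and "e \<le> (d::nat)"
proof -
  show ind: "\<forall>j<e. k j = 0" if k: "\<forall>i<d. (\<Sum>j<e. k j * residue_pairing P (u j) (w i)) = 0" for k
  proof -
    define \<phi> where "\<phi> p = (\<Sum>j<e. fls_const (k j) * u j p)" for p
    have hor: "coord_conn P (dual_matrix G) \<phi> p = 0" if "p \<in> P" for p
      unfolding \<phi>_def using u[OF _ that] by (simp add: coord_conn_sum coord_conn_scale)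
    have "\<phi> p = 0" if "p \<in> P" for p
      by (rule horizontal_dual_vanishing_on_complement[OF P A hor w _ that])
         (use k in \<open>simp_all add: \<phi>_def[abs_def] residue_pairing_sum_left\<close>)
    then show ?thesis using indep[of k] by (simp add: \<phi>_def)
  qed
  show "e \<le> d"
  proof (rule ccontr)
    assume "\<not> e \<le> d"
    then have "card {..<d} < card {..<e}" by simp
    from underdetermined_system_solvable[OF _ _ this, of "\<lambda>j i. residue_pairing P (u j) (w i)"]
    show False using ind by (metis finite_lessThan lessThan_iff)
  qed
qed

text \<open>
  The dimension bound, applied to \<open>G\<close> and to its dual, shows that the pairing matrix of the
  horizontal \<open>u'\<close> for the dual of \<open>G\<close> with the representatives \<open>w\<close> for \<open>G\<close> is square, hence
  invertible.  A formal horizontal \<open>\<phi>\<close> then pairs with the \<open>w i\<close> like a combination of the \<open>u' j\<close> and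
  so equals it.  If a vector over \<open>A\<close> is a formal derivative, it is orthogonal to all \<open>u' j\<close>, which
  forces its components along the \<open>w i\<close> to vanish.
\<close>

lemma index_zero_comparison:
  assumes P: "finite P"
    and A: "0 \<in> A" "\<And>n. fls_X_intpow n \<in> A" "\<And>c. fls_const c \<in> A"
      "\<And>a b. a \<in> A \<Longrightarrow> b \<in> A \<Longrightarrow> a + b \<in> A" "\<And>a b. a \<in> A \<Longrightarrow> b \<in> A \<Longrightarrow> a * b \<in> A"
    and G: "coord_index_zero A P G" and G': "coord_index_zero A P (dual_matrix G)"
  shows horizontal_over_subfield:
      "\<And>\<phi> p. \<lbrakk>\<And>p. p \<in> P \<Longrightarrow> coord_conn P (dual_matrix G) \<phi> p = 0; p \<in> P\<rbrakk> \<Longrightarrow> \<phi> p \<in> A"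
    and exact_over_subfield:
      "\<And>x y. \<lbrakk>\<And>p. p \<in> P \<Longrightarrow> y p \<in> A; \<And>p. p \<in> P \<Longrightarrow> y p = coord_conn P G x p\<rbrakk> \<Longrightarrow>
        \<exists>z. (\<forall>p\<in>P. z p \<in> A) \<and> (\<forall>p\<in>P. y p = coord_conn P G z p)"
proof -
  obtain d u w where bases: "coord_index_zero_bases A P G d u w"
    using G unfolding coord_index_zero_def by blast
  have u: "\<And>j p. j < d \<Longrightarrow> p \<in> P \<Longrightarrow> u j p \<in> A" "\<And>j p. j < d \<Longrightarrow> p \<in> P \<Longrightarrow> coord_conn P G (u j) p = 0"
    and u_ind: "\<And>k. (\<forall>p\<in>P. (\<Sum>j<d. fls_const (k j) * u j p) = 0) \<Longrightarrow> \<forall>j<d. k j = 0"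
    and w: "\<And>y. (\<forall>p\<in>P. y p \<in> A) \<Longrightarrow> (\<exists>k z. (\<forall>p\<in>P. z p \<in> A) \<and>
        (\<forall>p\<in>P. y p = (\<Sum>j<d. fls_const (k j) * w j p) + coord_conn P G z p))"
    using bases unfolding coord_index_zero_bases_def by blast+
  obtain d' u' w' where bases': "coord_index_zero_bases A P (dual_matrix G) d' u' w'"
    using G' unfolding coord_index_zero_def by blast
  have u': "\<And>j p. j < d' \<Longrightarrow> p \<in> P \<Longrightarrow> u' j p \<in> A" "\<And>j p. j < d' \<Longrightarrow> p \<in> P \<Longrightarrow> coord_conn P (dual_matrix G) (u' j) p = 0"
    and u'_ind: "\<And>k. (\<forall>p\<in>P. (\<Sum>j<d'. fls_const (k j) * u' j p) = 0) \<Longrightarrow> \<forall>j<d'. k j = 0"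
    and w': "\<And>y. (\<forall>p\<in>P. y p \<in> A) \<Longrightarrow> (\<exists>k z. (\<forall>p\<in>P. z p \<in> A) \<and>
        (\<forall>p\<in>P. y p = (\<Sum>j<d'. fls_const (k j) * w' j p) + coord_conn P (dual_matrix G) z p))"
    using bases' unfolding coord_index_zero_bases_def by blast+
  have w1: "\<exists>k z. \<forall>p\<in>P. y p = (\<Sum>j<d. fls_const (k j) * w j p) + coord_conn P G z p"
    if "\<forall>p\<in>P. y p \<in> A" for y using w[OF that] by blast
  have w1': "\<exists>k z. \<forall>p\<in>P. y p = (\<Sum>j<d'. fls_const (k j) * w' j p) + coord_conn P (dual_matrix G) z p"
    if "\<forall>p\<in>P. y p \<in> A" for y using w'[OF that] by blast
  have "d' \<le> d"
    by (rule residue_pairing_dimension_bound(2)[OF P A(1,2) u'(2) u'_ind w1])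
  moreover have "d \<le> d'"
    by (rule residue_pairing_dimension_bound(2)[where G="dual_matrix G", OF P A(1,2) _ u_ind w1'])
       (use u(2) in simp)
  ultimately have d': "d' = d" by simp
  have span: "\<exists>k. \<forall>i\<in>{..<d}. g i = (\<Sum>j<d. k j * residue_pairing P (u' j) (w i))" for g
  proof (rule independent_square_family_spans)
    fix k assume "\<forall>i\<in>{..<d}. (\<Sum>j<d. k j * residue_pairing P (u' j) (w i)) = 0"
    then show "\<forall>j\<in>{..<d}. k j = 0"
      using residue_pairing_independent[where u=u' and e=d' and d=d and w=w, OF P A(1,2) u'(2) u'_ind w1]
      by (simp add: d')
  qed auto
  show "\<phi> p \<in> A" if \<phi>: "\<And>p. p \<in> P \<Longrightarrow> coord_conn P (dual_matrix G) \<phi> p = 0" and p: "p \<in> P" for \<phi> p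
  proof -
    obtain k where k: "\<And>i. i < d \<Longrightarrow> residue_pairing P \<phi> (w i) = (\<Sum>j<d. k j * residue_pairing P (u' j) (w i))"
      using span[of "\<lambda>i. residue_pairing P \<phi> (w i)"] by auto
    define \<psi> where "\<psi> p = (\<Sum>j<d. fls_const (k j) * u' j p)" for p
    have \<psi>: "coord_conn P (dual_matrix G) \<psi> p = 0" if "p \<in> P" for p
      unfolding \<psi>_def using u'(2)[OF _ that] by (simp add: coord_conn_sum coord_conn_scale d')
    have "\<phi> p - \<psi> p = 0"
    proof (rule horizontal_dual_vanishing_on_complement[where \<phi>="\<lambda>p. \<phi> p - \<psi> p", OF P A(1,2) _ w1 _ p])
      show "residue_pairing P (\<lambda>p. \<phi> p - \<psi> p) (w j) = 0" if "j < d" for j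
        using that by (simp add: residue_pairing_diff_left \<psi>_def[abs_def] residue_pairing_sum_left k)
    qed (simp_all add: coord_conn_diff \<phi> \<psi>)
    moreover have "(\<Sum>j\<in>J. fls_const (k j) * u' j p) \<in> A" if "finite J" "J \<subseteq> {..<d}" for J
      using that u'(1)[OF _ p] by (induction J rule: finite_induct) (auto intro!: A simp: d')
    then have "\<psi> p \<in> A" by (simp add: \<psi>_def)
    ultimately show ?thesis by simp
  qed
  show "\<exists>z. (\<forall>p\<in>P. z p \<in> A) \<and> (\<forall>p\<in>P. y p = coord_conn P G z p)"
    if y: "\<And>p. p \<in> P \<Longrightarrow> y p \<in> A" and x: "\<And>p. p \<in> P \<Longrightarrow> y p = coord_conn P G x p" for x y
  proof -
    obtain k z where z: "\<forall>p\<in>P. z p \<in> A"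
      "\<And>p. p \<in> P \<Longrightarrow> y p = (\<Sum>j<d. fls_const (k j) * w j p) + coord_conn P G z p"
      using w[of y] y by blast
    have 0: "(\<Sum>i<d. k i * residue_pairing P (u' j) (w i)) = 0" if "j < d" for j
    proof -
      have hor: "coord_conn P (dual_matrix G) (u' j) p = 0" if "p \<in> P" for p
        using u'(2) \<open>j < d\<close> that by (simp add: d')
      have "residue_pairing P (u' j) y = residue_pairing P (u' j) (coord_conn P G x)"
        by (intro residue_pairing_cong x) auto
      then have "residue_pairing P (u' j) y = 0" using residue_pairing_horizontal[OF P hor] by simp
      moreover have "residue_pairing P (u' j) y
          = residue_pairing P (u' j) (\<lambda>p. (\<Sum>i<d. fls_const (k i) * w i p) + coord_conn P G z p)"
        by (intro residue_pairing_cong z) auto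
      ultimately show ?thesis
        by (simp add: residue_pairing_add_right residue_pairing_sum_right residue_pairing_horizontal[OF P hor])
    qed
    have "k i0 = 0" if "i0 < d" for i0
    proof -
      obtain c where c: "\<forall>i\<in>{..<d}. (if i = i0 then 1 else 0) = (\<Sum>j<d. c j * residue_pairing P (u' j) (w i))"
        using span[of "\<lambda>i. if i = i0 then 1 else 0"] by blast
      have "k i0 = (\<Sum>i<d. k i * (if i = i0 then 1 else 0))"
        using that by (simp add: if_distrib cong: if_cong)
      also have "\<dots> = (\<Sum>i<d. k i * (\<Sum>j<d. c j * residue_pairing P (u' j) (w i)))"
        using c by (intro sum.cong) auto
      also have "\<dots> = (\<Sum>j<d. c j * (\<Sum>i<d. k i * residue_pairing P (u' j) (w i)))"
        unfolding sum_distrib_left by (subst sum.swap) (simp add: mult_ac)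
      also have "\<dots> = 0" by (simp add: 0)
      finally show ?thesis .
    qed
    then show ?thesis using z by auto
  qed
qed

section \<open>Modules over a subfield\<close>

text \<open>
  Both Laurent series rings are subsets of one field type with its own operations, so a subfield is
  given by its carrier; \<open>UNIV\<close> gives the full field.
\<close>

abbreviation subfield_ring :: "'a::field set \<Rightarrow> 'a ring" where
  "subfield_ring A \<equiv> ring_of_type_algebra\<lparr>carrier := A\<rparr>"

lemma ring_of_type_algebra_simps [simp]:
  "carrier (ring_of_type_algebra :: 'a::field ring) = UNIV"
  "monoid.mult (ring_of_type_algebra :: 'a::field ring) = (*)"
  "monoid.one (ring_of_type_algebra :: 'a::field ring) = 1"
  "ring.zero (ring_of_type_algebra :: 'a::field ring) = 0"
  "ring.add (ring_of_type_algebra :: 'a::field ring) = (+)"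
  by (simp_all add: ring_of_type_algebra_def)

lemma subfield_ring_UNIV: "subfield_ring UNIV = ring_of_type_algebra"
  by (simp add: ring_of_type_algebra_def)

locale subfield_set =
  fixes A :: "'a::field set"
  assumes zero_in [simp, intro]: "0 \<in> A"
    and one_in [simp, intro]: "1 \<in> A"
    and add_in [simp, intro]: "a \<in> A \<Longrightarrow> b \<in> A \<Longrightarrow> a + b \<in> A"
    and uminus_in [simp, intro]: "a \<in> A \<Longrightarrow> - a \<in> A"
    and mult_in [simp, intro]: "a \<in> A \<Longrightarrow> b \<in> A \<Longrightarrow> a * b \<in> A"
    and inverse_in [simp, intro]: "a \<in> A \<Longrightarrow> inverse a \<in> A"
begin

lemma minus_in [simp, intro]: "a \<in> A \<Longrightarrow> b \<in> A \<Longrightarrow> a - b \<in> A"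
  using add_in[of a "- b"] by simp

lemma cring_subfield_ring: "cring (subfield_ring A)"
proof (intro cringI abelian_groupI comm_monoidI)
  show "\<exists>y\<in>carrier (subfield_ring A). y \<oplus>\<^bsub>subfield_ring A\<^esub> x = \<zero>\<^bsub>subfield_ring A\<^esub>"
    if "x \<in> carrier (subfield_ring A)" for x
    using that by (intro bexI[of _ "- x"]) auto
qed (auto simp: algebra_simps)

end

lemma subfield_set_UNIV: "subfield_set (UNIV :: 'a::field set)"
  by unfold_locales auto

locale subfield_module = subfield_set A + V?: module "subfield_ring A" M
  for A :: "'a::field set" and M :: "('a, 'b, 'z) module_scheme" (structure)
begin

lemma smult_in [simp, intro]: "a \<in> A \<Longrightarrow> x \<in> carrier M \<Longrightarrow> a \<odot> x \<in> carrier M"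
  using smult_closed by simp

lemma smult_add_left: "a \<in> A \<Longrightarrow> b \<in> A \<Longrightarrow> x \<in> carrier M \<Longrightarrow> (a + b) \<odot> x = a \<odot> x \<oplus> b \<odot> x"
  using smult_l_distr[of a b x] by simp

lemma smult_add_right: "a \<in> A \<Longrightarrow> x \<in> carrier M \<Longrightarrow> y \<in> carrier M \<Longrightarrow> a \<odot> (x \<oplus> y) = a \<odot> x \<oplus> a \<odot> y"
  using smult_r_distr[of a x y] by simp

lemma smult_mult: "a \<in> A \<Longrightarrow> b \<in> A \<Longrightarrow> x \<in> carrier M \<Longrightarrow> (a * b) \<odot> x = a \<odot> (b \<odot> x)"
  using smult_assoc1[of a b x] by simp

lemma smult_1 [simp]: "x \<in> carrier M \<Longrightarrow> 1 \<odot> x = x"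
  using smult_one[of x] by simp

lemma smult_0 [simp]: "x \<in> carrier M \<Longrightarrow> 0 \<odot> x = \<zero>"
  using smult_l_null[of x] by simp

lemma smult_uminus: "a \<in> A \<Longrightarrow> x \<in> carrier M \<Longrightarrow> (- a) \<odot> x = \<ominus> (a \<odot> x)"
proof -
  assume a: "a \<in> A" and x: "x \<in> carrier M"
  then have "(- a) \<odot> x \<oplus> a \<odot> x = \<zero>" by (simp add: smult_add_left[symmetric])
  then show ?thesis using a x by (simp add: V.M.minus_equality)
qed

lemma smult_minus_right: "a \<in> A \<Longrightarrow> x \<in> carrier M \<Longrightarrow> a \<odot> (\<ominus> x) = \<ominus> (a \<odot> x)"
  using smult_r_minus[of a x] by simp

definition lincomb :: "'i set \<Rightarrow> ('i \<Rightarrow> 'b) \<Rightarrow> ('i \<Rightarrow> 'a) \<Rightarrow> 'b" where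
  "lincomb I e c = (\<Oplus>i\<in>I. c i \<odot> e i)"

lemma lincomb_closed [simp, intro]: "e \<in> I \<rightarrow> carrier M \<Longrightarrow> c \<in> I \<rightarrow> A \<Longrightarrow> lincomb I e c \<in> carrier M"
  unfolding lincomb_def by (intro V.M.finsum_closed) auto

lemma lincomb_cong:
  "e \<in> I \<rightarrow> carrier M \<Longrightarrow> c \<in> I \<rightarrow> A \<Longrightarrow> (\<And>i. i \<in> I \<Longrightarrow> c i = c' i) \<Longrightarrow> lincomb I e c = lincomb I e c'"
  unfolding lincomb_def by (intro V.M.finsum_cong') (auto simp: Pi_iff)

lemma lincomb_insert:
  "finite I \<Longrightarrow> i \<notin> I \<Longrightarrow> e \<in> insert i I \<rightarrow> carrier M \<Longrightarrow> c \<in> insert i I \<rightarrow> A \<Longrightarrow>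
    lincomb (insert i I) e c = c i \<odot> e i \<oplus> lincomb I e c"
  unfolding lincomb_def by (intro V.M.finsum_insert) auto

lemma lincomb_empty [simp]: "lincomb {} e c = \<zero>"
  by (simp add: lincomb_def)

lemma lincomb_add:
  assumes "finite I" "e \<in> I \<rightarrow> carrier M" "c \<in> I \<rightarrow> A" "c' \<in> I \<rightarrow> A"
  shows "lincomb I e (\<lambda>i. c i + c' i) = lincomb I e c \<oplus> lincomb I e c'"
proof -
  have "lincomb I e (\<lambda>i. c i + c' i) = (\<Oplus>i\<in>I. c i \<odot> e i \<oplus> c' i \<odot> e i)"
    unfolding lincomb_def using assms
    by (intro V.M.finsum_cong' refl) (auto intro!: smult_add_left V.M.add.m_closed smult_in dest: Pi_mem)
  also have "\<dots> = lincomb I e c \<oplus> lincomb I e c'"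
    unfolding lincomb_def using assms by (intro V.M.finsum_addf) auto
  finally show ?thesis .
qed

lemma lincomb_smult:
  assumes "finite I" "e \<in> I \<rightarrow> carrier M" "c \<in> I \<rightarrow> A" "a \<in> A"
  shows "lincomb I e (\<lambda>i. a * c i) = a \<odot> lincomb I e c"
proof -
  have "a \<odot> lincomb I e c = (\<Oplus>i\<in>I. a \<odot> (c i \<odot> e i))"
    unfolding lincomb_def using assms by (intro finsum_smult_ldistr) auto
  also have "\<dots> = lincomb I e (\<lambda>i. a * c i)"
    unfolding lincomb_def using assms
    by (intro V.M.finsum_cong' refl) (auto intro!: smult_mult[symmetric] dest: Pi_mem)
  finally show ?thesis by simp
qed

lemma lincomb_zero:
  assumes "finite I" "e \<in> I \<rightarrow> carrier M"
  shows "lincomb I e (\<lambda>_. 0) = \<zero>"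
  using assms by (induction I rule: finite_induct) (auto simp: lincomb_insert)

lemma lincomb_unit:
  assumes "finite I" "e \<in> I \<rightarrow> carrier M" "i \<in> I"
  shows "lincomb I e (\<lambda>k. if k = i then 1 else 0) = e i"
proof -
  have "lincomb I e (\<lambda>k. if k = i then 1 else 0)
      = lincomb (insert i (I - {i})) e (\<lambda>k. if k = i then 1 else 0)"
    using assms by (simp add: insert_absorb)
  also have "\<dots> = e i \<oplus> lincomb (I - {i}) e (\<lambda>k. if k = i then 1 else 0)"
    using assms by (subst lincomb_insert) (auto dest: Pi_mem)
  also have "lincomb (I - {i}) e (\<lambda>k. if k = i then 1 else 0) = lincomb (I - {i}) e (\<lambda>_. 0)"
    using assms by (intro lincomb_cong) auto
  also have "\<dots> = \<zero>" using assms by (intro lincomb_zero) auto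
  finally show ?thesis using Pi_mem[OF assms(2,3)] by simp
qed

definition coord_basis :: "'i set \<Rightarrow> ('i \<Rightarrow> 'b) \<Rightarrow> bool" where
  "coord_basis I e \<longleftrightarrow> finite I \<and> e \<in> I \<rightarrow> carrier M \<and>
     (\<forall>x\<in>carrier M. \<exists>c\<in>I \<rightarrow> A. x = lincomb I e c) \<and>
     (\<forall>c\<in>I \<rightarrow> A. lincomb I e c = \<zero> \<longrightarrow> (\<forall>i\<in>I. c i = 0))"

definition coord :: "'i set \<Rightarrow> ('i \<Rightarrow> 'b) \<Rightarrow> 'b \<Rightarrow> 'i \<Rightarrow> 'a" where
  "coord I e x = (SOME c. c \<in> I \<rightarrow> A \<and> x = lincomb I e c)"

lemma coord_basisD:
  assumes "coord_basis I e"
  shows "finite I" "e \<in> I \<rightarrow> carrier M" "i \<in> I \<Longrightarrow> e i \<in> carrier M"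
  using assms by (auto simp: coord_basis_def)

lemma coord_in:
  assumes "coord_basis I e" "x \<in> carrier M"
  shows "coord I e x \<in> I \<rightarrow> A" "i \<in> I \<Longrightarrow> coord I e x i \<in> A" "lincomb I e (coord I e x) = x"
proof -
  have "\<exists>c\<in>I \<rightarrow> A. x = lincomb I e c"
    using assms by (simp add: coord_basis_def)
  then have "\<exists>c. c \<in> I \<rightarrow> A \<and> x = lincomb I e c" by (simp add: Bex_def)
  from someI_ex[OF this] have *: "coord I e x \<in> I \<rightarrow> A \<and> x = lincomb I e (coord I e x)"
    unfolding coord_def .
  from * show "coord I e x \<in> I \<rightarrow> A" by blast
  from * show "i \<in> I \<Longrightarrow> coord I e x i \<in> A" by blast
  from * show "lincomb I e (coord I e x) = x" by (rule conjunct2[THEN sym])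
qed

lemma coord_unique:
  assumes b: "coord_basis I e" and c: "c \<in> I \<rightarrow> A" "c' \<in> I \<rightarrow> A"
    and eq: "lincomb I e c = lincomb I e c'" and i: "i \<in> I"
  shows "c i = c' i"
proof -
  note fin = coord_basisD(1,2)[OF b]
  have "lincomb I e (\<lambda>i. c i + (- 1) * c' i) = lincomb I e c \<oplus> (- 1) \<odot> lincomb I e c'"
    using c fin lincomb_smult[OF fin c(2), of "- 1"]
    by (subst lincomb_add) (auto dest: Pi_mem)
  also have "\<dots> = \<zero>" using c fin eq by (simp add: smult_uminus V.M.r_neg)
  finally have 0: "lincomb I e (\<lambda>i. c i + (- 1) * c' i) = \<zero>" .
  have "(\<lambda>i. c i + (- 1) * c' i) \<in> I \<rightarrow> A" using c by auto
  with 0 b i have "c i + (- 1) * c' i = 0" unfolding coord_basis_def by blast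
  then show ?thesis by simp
qed

lemma coord_lincomb:
  assumes "coord_basis I e" "c \<in> I \<rightarrow> A" "i \<in> I"
  shows "coord I e (lincomb I e c) i = c i"
proof -
  have "lincomb I e c \<in> carrier M" using assms coord_basisD[OF assms(1)] by auto
  from coord_in[OF assms(1) this] show ?thesis
    by (intro coord_unique[OF assms(1) _ assms(2) _ assms(3)])
qed

lemma coord_eqI:
  assumes "coord_basis I e" "x \<in> carrier M" "y \<in> carrier M" "\<And>i. i \<in> I \<Longrightarrow> coord I e x i = coord I e y i"
  shows "x = y"
proof -
  have "lincomb I e (coord I e x) = lincomb I e (coord I e y)"
    using assms coord_basisD(2)[OF assms(1)] by (intro lincomb_cong) (auto intro!: coord_in)
  then show ?thesis using assms by (simp add: coord_in)
qed

lemma coord_add: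
  assumes b: "coord_basis I e" and x: "x \<in> carrier M" and y: "y \<in> carrier M" and i: "i \<in> I"
  shows "coord I e (x \<oplus> y) i = coord I e x i + coord I e y i"
proof -
  have "x \<oplus> y = lincomb I e (\<lambda>i. coord I e x i + coord I e y i)"
    using coord_basisD[OF b] x y b by (subst lincomb_add) (auto intro: coord_in simp: coord_in)
  moreover have "coord I e (lincomb I e (\<lambda>i. coord I e x i + coord I e y i)) i = coord I e x i + coord I e y i"
    using x y b i by (intro coord_lincomb) (auto intro: coord_in)
  ultimately show ?thesis by simp
qed

lemma coord_smult:
  assumes b: "coord_basis I e" and x: "x \<in> carrier M" and a: "a \<in> A" and i: "i \<in> I"
  shows "coord I e (a \<odot> x) i = a * coord I e x i"
proof -
  have "a \<odot> x = lincomb I e (\<lambda>i. a * coord I e x i)"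
    using coord_basisD[OF b] x b a by (subst lincomb_smult) (auto intro: coord_in simp: coord_in)
  moreover have "coord I e (lincomb I e (\<lambda>i. a * coord I e x i)) i = a * coord I e x i"
    using x b i a by (intro coord_lincomb) (auto intro: coord_in)
  ultimately show ?thesis by simp
qed

lemma coord_zero:
  assumes "coord_basis I e" "i \<in> I"
  shows "coord I e \<zero> i = 0"
  using coord_smult[OF assms(1), of "\<zero>" 0 i] assms by simp

lemma coord_uminus:
  assumes "coord_basis I e" "x \<in> carrier M" "i \<in> I"
  shows "coord I e (\<ominus> x) i = - coord I e x i"
  using coord_smult[OF assms(1,2), of "- 1" i] assms by (simp add: smult_uminus)

lemma coord_minus:
  assumes "coord_basis I e" "x \<in> carrier M" "y \<in> carrier M" "i \<in> I"
  shows "coord I e (x \<ominus> y) i = coord I e x i - coord I e y i"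
  using assms by (simp add: a_minus_def coord_add coord_uminus)

lemma coord_unit:
  assumes "coord_basis I e" "i \<in> I" "k \<in> I"
  shows "coord I e (e i) k = (if k = i then 1 else 0)"
proof -
  have "coord I e (lincomb I e (\<lambda>k. if k = i then 1 else 0)) k = (if k = i then 1 else 0)"
    using assms by (intro coord_lincomb) auto
  then show ?thesis using assms lincomb_unit[OF coord_basisD(1,2)[OF assms(1)], of i] by simp
qed

subsection \<open>Minimal generating sets\<close>

lemma lincomb_in_submodule:
  assumes H: "submodule H (subfield_ring A) M" and "finite F" "e \<in> F \<rightarrow> H" "c \<in> F \<rightarrow> A"
  shows "lincomb F e c \<in> H"
proof -
  note H' = submoduleE[OF H]
  have z: "\<zero> \<in> H" using subgroup.one_closed[OF submodule.axioms(1)[OF H]] by simp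
  show ?thesis
    using assms(2-4)
  proof (induction F rule: finite_induct)
    case (insert i F)
    have "e \<in> insert i F \<rightarrow> carrier M" using insert.prems H'(1) by auto
    then have "lincomb (insert i F) e c = c i \<odot> e i \<oplus> lincomb F e c"
      using insert by (intro lincomb_insert)
    moreover have "c i \<odot> e i \<in> H" using insert.prems by (intro H'(4)) auto
    moreover have "lincomb F e c \<in> H" using insert by auto
    ultimately show ?case by (simp add: H'(5))
  qed (use z in simp)
qed

lemma mod_span_submodule_mono:
  assumes "submodule H (subfield_ring A) M" "S \<subseteq> H"
  shows "mod_span (subfield_ring A) M S \<subseteq> H"
  using assms by (auto simp: mod_span_def)

lemma lincomb_in_mod_span:
  assumes "finite F" "F \<subseteq> S" "c \<in> F \<rightarrow> A"
  shows "lincomb F (\<lambda>b. b) c \<in> mod_span (subfield_ring A) M S"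
  unfolding mod_span_def using assms by (auto intro!: lincomb_in_submodule)

lemma lincomb_extend_zero:
  assumes "finite I" "F \<subseteq> I" "e \<in> I \<rightarrow> carrier M" "c \<in> F \<rightarrow> A"
  shows "lincomb F e c = lincomb I e (\<lambda>i. if i \<in> F then c i else 0)"
  unfolding lincomb_def
proof (rule V.M.add.finprod_mono_neutral_cong_left)
  show "\<And>i. i \<in> I - F \<Longrightarrow> (if i \<in> F then c i else 0) \<odot> e i = \<zero>"
    using assms by (auto simp: Pi_iff)
qed (use assms in \<open>auto simp: Pi_iff\<close>)

text \<open>
  The combinations of finite subsets of \<open>S\<close> form a submodule containing \<open>S\<close>.
\<close>

lemma mod_span_eq_lincomb:
  assumes S: "S \<subseteq> carrier M" and x: "x \<in> mod_span (subfield_ring A) M S"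
  shows "\<exists>F c. finite F \<and> F \<subseteq> S \<and> c \<in> F \<rightarrow> A \<and> x = lincomb F (\<lambda>b. b) c"
proof -
  define H where "H = {x. \<exists>F c. finite F \<and> F \<subseteq> S \<and> c \<in> F \<rightarrow> A \<and> x = lincomb F (\<lambda>b. b) c}"
  have HM: "H \<subseteq> carrier M" using S by (auto simp: H_def intro!: lincomb_closed)
  have smult: "a \<odot> x \<in> H" if a: "a \<in> A" and x: "x \<in> H" for a x
  proof -
    obtain F c where F: "finite F" "F \<subseteq> S" "c \<in> F \<rightarrow> A" "x = lincomb F (\<lambda>b. b) c"
      using x unfolding H_def by blast
    then have "a \<odot> x = lincomb F (\<lambda>b. b) (\<lambda>b. a * c b)"
      using a S by (subst lincomb_smult) auto
    moreover have "(\<lambda>b. a * c b) \<in> F \<rightarrow> A" using F a by auto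
    ultimately show ?thesis using F unfolding H_def by blast
  qed
  have add: "x \<oplus> y \<in> H" if x: "x \<in> H" and y: "y \<in> H" for x y
  proof -
    obtain F c where F: "finite F" "F \<subseteq> S" "c \<in> F \<rightarrow> A" "x = lincomb F (\<lambda>b. b) c"
      using x unfolding H_def by blast
    obtain F' c' where F': "finite F'" "F' \<subseteq> S" "c' \<in> F' \<rightarrow> A" "y = lincomb F' (\<lambda>b. b) c'"
      using y unfolding H_def by blast
    have x': "x = lincomb (F \<union> F') (\<lambda>b. b) (\<lambda>i. if i \<in> F then c i else 0)"
      unfolding F(4) using F F' S by (intro lincomb_extend_zero) auto
    have y': "y = lincomb (F \<union> F') (\<lambda>b. b) (\<lambda>i. if i \<in> F' then c' i else 0)"
      unfolding F'(4) using F F' S by (intro lincomb_extend_zero) auto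
    have "x \<oplus> y = lincomb (F \<union> F') (\<lambda>b. b)
        (\<lambda>i. (if i \<in> F then c i else 0) + (if i \<in> F' then c' i else 0))"
      unfolding x' y' using F F' S by (subst lincomb_add) auto
    moreover have "(\<lambda>i. (if i \<in> F then c i else 0) + (if i \<in> F' then c' i else 0)) \<in> F \<union> F' \<rightarrow> A"
      using F F' by (auto simp: Pi_iff)
    moreover have "finite (F \<union> F')" "F \<union> F' \<subseteq> S" using F F' by auto
    ultimately show ?thesis unfolding H_def by blast
  qed
  have "submodule H (subfield_ring A) M"
  proof (rule submoduleI)
    show "\<zero> \<in> H" unfolding H_def by (intro CollectI exI[of _ "{}"]) auto
    show "\<ominus> a \<in> H" if "a \<in> H" for a
      using smult[OF _ that, of "- 1"] that HM by (auto simp: smult_uminus)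
  qed (use HM smult add in auto)
  moreover have "S \<subseteq> H"
  proof
    fix s assume "s \<in> S"
    then show "s \<in> H" unfolding H_def using S lincomb_unit[of "{s}" "\<lambda>b. b" s]
      by (intro CollectI exI[of _ "{s}"] exI[of _ "\<lambda>k. if k = s then 1 else 0"]) auto
  qed
  ultimately have "x \<in> H" using mod_span_submodule_mono x by blast
  then show ?thesis by (simp add: H_def)
qed

lemma mod_span_mono: "S \<subseteq> S' \<Longrightarrow> mod_span (subfield_ring A) M S \<subseteq> mod_span (subfield_ring A) M S'"
  by (auto simp: mod_span_def)

lemma submodule_mod_span:
  assumes "S \<subseteq> carrier M"
  shows "submodule (mod_span (subfield_ring A) M S) (subfield_ring A) M"
proof (rule submoduleI)
  have sub: "submodule H (subfield_ring A) M \<Longrightarrow> \<zero> \<in> H" for H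
    using subgroup.one_closed[OF submodule.axioms(1)] by fastforce
  show "mod_span (subfield_ring A) M S \<subseteq> carrier M"
    using assms carrier_is_submodule by (auto simp: mod_span_def)
qed (auto simp: mod_span_def intro: submoduleE subgroup.one_closed[OF submodule.axioms(1), simplified])

text \<open>
  A basis in the sense of minimal generating sets is finite here: each of finitely many generators
  involves finitely many elements of \<open>B\<close>, and by minimality these are all of \<open>B\<close>.  A nontrivial
  relation could be solved for one element of \<open>B\<close>, against minimality.
\<close>

lemma mod_basis_coord_basis:
  assumes fd: "fin_dim (subfield_ring A) M" and B: "mod_basis (subfield_ring A) M B"
  shows "coord_basis B (\<lambda>b. b)"
proof -
  let ?span = "mod_span (subfield_ring A) M"
  have BM: "B \<subseteq> carrier M" and Bspan: "?span B = carrier M"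
    and Bmin: "\<And>b. b \<in> B \<Longrightarrow> b \<notin> ?span (B - {b})"
    using B by (auto simp: mod_basis_def)
  obtain S0 where S0: "finite S0" "S0 \<subseteq> carrier M" "?span S0 = carrier M"
    using fd by (auto simp: fin_dim_def mod_basis_def)
  have "\<forall>s\<in>S0. \<exists>F c. finite F \<and> F \<subseteq> B \<and> c \<in> F \<rightarrow> A \<and> s = lincomb F (\<lambda>b. b) c"
    using mod_span_eq_lincomb[OF BM] S0 Bspan by blast
  then obtain F where F: "\<And>s. s \<in> S0 \<Longrightarrow> finite (F s) \<and> F s \<subseteq> B \<and> s \<in> ?span (F s)"
    using lincomb_in_mod_span by (metis order_refl)
  define F' where "F' = (\<Union>s\<in>S0. F s)"
  have F': "finite F'" "F' \<subseteq> B" using F S0(1) by (auto simp: F'_def)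
  have "S0 \<subseteq> ?span F'"
  proof
    fix s assume s: "s \<in> S0"
    then have "?span (F s) \<subseteq> ?span F'" by (intro mod_span_mono) (auto simp: F'_def)
    then show "s \<in> ?span F'" using F[OF s] by blast
  qed
  then have F'_span: "carrier M \<subseteq> ?span F'"
    using mod_span_submodule_mono[OF submodule_mod_span, of F' S0] F'(2) BM S0(3) by auto
  have "B \<subseteq> F'"
  proof
    fix b assume b: "b \<in> B"
    show "b \<in> F'"
    proof (rule ccontr)
      assume "b \<notin> F'"
      then have "?span F' \<subseteq> ?span (B - {b})" using F' by (intro mod_span_mono) auto
      then show False using Bmin[OF b] F'_span b BM by blast
    qed
  qed
  then have fin: "finite B" using F' finite_subset by blast
  have span: "\<exists>c\<in>B \<rightarrow> A. x = lincomb B (\<lambda>b. b) c" if x: "x \<in> carrier M" for x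
  proof -
    obtain F c where F: "finite F" "F \<subseteq> B" "c \<in> F \<rightarrow> A" "x = lincomb F (\<lambda>b. b) c"
      using mod_span_eq_lincomb[OF BM] Bspan x by metis
    have "x = lincomb B (\<lambda>b. b) (\<lambda>i. if i \<in> F then c i else 0)"
      unfolding F(4) using F fin BM by (intro lincomb_extend_zero) auto
    moreover have "(\<lambda>i. if i \<in> F then c i else 0) \<in> B \<rightarrow> A" using F by auto
    ultimately show ?thesis by blast
  qed
  have indep: "c b = 0" if c: "c \<in> B \<rightarrow> A" and 0: "lincomb B (\<lambda>b. b) c = \<zero>" and b: "b \<in> B" for c b
  proof (rule ccontr)
    assume nz: "c b \<noteq> 0"
    have cb: "c b \<in> A" "b \<in> carrier M" using c b BM by auto
    have c': "c \<in> B - {b} \<rightarrow> A" "(\<lambda>i. i) \<in> B - {b} \<rightarrow> carrier M" using c BM by auto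
    let ?y = "lincomb (B - {b}) (\<lambda>b. b) c"
    have y: "?y \<in> carrier M" using c' by (intro lincomb_closed)
    have "lincomb (insert b (B - {b})) (\<lambda>b. b) c = c b \<odot> b \<oplus> ?y"
      using fin c b BM by (intro lincomb_insert) auto
    then have "c b \<odot> b \<oplus> ?y = \<zero>" using 0 b by (simp add: insert_absorb)
    then have "c b \<odot> b = \<ominus> ?y" using cb y by (simp add: V.M.minus_equality)
    then have "b = (- inverse (c b)) \<odot> ?y"
      using cb y nz smult_mult[of "inverse (c b)" "c b" b]
      by (simp add: smult_uminus smult_minus_right)
    also have "\<dots> = lincomb (B - {b}) (\<lambda>b. b) (\<lambda>i. - inverse (c b) * c i)"
      using fin c' cb by (intro lincomb_smult[symmetric]) auto
    also have "\<dots> \<in> ?span (B - {b})"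
      using fin c' cb by (intro lincomb_in_mod_span) (auto simp: Pi_iff)
    finally show False using Bmin[OF b] by simp
  qed
  show ?thesis unfolding coord_basis_def using fin BM span indep by auto
qed

end

section \<open>Quotients\<close>

context abelian_subgroup
begin

lemma coset_eq_iff:
  assumes "x \<in> carrier G" "y \<in> carrier G"
  shows "H +> x = H +> y \<longleftrightarrow> x \<ominus> y \<in> H"
proof
  assume "H +> x = H +> y"
  then have "x \<in> H +> y" using a_rcos_self[OF assms(1)] by simp
  then show "x \<ominus> y \<in> H" using assms by (simp add: a_rcos_module a_minus_def)
next
  assume "x \<ominus> y \<in> H"
  then have "x \<in> H +> y" using assms by (simp add: a_rcos_module a_minus_def)
  then show "H +> x = H +> y" using a_repr_independence'[of x y] assms by simp
qed

text \<open>
  Quotients define induced maps by this formula on cosets; the result is a coset again because \<open>h\<close>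
  respects the two subgroups.
\<close>

lemma induced_map_on_coset:
  assumes h: "\<And>x. x \<in> carrier G \<Longrightarrow> h x \<in> carrier G'"
    and add: "\<And>x y. x \<in> carrier G \<Longrightarrow> y \<in> carrier G \<Longrightarrow> h (x \<oplus> y) = h x \<oplus>\<^bsub>G'\<^esub> h y"
    and H': "abelian_subgroup H' G'" and HH': "\<And>x. x \<in> H \<Longrightarrow> h x \<in> H'"
    and x: "x \<in> carrier G"
  shows "H' <+>\<^bsub>G'\<^esub> (h ` (H +> x)) = H' +>\<^bsub>G'\<^esub> h x"
proof -
  interpret H': abelian_subgroup H' G' by fact
  have sub: "h ` (H +> x) \<subseteq> H' +>\<^bsub>G'\<^esub> h x"
  proof clarify
    fix y assume "y \<in> H +> x"
    then obtain k where k: "k \<in> H" "y = k \<oplus> x" by (auto simp: a_r_coset_def')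
    then have "h y = h k \<oplus>\<^bsub>G'\<^esub> h x" using add x by auto
    then show "h y \<in> H' +>\<^bsub>G'\<^esub> h x" using HH'[OF k(1)] by (auto simp: a_r_coset_def')
  qed
  have "H' <+>\<^bsub>G'\<^esub> (H' +>\<^bsub>G'\<^esub> h x) = H' +>\<^bsub>G'\<^esub> h x"
    using h[OF x] by (intro H'.rcosets_add_eq H'.a_rcosetsI) auto
  moreover have "H' <+>\<^bsub>G'\<^esub> (h ` (H +> x)) \<subseteq> H' <+>\<^bsub>G'\<^esub> (H' +>\<^bsub>G'\<^esub> h x)"
    using sub by (auto simp: set_add_def')
  moreover have "H' +>\<^bsub>G'\<^esub> h x \<subseteq> H' <+>\<^bsub>G'\<^esub> (h ` (H +> x))"
  proof
    fix z assume "z \<in> H' +>\<^bsub>G'\<^esub> h x"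
    then obtain k where "k \<in> H'" "z = k \<oplus>\<^bsub>G'\<^esub> h x" by (auto simp: a_r_coset_def')
    then show "z \<in> H' <+>\<^bsub>G'\<^esub> (h ` (H +> x))"
      unfolding set_add_def' using a_rcos_self[OF x] by blast
  qed
  ultimately show ?thesis by blast
qed

lemma a_rcosets_cases:
  assumes "C \<in> a_rcosets H"
  obtains x where "x \<in> carrier G" "C = H +> x"
  using assms by (auto simp: A_RCOSETS_def')

lemma some_in_coset:
  assumes "x \<in> carrier G"
  shows "(SOME y. y \<in> H +> x) \<in> carrier G" "H +> (SOME y. y \<in> H +> x) = H +> x"
proof -
  have *: "(SOME y. y \<in> H +> x) \<in> H +> x" using a_rcos_self[OF assms] by (rule someI)
  then show "(SOME y. y \<in> H +> x) \<in> carrier G"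
    using a_elemrcos_carrier[OF assms] by blast
  show "H +> (SOME y. y \<in> H +> x) = H +> x" using a_repr_independence'[OF * assms] by simp
qed

end

lemma quot_module_simps [simp]:
  "carrier (quot_module M U) = a_rcosets\<^bsub>M\<^esub> U"
  "ring.zero (quot_module M U) = U"
  "ring.add (quot_module M U) = set_add M"
  "module.smult (quot_module M U) = (\<lambda>a C. U <+>\<^bsub>M\<^esub> ((\<lambda>x. a \<odot>\<^bsub>M\<^esub> x) ` C))"
  by (simp_all add: quot_module_def)

lemma quot_dmod_simps [simp]:
  "carrier (quot_dmod M U) = a_rcosets\<^bsub>M\<^esub> U"
  "ring.zero (quot_dmod M U) = U"
  "ring.add (quot_dmod M U) = set_add M"
  "module.smult (quot_dmod M U) = (\<lambda>a C. U <+>\<^bsub>M\<^esub> ((\<lambda>x. a \<odot>\<^bsub>M\<^esub> x) ` C))"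
  "nabla (quot_dmod M U) = (\<lambda>C. U <+>\<^bsub>M\<^esub> (nabla M ` C))"
  by (simp_all add: quot_dmod_def module.defs dmod.defs)

text \<open>
  The module axioms for \<open>M\<close> itself may fail; they are required only up to \<open>U\<close>.  This is the
  situation of the free abelian group from which a tensor product is formed.
\<close>

lemma quotient_is_module:
  fixes M :: "('a, 'b, 'z) module_scheme" and Q :: "('a, 'b set, 'y) module_scheme"
  assumes R: "cring R" and U: "abelian_subgroup U M"
    and Q: "carrier Q = a_rcosets\<^bsub>M\<^esub> U" "ring.zero Q = U" "ring.add Q = set_add M"
      "module.smult Q = (\<lambda>a C. U <+>\<^bsub>M\<^esub> ((\<lambda>x. a \<odot>\<^bsub>M\<^esub> x) ` C))"
    and smult: "\<And>a x. a \<in> carrier R \<Longrightarrow> x \<in> carrier M \<Longrightarrow> a \<odot>\<^bsub>M\<^esub> x \<in> carrier M"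
      "\<And>a x. a \<in> carrier R \<Longrightarrow> x \<in> U \<Longrightarrow> a \<odot>\<^bsub>M\<^esub> x \<in> U"
      "\<And>a x y. a \<in> carrier R \<Longrightarrow> x \<in> carrier M \<Longrightarrow> y \<in> carrier M \<Longrightarrow>
        a \<odot>\<^bsub>M\<^esub> (x \<oplus>\<^bsub>M\<^esub> y) = a \<odot>\<^bsub>M\<^esub> x \<oplus>\<^bsub>M\<^esub> a \<odot>\<^bsub>M\<^esub> y"
    and axioms: "\<And>a b x. a \<in> carrier R \<Longrightarrow> b \<in> carrier R \<Longrightarrow> x \<in> carrier M \<Longrightarrow>
        U +>\<^bsub>M\<^esub> ((a \<oplus>\<^bsub>R\<^esub> b) \<odot>\<^bsub>M\<^esub> x) = U +>\<^bsub>M\<^esub> (a \<odot>\<^bsub>M\<^esub> x \<oplus>\<^bsub>M\<^esub> b \<odot>\<^bsub>M\<^esub> x)"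
      "\<And>a b x. a \<in> carrier R \<Longrightarrow> b \<in> carrier R \<Longrightarrow> x \<in> carrier M \<Longrightarrow>
        U +>\<^bsub>M\<^esub> ((a \<otimes>\<^bsub>R\<^esub> b) \<odot>\<^bsub>M\<^esub> x) = U +>\<^bsub>M\<^esub> (a \<odot>\<^bsub>M\<^esub> (b \<odot>\<^bsub>M\<^esub> x))"
      "\<And>x. x \<in> carrier M \<Longrightarrow> U +>\<^bsub>M\<^esub> (\<one>\<^bsub>R\<^esub> \<odot>\<^bsub>M\<^esub> x) = U +>\<^bsub>M\<^esub> x"
  shows "module R Q"
proof -
  interpret R: cring R by fact
  interpret U: abelian_subgroup U M by fact
  have smult_coset: "U <+>\<^bsub>M\<^esub> ((\<lambda>x. a \<odot>\<^bsub>M\<^esub> x) ` (U +>\<^bsub>M\<^esub> x)) = U +>\<^bsub>M\<^esub> (a \<odot>\<^bsub>M\<^esub> x)"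
    if "a \<in> carrier R" "x \<in> carrier M" for a x
    using that smult by (intro U.induced_map_on_coset[OF _ _ U]) auto
  have closed: "U +>\<^bsub>M\<^esub> x \<in> a_rcosets\<^bsub>M\<^esub> U" if "x \<in> carrier M" for x
    using that by (intro U.a_rcosetsI) auto
  have U0: "U = U +>\<^bsub>M\<^esub> \<zero>\<^bsub>M\<^esub>" using U.a_rcos_const[of "\<zero>\<^bsub>M\<^esub>"] by auto
  show ?thesis
  proof (rule moduleI[OF R])
    show "abelian_group Q"
    proof (rule abelian_groupI)
      show "\<zero>\<^bsub>Q\<^esub> \<in> carrier Q" using closed[of "\<zero>\<^bsub>M\<^esub>"] U0 by (simp add: Q)
      fix x assume "x \<in> carrier Q"
      then obtain x' where x: "x' \<in> carrier M" "x = U +>\<^bsub>M\<^esub> x'"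
        unfolding Q by (rule U.a_rcosets_cases)
      show "\<zero>\<^bsub>Q\<^esub> \<oplus>\<^bsub>Q\<^esub> x = x"
        using x U.a_rcos_sum[of "\<zero>\<^bsub>M\<^esub>" x'] U0 by (simp add: Q)
      have "(U +>\<^bsub>M\<^esub> (\<ominus>\<^bsub>M\<^esub> x')) \<oplus>\<^bsub>Q\<^esub> x = \<zero>\<^bsub>Q\<^esub>"
        using x U0 by (simp add: Q U.a_rcos_sum U.l_neg)
      moreover have "U +>\<^bsub>M\<^esub> (\<ominus>\<^bsub>M\<^esub> x') \<in> carrier Q" unfolding Q using x by (intro closed) simp
      ultimately show "\<exists>y\<in>carrier Q. y \<oplus>\<^bsub>Q\<^esub> x = \<zero>\<^bsub>Q\<^esub>" by blast
      fix y assume "y \<in> carrier Q"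
      then obtain y' where y: "y' \<in> carrier M" "y = U +>\<^bsub>M\<^esub> y'"
        unfolding Q by (rule U.a_rcosets_cases)
      show "x \<oplus>\<^bsub>Q\<^esub> y \<in> carrier Q" using x y by (simp add: Q U.a_rcos_sum closed)
      show "x \<oplus>\<^bsub>Q\<^esub> y = y \<oplus>\<^bsub>Q\<^esub> x" using x y by (simp add: Q U.a_rcos_sum U.a_comm)
      fix z assume "z \<in> carrier Q"
      then obtain z' where z: "z' \<in> carrier M" "z = U +>\<^bsub>M\<^esub> z'"
        unfolding Q by (rule U.a_rcosets_cases)
      show "(x \<oplus>\<^bsub>Q\<^esub> y) \<oplus>\<^bsub>Q\<^esub> z = x \<oplus>\<^bsub>Q\<^esub> (y \<oplus>\<^bsub>Q\<^esub> z)"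
        using x y z by (simp add: Q U.a_rcos_sum U.a_assoc)
    qed
  qed (auto simp: Q elim!: U.a_rcosets_cases simp: smult_coset closed smult U.a_rcos_sum axioms)
qed

lemma quotient_is_diff_module:
  fixes M :: "('a, 'b) dmod"
  assumes R: "cring R" and U: "abelian_subgroup U M"
    and smult: "\<And>a x. a \<in> carrier R \<Longrightarrow> x \<in> carrier M \<Longrightarrow> a \<odot>\<^bsub>M\<^esub> x \<in> carrier M"
      "\<And>a x. a \<in> carrier R \<Longrightarrow> x \<in> U \<Longrightarrow> a \<odot>\<^bsub>M\<^esub> x \<in> U"
      "\<And>a x y. a \<in> carrier R \<Longrightarrow> x \<in> carrier M \<Longrightarrow> y \<in> carrier M \<Longrightarrow>
        a \<odot>\<^bsub>M\<^esub> (x \<oplus>\<^bsub>M\<^esub> y) = a \<odot>\<^bsub>M\<^esub> x \<oplus>\<^bsub>M\<^esub> a \<odot>\<^bsub>M\<^esub> y"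
    and axioms: "\<And>a b x. a \<in> carrier R \<Longrightarrow> b \<in> carrier R \<Longrightarrow> x \<in> carrier M \<Longrightarrow>
        U +>\<^bsub>M\<^esub> ((a \<oplus>\<^bsub>R\<^esub> b) \<odot>\<^bsub>M\<^esub> x) = U +>\<^bsub>M\<^esub> (a \<odot>\<^bsub>M\<^esub> x \<oplus>\<^bsub>M\<^esub> b \<odot>\<^bsub>M\<^esub> x)"
      "\<And>a b x. a \<in> carrier R \<Longrightarrow> b \<in> carrier R \<Longrightarrow> x \<in> carrier M \<Longrightarrow>
        U +>\<^bsub>M\<^esub> ((a \<otimes>\<^bsub>R\<^esub> b) \<odot>\<^bsub>M\<^esub> x) = U +>\<^bsub>M\<^esub> (a \<odot>\<^bsub>M\<^esub> (b \<odot>\<^bsub>M\<^esub> x))"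
      "\<And>x. x \<in> carrier M \<Longrightarrow> U +>\<^bsub>M\<^esub> (\<one>\<^bsub>R\<^esub> \<odot>\<^bsub>M\<^esub> x) = U +>\<^bsub>M\<^esub> x"
    and nabla: "\<And>x. x \<in> carrier M \<Longrightarrow> nabla M x \<in> carrier M"
      "\<And>x. x \<in> U \<Longrightarrow> nabla M x \<in> U"
      "\<And>x y. x \<in> carrier M \<Longrightarrow> y \<in> carrier M \<Longrightarrow> nabla M (x \<oplus>\<^bsub>M\<^esub> y) = nabla M x \<oplus>\<^bsub>M\<^esub> nabla M y"
      "\<And>a x. a \<in> carrier R \<Longrightarrow> x \<in> carrier M \<Longrightarrow>
        U +>\<^bsub>M\<^esub> nabla M (a \<odot>\<^bsub>M\<^esub> x) = U +>\<^bsub>M\<^esub> (d a \<odot>\<^bsub>M\<^esub> x \<oplus>\<^bsub>M\<^esub> a \<odot>\<^bsub>M\<^esub> nabla M x)"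
    and d: "\<And>a. a \<in> carrier R \<Longrightarrow> d a \<in> carrier R"
  shows "diff_module R d (quot_dmod M U)"
proof -
  interpret U: abelian_subgroup U M by fact
  interpret Q: module R "quot_dmod M U"
    by (rule quotient_is_module[OF R U quot_dmod_simps(1-4) smult axioms])
  have smult_coset: "U <+>\<^bsub>M\<^esub> ((\<lambda>x. a \<odot>\<^bsub>M\<^esub> x) ` (U +>\<^bsub>M\<^esub> x)) = U +>\<^bsub>M\<^esub> (a \<odot>\<^bsub>M\<^esub> x)"
    if "a \<in> carrier R" "x \<in> carrier M" for a x
    using that smult by (intro U.induced_map_on_coset[OF _ _ U]) auto
  have nabla_coset: "U <+>\<^bsub>M\<^esub> (nabla M ` (U +>\<^bsub>M\<^esub> x)) = U +>\<^bsub>M\<^esub> nabla M x"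
    if "x \<in> carrier M" for x
    using that nabla by (intro U.induced_map_on_coset[OF _ _ U]) auto
  have closed: "U +>\<^bsub>M\<^esub> x \<in> a_rcosets\<^bsub>M\<^esub> U" if "x \<in> carrier M" for x
    using that by (intro U.a_rcosetsI) auto
  show ?thesis
    by unfold_locales
       (auto elim!: U.a_rcosets_cases simp: nabla_coset smult_coset closed smult nabla U.a_rcos_sum d)
qed

section \<open>Differential modules over a differential subfield\<close>

lemma lin_mapsD:
  assumes "f \<in> lin_maps R M N"
  shows "x \<in> carrier M \<Longrightarrow> f x \<in> carrier N"
    and "x \<in> carrier M \<Longrightarrow> y \<in> carrier M \<Longrightarrow> f (x \<oplus>\<^bsub>M\<^esub> y) = f x \<oplus>\<^bsub>N\<^esub> f y"
    and "a \<in> carrier R \<Longrightarrow> x \<in> carrier M \<Longrightarrow> f (a \<odot>\<^bsub>M\<^esub> x) = a \<odot>\<^bsub>N\<^esub> f x"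
    and "x \<notin> carrier M \<Longrightarrow> f x = undefined"
  using assms by (auto simp: lin_maps_def PiE_def extensional_def)

lemma lin_mapsI:
  assumes "\<And>x. x \<in> carrier M \<Longrightarrow> f x \<in> carrier N"
    and "\<And>x y. x \<in> carrier M \<Longrightarrow> y \<in> carrier M \<Longrightarrow> f (x \<oplus>\<^bsub>M\<^esub> y) = f x \<oplus>\<^bsub>N\<^esub> f y"
    and "\<And>a x. a \<in> carrier R \<Longrightarrow> x \<in> carrier M \<Longrightarrow> f (a \<odot>\<^bsub>M\<^esub> x) = a \<odot>\<^bsub>N\<^esub> f x"
    and "\<And>x. x \<notin> carrier M \<Longrightarrow> f x = undefined"
  shows "f \<in> lin_maps R M N"
  using assms by (auto simp: lin_maps_def PiE_def extensional_def)

lemma lin_maps_eqI: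
  assumes "f \<in> lin_maps R M N" "g \<in> lin_maps R M N'" "\<And>x. x \<in> carrier M \<Longrightarrow> f x = g x"
  shows "f = g"
proof
  fix x show "f x = g x"
    using assms(3) lin_mapsD(4)[OF assms(1)] lin_mapsD(4)[OF assms(2)] by (cases "x \<in> carrier M") auto
qed

lemma dmod_homD:
  assumes "f \<in> dmod_hom R M N"
  shows "f \<in> lin_maps R M N" and "x \<in> carrier M \<Longrightarrow> f (nabla M x) = nabla N (f x)"
  using assms by (auto simp: dmod_hom_def)

locale diff_subfield = subfield_set A for A :: "'a::field set" +
  fixes d :: "'a \<Rightarrow> 'a"
  assumes d_in [simp, intro]: "a \<in> A \<Longrightarrow> d a \<in> A"
    and d_add: "d (a + b) = d a + d b"
    and d_mult: "d (a * b) = d a * b + a * d b"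
begin

lemma d_0 [simp]: "d 0 = 0"
  by (metis add.right_neutral add_left_cancel d_add)

lemma d_1 [simp]: "d 1 = 0"
  by (metis add.right_neutral add_left_cancel d_mult mult.left_neutral mult.right_neutral)

lemma d_uminus: "d (- a) = - d a"
  using d_add[of a "- a"] by (simp add: eq_neg_iff_add_eq_0 add.commute)

lemma diff_subfield_UNIV: "diff_subfield UNIV d"
  by unfold_locales (simp_all add: d_add d_mult)

end

locale diff_vector_space = diff_subfield A d + D?: diff_module "subfield_ring A" d M
  for A :: "'a::field set" and d and M :: "('a, 'b) dmod" (structure)

sublocale diff_vector_space \<subseteq> subfield_module A M
  by unfold_locales

context diff_vector_space
begin

lemma nabla_in [simp, intro]: "x \<in> carrier M \<Longrightarrow> nabla M x \<in> carrier M"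
  by (rule nabla_closed)

lemma nabla_smult: "a \<in> A \<Longrightarrow> x \<in> carrier M \<Longrightarrow> nabla M (a \<odot> x) = d a \<odot> x \<oplus> a \<odot> nabla M x"
  using leibniz[of a x] by simp

lemma nabla_zero [simp]: "nabla M \<zero> = \<zero>"
  using nabla_smult[of 0 "\<zero>"] by simp

lemma nabla_uminus: "x \<in> carrier M \<Longrightarrow> nabla M (\<ominus> x) = \<ominus> nabla M x"
  using nabla_smult[of "- 1" x] by (simp add: smult_uminus d_uminus)

lemma nabla_lincomb:
  assumes "finite I" "e \<in> I \<rightarrow> carrier M" "c \<in> I \<rightarrow> A"
  shows "nabla M (lincomb I e c) = lincomb I e (\<lambda>i. d (c i)) \<oplus> lincomb I (\<lambda>i. nabla M (e i)) c"
  using assms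
proof (induction I rule: finite_induct)
  case (insert i I)
  then have 1: "e i \<in> carrier M" "c i \<in> A" "e \<in> I \<rightarrow> carrier M" "c \<in> I \<rightarrow> A" by auto
  have 2: "(\<lambda>i. d (c i)) \<in> insert i I \<rightarrow> A" "(\<lambda>i. nabla M (e i)) \<in> insert i I \<rightarrow> carrier M"
    using insert.prems by auto
  have 3: "lincomb I e c \<in> carrier M" "lincomb I e (\<lambda>i. d (c i)) \<in> carrier M"
      "lincomb I (\<lambda>i. nabla M (e i)) c \<in> carrier M"
    using insert.prems by (auto intro!: lincomb_closed)
  show ?case
    using insert 1 2 3
    by (simp add: lincomb_insert nabla_add nabla_smult D.M.a_ac)
qed simp

end

section \<open>Linear maps and bases\<close>

locale subfield_modules = M: subfield_module A M + N: subfield_module A N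
  for A :: "'a::field set" and M :: "('a, 'm, 'y) module_scheme" and N :: "('a, 'n, 'z) module_scheme"
begin

lemma lin_zero: "f \<in> lin_maps (subfield_ring A) M N \<Longrightarrow> f \<zero>\<^bsub>M\<^esub> = \<zero>\<^bsub>N\<^esub>"
  using lin_mapsD(3)[of f "subfield_ring A" M N 0 "\<zero>\<^bsub>M\<^esub>"] lin_mapsD(1)[of f "subfield_ring A" M N "\<zero>\<^bsub>M\<^esub>"] by simp

lemma lin_uminus:
  "f \<in> lin_maps (subfield_ring A) M N \<Longrightarrow> x \<in> carrier M \<Longrightarrow> f (\<ominus>\<^bsub>M\<^esub> x) = \<ominus>\<^bsub>N\<^esub> f x"
  using lin_mapsD(3)[of f "subfield_ring A" M N "- 1" x] lin_mapsD(1)[of f "subfield_ring A" M N x]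
  by (simp add: M.smult_uminus N.smult_uminus)

lemma lin_minus:
  "f \<in> lin_maps (subfield_ring A) M N \<Longrightarrow> x \<in> carrier M \<Longrightarrow> y \<in> carrier M \<Longrightarrow>
    f (x \<ominus>\<^bsub>M\<^esub> y) = f x \<ominus>\<^bsub>N\<^esub> f y"
  using lin_mapsD(2)[of f "subfield_ring A" M N x "\<ominus>\<^bsub>M\<^esub> y"] by (simp add: a_minus_def lin_uminus)

lemma lin_lincomb:
  assumes f: "f \<in> lin_maps (subfield_ring A) M N" and "finite I" "e \<in> I \<rightarrow> carrier M" "c \<in> I \<rightarrow> A"
  shows "f (M.lincomb I e c) = N.lincomb I (\<lambda>i. f (e i)) c"
  using assms(2-)
proof (induction I rule: finite_induct)
  case empty then show ?case using lin_zero[OF f] by simp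
next
  case (insert i I)
  then have 1: "e i \<in> carrier M" "c i \<in> A" "e \<in> I \<rightarrow> carrier M" "c \<in> I \<rightarrow> A" by auto
  have 2: "(\<lambda>i. f (e i)) \<in> insert i I \<rightarrow> carrier N" using insert.prems lin_mapsD(1)[OF f] by auto
  show ?case using insert 1 2
    by (simp add: M.lincomb_insert N.lincomb_insert lin_mapsD[OF f])
qed

lemma lin_maps_basis_eqI:
  assumes b: "M.coord_basis I e"
    and f: "f \<in> lin_maps (subfield_ring A) M N" and g: "g \<in> lin_maps (subfield_ring A) M N"
    and eq: "\<And>i. i \<in> I \<Longrightarrow> f (e i) = g (e i)"
  shows "f = g"
proof (rule lin_maps_eqI[OF f g])
  fix x assume x: "x \<in> carrier M"
  note bD = M.coord_basisD(1,2)[OF b] and c = M.coord_in(1,3)[OF b x]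
  have "f (M.lincomb I e (M.coord I e x)) = g (M.lincomb I e (M.coord I e x))"
    unfolding lin_lincomb[OF f bD c(1)] lin_lincomb[OF g bD c(1)] N.lincomb_def
    using bD c(1) eq lin_mapsD(1)[OF g] by (intro N.V.M.finsum_cong' refl) (auto simp: Pi_iff)
  then show "f x = g x" by (simp add: c)
qed

lemma lin_map_exists:
  assumes b: "M.coord_basis I e" and t: "t \<in> I \<rightarrow> carrier N"
  shows "\<exists>f\<in>lin_maps (subfield_ring A) M N. \<forall>i\<in>I. f (e i) = t i"
proof
  define f where "f = (\<lambda>x\<in>carrier M. N.lincomb I t (M.coord I e x))"
  note fin = M.coord_basisD(1,2)[OF b]
  have cl: "N.lincomb I t (M.coord I e x) \<in> carrier N" if "x \<in> carrier M" for x
    using t M.coord_in(1)[OF b that] by auto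
  show "f \<in> lin_maps (subfield_ring A) M N"
  proof (rule lin_mapsI)
    fix x y assume x: "x \<in> carrier M" and y: "y \<in> carrier M"
    have "N.lincomb I t (M.coord I e (x \<oplus>\<^bsub>M\<^esub> y))
        = N.lincomb I t (\<lambda>i. M.coord I e x i + M.coord I e y i)"
      using x y t M.coord_in(1)[OF b, of "x \<oplus>\<^bsub>M\<^esub> y"] by (intro N.lincomb_cong) (auto simp: M.coord_add[OF b])
    then show "f (x \<oplus>\<^bsub>M\<^esub> y) = f x \<oplus>\<^bsub>N\<^esub> f y"
      using x y t fin M.coord_in(1)[OF b] by (simp add: f_def N.lincomb_add)
  next
    fix a x assume a: "a \<in> carrier (subfield_ring A)" and x: "x \<in> carrier M"
    then have "N.lincomb I t (M.coord I e (a \<odot>\<^bsub>M\<^esub> x)) = N.lincomb I t (\<lambda>i. a * M.coord I e x i)"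
      using t M.coord_in(1)[OF b, of "a \<odot>\<^bsub>M\<^esub> x"] by (intro N.lincomb_cong) (auto simp: M.coord_smult[OF b])
    then show "f (a \<odot>\<^bsub>M\<^esub> x) = a \<odot>\<^bsub>N\<^esub> f x"
      using a x t fin M.coord_in(1)[OF b] by (simp add: f_def N.lincomb_smult)
  qed (auto simp: f_def cl)
  show "\<forall>i\<in>I. f (e i) = t i"
  proof
    fix i assume i: "i \<in> I"
    then have ei: "e i \<in> carrier M" using fin by auto
    have "N.lincomb I t (M.coord I e (e i)) = N.lincomb I t (\<lambda>k. if k = i then 1 else 0)"
      using i t M.coord_in(1)[OF b ei] by (intro N.lincomb_cong) (auto simp: M.coord_unit[OF b])
    then show "f (e i) = t i" using i ei fin t by (simp add: f_def N.lincomb_unit)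
  qed
qed

end

lemma lin_maps_comp:
  assumes "f \<in> lin_maps R M N" "g \<in> lin_maps R N N'"
    and "\<And>x y. x \<in> carrier M \<Longrightarrow> y \<in> carrier M \<Longrightarrow> x \<oplus>\<^bsub>M\<^esub> y \<in> carrier M"
    and "\<And>a x. a \<in> carrier R \<Longrightarrow> x \<in> carrier M \<Longrightarrow> a \<odot>\<^bsub>M\<^esub> x \<in> carrier M"
  shows "(\<lambda>x\<in>carrier M. g (f x)) \<in> lin_maps R M N'"
  by (rule lin_mapsI) (simp_all add: lin_mapsD[OF assms(1)] lin_mapsD[OF assms(2)] assms)

section \<open>Transport of structure along isomorphisms\<close>

lemma dmod_isoD:
  assumes "f \<in> dmod_iso R M N"
  shows "f \<in> dmod_hom R M N" "f \<in> lin_maps R M N" "inj_on f (carrier M)" "f ` carrier M = carrier N"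
    "bij_betw f (carrier M) (carrier N)"
  using assms by (auto simp: dmod_iso_def dmod_hom_def bij_betw_def)

lemma dmod_isoI:
  assumes "f \<in> dmod_hom R M N" "inj_on f (carrier M)" "f ` carrier M = carrier N"
  shows "f \<in> dmod_iso R M N"
  using assms by (auto simp: dmod_iso_def bij_betw_def)

lemma dmod_homI:
  assumes "f \<in> lin_maps R M N" "\<And>x. x \<in> carrier M \<Longrightarrow> f (nabla M x) = nabla N (f x)"
  shows "f \<in> dmod_hom R M N"
  using assms by (auto simp: dmod_hom_def)

lemma diff_module_transport:
  assumes M: "diff_module R d M" and f: "f \<in> dmod_iso R M N" and zero: "f \<zero>\<^bsub>M\<^esub> = \<zero>\<^bsub>N\<^esub>"
    and d: "\<And>a. a \<in> carrier R \<Longrightarrow> d a \<in> carrier R"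
  shows "diff_module R d N"
proof -
  interpret M: diff_module R d M by fact
  note fD = lin_mapsD[OF dmod_isoD(2)[OF f]] dmod_homD(2)[OF dmod_isoD(1)[OF f], symmetric]
  have surj: "\<exists>x\<in>carrier M. y = f x" if "y \<in> carrier N" for y
    using that dmod_isoD(4)[OF f] by blast
  have N: "module R N"
  proof (rule moduleI[OF M.is_cring])
    show "abelian_group N"
    proof (rule abelian_groupI)
      fix y assume "y \<in> carrier N"
      then obtain x where x: "x \<in> carrier M" "y = f x" using surj by blast
      then have "f (\<ominus>\<^bsub>M\<^esub> x) \<oplus>\<^bsub>N\<^esub> y = \<zero>\<^bsub>N\<^esub>"
        by (simp add: fD(2)[symmetric] zero[symmetric] M.M.l_neg)
      then show "\<exists>z\<in>carrier N. z \<oplus>\<^bsub>N\<^esub> y = \<zero>\<^bsub>N\<^esub>" using x fD(1) by blast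
    qed (auto dest!: surj simp: fD(2)[symmetric] zero[symmetric] fD(1) M.M.a_ac)
  qed (auto dest!: surj simp: fD(2)[symmetric] fD(3)[symmetric] fD(1) M.smult_l_distr M.smult_r_distr M.smult_assoc1)
  then interpret N: module R N .
  show ?thesis
    by unfold_locales
       (auto dest!: surj simp: fD(2)[symmetric] fD(3)[symmetric] fD(1) fD(5) d M.nabla_closed M.nabla_add M.leibniz)
qed

lemma dmod_iso_inverse:
  assumes M: "diff_module R d M" and f: "f \<in> dmod_iso R M N"
  shows "(\<lambda>y\<in>carrier N. inv_into (carrier M) f y) \<in> dmod_iso R N M"
proof -
  interpret M: diff_module R d M by fact
  let ?g = "\<lambda>y\<in>carrier N. inv_into (carrier M) f y"
  note fD = lin_mapsD[OF dmod_isoD(2)[OF f]] dmod_homD(2)[OF dmod_isoD(1)[OF f], symmetric]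
  note inj = dmod_isoD(3)[OF f]
  have surj: "\<exists>x\<in>carrier M. y = f x" if "y \<in> carrier N" for y
    using that dmod_isoD(4)[OF f] by blast
  have gf: "?g (f x) = x" if "x \<in> carrier M" for x using that fD(1) inj by simp
  show ?thesis
  proof (intro dmod_isoI dmod_homI lin_mapsI)
    show "inj_on ?g (carrier N)" by (rule inj_onI) (metis gf surj)
    show "?g ` carrier N = carrier M"
    proof (intro equalityI subsetI)
      fix x assume "x \<in> ?g ` carrier N"
      then obtain y where y: "y \<in> carrier N" "x = ?g y" by blast
      from surj[OF y(1)] obtain x' where x': "x' \<in> carrier M" "y = f x'" by blast
      have "x = x'" unfolding y(2) x'(2) by (rule gf[OF x'(1)])
      with x'(1) show "x \<in> carrier M" by simp
    next
      fix x assume "x \<in> carrier M"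
      then show "x \<in> ?g ` carrier N" using gf fD(1) by (intro image_eqI[of _ _ "f x"]) simp_all
    qed
  qed (auto dest!: surj simp del: restrict_apply
      simp: gf fD(2)[symmetric] fD(3)[symmetric] fD(5) M.nabla_closed, auto)
qed

lemma dmod_iso_comp:
  assumes M: "diff_module R d M" and f: "f \<in> dmod_iso R M N" and g: "g \<in> dmod_iso R N N'"
  shows "(\<lambda>x\<in>carrier M. g (f x)) \<in> dmod_iso R M N'"
proof -
  interpret M: diff_module R d M by fact
  note fD = lin_mapsD[OF dmod_isoD(2)[OF f]] dmod_homD(2)[OF dmod_isoD(1)[OF f]]
  note gD = lin_mapsD[OF dmod_isoD(2)[OF g]] dmod_homD(2)[OF dmod_isoD(1)[OF g]]
  show ?thesis
  proof (intro dmod_isoI dmod_homI lin_maps_comp[OF dmod_isoD(2)[OF f] dmod_isoD(2)[OF g]])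
    have "bij_betw (g \<circ> f) (carrier M) (carrier N')"
      using dmod_isoD(5)[OF f] dmod_isoD(5)[OF g] by (rule bij_betw_trans)
    then show "inj_on (\<lambda>x\<in>carrier M. g (f x)) (carrier M)"
      "(\<lambda>x\<in>carrier M. g (f x)) ` carrier M = carrier N'"
      by (auto simp: bij_betw_def inj_on_def)
  qed (simp_all add: fD gD M.nabla_closed)
qed

section \<open>Scalar extension\<close>

text \<open>
  Additive subgroups of a type, as targets for induction over generators: an additive map sends a
  free abelian group, or the subgroup of relations, into \<open>V\<close> as soon as it does so on generators.
\<close>

definition add_subgroup :: "'v::ab_group_add set \<Rightarrow> bool" where
  "add_subgroup V \<longleftrightarrow> 0 \<in> V \<and> (\<forall>x\<in>V. \<forall>y\<in>V. x - y \<in> V)"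

lemma add_subgroupD:
  assumes "add_subgroup V"
  shows "0 \<in> V" "x \<in> V \<Longrightarrow> y \<in> V \<Longrightarrow> x - y \<in> V" "x \<in> V \<Longrightarrow> - x \<in> V"
    "x \<in> V \<Longrightarrow> y \<in> V \<Longrightarrow> x + y \<in> V"
proof -
  show 0: "0 \<in> V" and d: "\<And>x y. x \<in> V \<Longrightarrow> y \<in> V \<Longrightarrow> x - y \<in> V"
    using assms by (auto simp: add_subgroup_def)
  show m: "- x \<in> V" if "x \<in> V" for x using d[OF 0 that] by simp
  show "x + y \<in> V" if "x \<in> V" "y \<in> V" using d[OF that(1) m[OF that(2)]] by simp
qed

definition frags_on :: "'p set \<Rightarrow> ('p \<Rightarrow>\<^sub>0 int) set" where
  "frags_on S = {c. Poly_Mapping.keys c \<subseteq> S}"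

lemma carrier_free_Abelian_group: "carrier (free_Abelian_group S) = frags_on S"
  by (auto simp: frags_on_def)

lemma frags_on_zero [simp, intro]: "0 \<in> frags_on S"
  by (simp add: frags_on_def)

lemma frags_on_uminus [simp]: "- c \<in> frags_on S \<longleftrightarrow> c \<in> frags_on S"
  by (simp add: frags_on_def)

lemma frags_on_diff [simp, intro]: "c \<in> frags_on S \<Longrightarrow> c' \<in> frags_on S \<Longrightarrow> c - c' \<in> frags_on S"
  using keys_diff[of c c'] by (auto simp: frags_on_def)

lemma frags_on_add [simp, intro]: "c \<in> frags_on S \<Longrightarrow> c' \<in> frags_on S \<Longrightarrow> c + c' \<in> frags_on S"
  using keys_add[of c c'] by (auto simp: frags_on_def)

lemma frags_on_of [simp]: "frag_of p \<in> frags_on S \<longleftrightarrow> p \<in> S"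
  by (simp add: frags_on_def)

lemma frags_on_extend [intro]:
  assumes "c \<in> frags_on S" "\<And>p. p \<in> S \<Longrightarrow> h p \<in> frags_on S'"
  shows "frag_extend h c \<in> frags_on S'"
  using keys_frag_extend[of h c] assms by (fastforce simp: frags_on_def)

lemma add_subgroup_frags_on: "add_subgroup (frags_on S)"
  by (auto simp: add_subgroup_def)

lemma frags_on_induct [consumes 1, case_names zero one diff]:
  assumes "c \<in> frags_on S" "P 0" "\<And>p. p \<in> S \<Longrightarrow> P (frag_of p)"
    "\<And>a b. P a \<Longrightarrow> P b \<Longrightarrow> P (a - b)"
  shows "P c"
  using assms by (intro frag_induction[of c S P]) (auto simp: frags_on_def)

lemma frag_additive_in:
  assumes c: "c \<in> frags_on S" and V: "add_subgroup V"
    and add: "\<And>x y. h (x - y) = h x - h y"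
    and gen: "\<And>p. p \<in> S \<Longrightarrow> h (frag_of p) \<in> V"
  shows "h c \<in> V"
  using c
proof (induction c rule: frags_on_induct)
  case zero
  have "h 0 = 0" using add[of 0 0] by simp
  then show ?case using add_subgroupD(1)[OF V] by simp
next
  case (one p) then show ?case by (rule gen)
next
  case (diff a b) then show ?case by (simp add: add add_subgroupD(2)[OF V])
qed

text \<open>
  The additive extension of \<open>\<phi>\<close> to the free abelian group.
\<close>

definition frag_eval :: "('p \<Rightarrow> 'a::comm_ring_1) \<Rightarrow> ('p \<Rightarrow>\<^sub>0 int) \<Rightarrow> 'a" where
  "frag_eval \<phi> c = (\<Sum>p\<in>Poly_Mapping.keys c. of_int (Poly_Mapping.lookup c p) * \<phi> p)"

lemma frag_eval_superset:
  assumes "finite K" "Poly_Mapping.keys c \<subseteq> K"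
  shows "frag_eval \<phi> c = (\<Sum>p\<in>K. of_int (Poly_Mapping.lookup c p) * \<phi> p)"
  unfolding frag_eval_def using assms by (intro sum.mono_neutral_left) (auto simp: in_keys_iff)

lemma frag_eval_diff: "frag_eval \<phi> (c - c') = frag_eval \<phi> c - frag_eval \<phi> c'"
proof -
  let ?K = "Poly_Mapping.keys c \<union> Poly_Mapping.keys c'"
  have "frag_eval \<phi> (c - c') = (\<Sum>p\<in>?K. of_int (Poly_Mapping.lookup (c - c') p) * \<phi> p)"
    using keys_diff[of c c'] by (intro frag_eval_superset) auto
  also have "\<dots> = frag_eval \<phi> c - frag_eval \<phi> c'"
    by (simp add: frag_eval_superset[of ?K] lookup_minus left_diff_distrib sum_subtractf)
  finally show ?thesis .
qed

lemma frag_eval_of [simp]: "frag_eval \<phi> (frag_of p) = \<phi> p"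
  by (simp add: frag_eval_def)

lemma frag_eval_sum: "finite I \<Longrightarrow> frag_eval \<phi> (\<Sum>i\<in>I. c i) = (\<Sum>i\<in>I. frag_eval \<phi> (c i))"
proof (induction I rule: finite_induct)
  case empty then show ?case by (simp add: frag_eval_def)
next
  case (insert i I)
  have "frag_eval \<phi> (c i + sum c I) = frag_eval \<phi> (c i - (0 - sum c I))" by simp
  also have "\<dots> = frag_eval \<phi> (c i) + frag_eval \<phi> (sum c I)"
    unfolding frag_eval_diff by (simp add: frag_eval_def)
  finally show ?case using insert by simp
qed

context diff_vector_space
begin

abbreviation "tens \<equiv> tensor_pre (subfield_ring UNIV) d M"
abbreviation "rels \<equiv> tensor_rels (subfield_ring A) (subfield_ring UNIV) M"
abbreviation "ext \<equiv> scalar_ext (subfield_ring A) (subfield_ring UNIV) d M"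

definition pure :: "'a \<Rightarrow> 'b \<Rightarrow> (('a \<times> 'b) \<Rightarrow>\<^sub>0 int) set" where
  "pure s x = rels +>\<^bsub>tens\<^esub> frag_of (s, x)"

lemma tensor_pre_simps [simp]:
  "carrier tens = frags_on (UNIV \<times> carrier M)"
  "ring.zero tens = 0" "ring.add tens = (+)"
  "module.smult tens = (\<lambda>s. frag_extend (\<lambda>(a, x). frag_of (s * a, x)))"
  "nabla tens = frag_extend (\<lambda>(a, x). frag_of (d a, x) + frag_of (a, nabla M x))"
  by (simp_all add: tensor_pre_def carrier_free_Abelian_group)

lemma abelian_group_tensor_pre: "abelian_group tens"
proof (rule abelian_groupI)
  fix c assume "c \<in> carrier tens"
  then show "\<exists>c'\<in>carrier tens. c' \<oplus>\<^bsub>tens\<^esub> c = \<zero>\<^bsub>tens\<^esub>" by (intro bexI[of _ "- c"]) auto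
qed (auto simp: algebra_simps)

lemma tensor_pre_uminus:
  "c \<in> frags_on (UNIV \<times> carrier M) \<Longrightarrow> \<ominus>\<^bsub>tens\<^esub> c = - c"
  by (rule abelian_group.minus_equality[OF abelian_group_tensor_pre]) auto

lemma tensor_pre_minus:
  "c' \<in> frags_on (UNIV \<times> carrier M) \<Longrightarrow> c \<ominus>\<^bsub>tens\<^esub> c' = c - c'"
  by (simp add: a_minus_def tensor_pre_uminus)

abbreviation tensor_gens :: "(('a \<times> 'b) \<Rightarrow>\<^sub>0 int) set" where
  "tensor_gens \<equiv> {frag_of (a + b, x) - frag_of (a, x) - frag_of (b, x) | a b x. x \<in> carrier M} \<union>
      {frag_of (a, x \<oplus> y) - frag_of (a, x) - frag_of (a, y) | a x y. x \<in> carrier M \<and> y \<in> carrier M} \<union>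
      {frag_of (a * r, x) - frag_of (a, r \<odot> x) | a r x. r \<in> A \<and> x \<in> carrier M}"

lemma tensor_rels_eq: "rels = generate (free_Abelian_group (UNIV \<times> carrier M)) tensor_gens"
  by (simp add: tensor_rels_def)

lemma tensor_gens_in: "g \<in> tensor_gens \<Longrightarrow> g \<in> frags_on (UNIV \<times> carrier M)"
  by (elim UnE CollectE exE conjE) (auto intro!: frags_on_diff)

lemma subgroup_rels: "subgroup rels (free_Abelian_group (UNIV \<times> carrier M))"
  unfolding tensor_rels_eq
  by (rule group.generate_is_subgroup[OF group_free_Abelian_group])
     (unfold carrier_free_Abelian_group, blast intro: tensor_gens_in)

lemma rels_in: "c \<in> rels \<Longrightarrow> c \<in> frags_on (UNIV \<times> carrier M)"
  using subgroup.subset[OF subgroup_rels] unfolding carrier_free_Abelian_group by blast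

lemma add_subgroup_rels: "add_subgroup rels"
  unfolding add_subgroup_def
proof (intro conjI ballI)
  show "0 \<in> rels" using subgroup.one_closed[OF subgroup_rels] by simp
  fix x y assume x: "x \<in> rels" and y: "y \<in> rels"
  have "- y \<in> rels"
    using subgroup.m_inv_closed[OF subgroup_rels y] rels_in[OF y] by (simp add: frags_on_def)
  then show "x - y \<in> rels" using subgroup.m_closed[OF subgroup_rels x, of "- y"] by simp
qed

lemma abelian_subgroup_rels: "abelian_subgroup rels tens"
proof (rule abelian_subgroupI3[OF _ abelian_group_tensor_pre])
  note V = add_subgroupD[OF add_subgroup_rels]
  show "additive_subgroup rels tens"
  proof (intro additive_subgroup.intro subgroup.intro)
    show "inv\<^bsub>add_monoid tens\<^esub> c \<in> rels" if "c \<in> rels" for c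
      using V(3)[OF that] tensor_pre_uminus[OF rels_in[OF that]] by (simp add: a_inv_def)
  qed (auto simp: V rels_in)
qed

lemma rels_gens:
  "x \<in> carrier M \<Longrightarrow> frag_of (a + b, x) - frag_of (a, x) - frag_of (b, x) \<in> rels"
  "x \<in> carrier M \<Longrightarrow> y \<in> carrier M \<Longrightarrow> frag_of (a, x \<oplus> y) - frag_of (a, x) - frag_of (a, y) \<in> rels"
  "r \<in> A \<Longrightarrow> x \<in> carrier M \<Longrightarrow> frag_of (a * r, x) - frag_of (a, r \<odot> x) \<in> rels"
  unfolding tensor_rels_eq by (blast intro: generate.incl)+

lemma rels_zero: "x \<in> carrier M \<Longrightarrow> frag_of (0, x) \<in> rels"
  using rels_gens(1)[of x 0 0] add_subgroupD(3)[OF add_subgroup_rels] by fastforce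

text \<open>
  The universal property of the tensor product in the form in which it is used: an additive map that
  respects the three kinds of generating relations modulo \<open>V\<close> maps all relations into \<open>V\<close>.
\<close>

lemma additive_map_rels:
  assumes c: "c \<in> rels" and V: "add_subgroup V"
    and diff: "\<And>x y. h (x - y) = h x - h y"
    and gens: "\<And>a b x. x \<in> carrier M \<Longrightarrow> h (frag_of (a + b, x)) - h (frag_of (a, x)) - h (frag_of (b, x)) \<in> V"
      "\<And>a x y. x \<in> carrier M \<Longrightarrow> y \<in> carrier M \<Longrightarrow>
         h (frag_of (a, x \<oplus> y)) - h (frag_of (a, x)) - h (frag_of (a, y)) \<in> V"
      "\<And>a r x. r \<in> A \<Longrightarrow> x \<in> carrier M \<Longrightarrow> h (frag_of (a * r, x)) - h (frag_of (a, r \<odot> x)) \<in> V"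
  shows "h c \<in> V"
proof -
  have h0: "h 0 = 0" using diff[of 0 0] by simp
  have hm: "h (- x) = - h x" for x using diff[of 0 x] h0 by simp
  have ha: "h (x + y) = h x + h y" for x y using diff[of x "- y"] hm by simp
  have gen: "h g \<in> V" if "g \<in> tensor_gens" for g
    using that by (elim UnE CollectE exE conjE) (simp_all add: diff gens)
  from c show ?thesis unfolding tensor_rels_eq
  proof (induction rule: generate.induct)
    case one then show ?case by (simp add: h0 add_subgroupD(1)[OF V])
  next
    case (incl g) then show ?case by (rule gen)
  next
    case (inv g)
    then have "inv\<^bsub>free_Abelian_group (UNIV \<times> carrier M)\<^esub> g = - g"
      using tensor_gens_in[OF inv] by (intro inv_free_Abelian_group) (simp add: frags_on_def)
    then show ?case using gen[OF inv] add_subgroupD(3)[OF V] by (simp add: hm)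
  next
    case (eng g g') then show ?case by (simp add: ha add_subgroupD(4)[OF V])
  qed
qed

lemma coset_rels_eq_iff:
  assumes "c \<in> frags_on (UNIV \<times> carrier M)" "c' \<in> frags_on (UNIV \<times> carrier M)"
  shows "rels +>\<^bsub>tens\<^esub> c = rels +>\<^bsub>tens\<^esub> c' \<longleftrightarrow> c - c' \<in> rels"
  using abelian_subgroup.coset_eq_iff[OF abelian_subgroup_rels, of c c'] assms by (simp add: tensor_pre_minus)

lemma smult_rels:
  assumes "c \<in> rels"
  shows "frag_extend (\<lambda>(a, x). frag_of (s * a, x)) c \<in> rels"
  by (rule additive_map_rels[OF assms add_subgroup_rels])
     (simp_all add: frag_extend_diff rels_gens distrib_left mult.assoc[symmetric])

lemma nabla_rels:
  assumes "c \<in> rels"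
  shows "frag_extend (\<lambda>(a, x). frag_of (d a, x) + frag_of (a, nabla M x)) c \<in> rels"
proof (rule additive_map_rels[OF assms add_subgroup_rels])
  note add = add_subgroupD(4)[OF add_subgroup_rels] and sub = add_subgroupD(2)[OF add_subgroup_rels]
  fix a b :: 'a and x y assume x: "x \<in> carrier M"
  from add[OF rels_gens(1)[OF x, of "d a" "d b"] rels_gens(1)[OF nabla_in[OF x], of a b]]
  show "frag_extend (\<lambda>(a, x). frag_of (d a, x) + frag_of (a, nabla M x)) (frag_of (a + b, x)) -
      frag_extend (\<lambda>(a, x). frag_of (d a, x) + frag_of (a, nabla M x)) (frag_of (a, x)) -
      frag_extend (\<lambda>(a, x). frag_of (d a, x) + frag_of (a, nabla M x)) (frag_of (b, x)) \<in> rels"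
    by (simp add: d_add algebra_simps)
  assume y: "y \<in> carrier M"
  from add[OF rels_gens(2)[OF x y, of "d a"] rels_gens(2)[OF nabla_in[OF x] nabla_in[OF y], of a]]
  show "frag_extend (\<lambda>(a, x). frag_of (d a, x) + frag_of (a, nabla M x)) (frag_of (a, x \<oplus> y)) -
      frag_extend (\<lambda>(a, x). frag_of (d a, x) + frag_of (a, nabla M x)) (frag_of (a, x)) -
      frag_extend (\<lambda>(a, x). frag_of (d a, x) + frag_of (a, nabla M x)) (frag_of (a, y)) \<in> rels"
    using x y by (simp add: nabla_add algebra_simps)
next
  note add = add_subgroupD(4)[OF add_subgroup_rels] and sub = add_subgroupD(2)[OF add_subgroup_rels]
  fix a r x assume r: "r \<in> A" and x: "x \<in> carrier M"
  note nx = nabla_in[OF x]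
  \<comment> \<open>The image of the relation \<open>a r \<otimes> x = a \<otimes> r x\<close>, written as a combination of relations: both
    Leibniz rules produce \<open>a d(r) \<otimes> x\<close>, once on the left and once on the right.\<close>
  have "(frag_of (d a * r + a * d r, x) - frag_of (d a * r, x) - frag_of (a * d r, x))
      + ((frag_of (d a * r, x) - frag_of (d a, r \<odot> x))
      + ((frag_of (a * d r, x) - frag_of (a, d r \<odot> x))
      + ((frag_of (a * r, nabla M x) - frag_of (a, r \<odot> nabla M x))
      - (frag_of (a, d r \<odot> x \<oplus> r \<odot> nabla M x) - frag_of (a, d r \<odot> x) - frag_of (a, r \<odot> nabla M x))))) \<in> rels"
    using x r nx by (intro add sub rels_gens) auto
  then show "frag_extend (\<lambda>(a, x). frag_of (d a, x) + frag_of (a, nabla M x)) (frag_of (a * r, x)) -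
      frag_extend (\<lambda>(a, x). frag_of (d a, x) + frag_of (a, nabla M x)) (frag_of (a, r \<odot> x)) \<in> rels"
    using x r by (simp add: nabla_smult d_mult algebra_simps)
qed (simp add: frag_extend_diff)

text \<open>
  Two additive operators on the free group agree modulo relations if they do so on generators; this
  yields the module axioms and the Leibniz rule on the tensor product.
\<close>

lemma coset_rels_cong:
  assumes c: "c \<in> frags_on (UNIV \<times> carrier M)"
    and h: "\<And>p. p \<in> UNIV \<times> carrier M \<Longrightarrow> h (frag_of p) \<in> frags_on (UNIV \<times> carrier M)"
    and h': "\<And>p. p \<in> UNIV \<times> carrier M \<Longrightarrow> h' (frag_of p) \<in> frags_on (UNIV \<times> carrier M)"
    and diff: "\<And>x y. h (x - y) = h x - h y" "\<And>x y. h' (x - y) = h' x - h' y"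
    and gen: "\<And>a x. x \<in> carrier M \<Longrightarrow> h (frag_of (a, x)) - h' (frag_of (a, x)) \<in> rels"
  shows "rels +>\<^bsub>tens\<^esub> h c = rels +>\<^bsub>tens\<^esub> h' c"
proof -
  have "h c \<in> frags_on (UNIV \<times> carrier M)" "h' c \<in> frags_on (UNIV \<times> carrier M)"
    by (rule frag_additive_in[OF c add_subgroup_frags_on]; use diff h h' in blast)+
  moreover have "h c - h' c \<in> rels"
    by (rule frag_additive_in[where h="\<lambda>c. h c - h' c", OF c add_subgroup_rels])
       (use diff gen in auto)
  ultimately show ?thesis by (simp add: coset_rels_eq_iff)
qed

lemma ext_diff_vector_space: "diff_vector_space UNIV d ext"
proof -
  interpret U: diff_subfield UNIV d by (rule diff_subfield_UNIV)
  have "diff_module (subfield_ring UNIV) d ext"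
    unfolding scalar_ext_def
  proof (rule quotient_is_diff_module[OF U.cring_subfield_ring abelian_subgroup_rels])
    fix a b c assume "c \<in> carrier tens"
    then show "rels +>\<^bsub>tens\<^esub> ((a \<oplus>\<^bsub>subfield_ring UNIV\<^esub> b) \<odot>\<^bsub>tens\<^esub> c) =
        rels +>\<^bsub>tens\<^esub> (a \<odot>\<^bsub>tens\<^esub> c \<oplus>\<^bsub>tens\<^esub> b \<odot>\<^bsub>tens\<^esub> c)"
      by (intro coset_rels_cong[where h="\<lambda>c. (a \<oplus>\<^bsub>subfield_ring UNIV\<^esub> b) \<odot>\<^bsub>tens\<^esub> c"
            and h'="\<lambda>c. a \<odot>\<^bsub>tens\<^esub> c \<oplus>\<^bsub>tens\<^esub> b \<odot>\<^bsub>tens\<^esub> c"])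
         (auto simp: frag_extend_diff distrib_right diff_diff_eq[symmetric] intro: rels_gens)
  next
    fix a b c assume "c \<in> carrier tens"
    then show "rels +>\<^bsub>tens\<^esub> ((a \<otimes>\<^bsub>subfield_ring UNIV\<^esub> b) \<odot>\<^bsub>tens\<^esub> c) =
        rels +>\<^bsub>tens\<^esub> (a \<odot>\<^bsub>tens\<^esub> (b \<odot>\<^bsub>tens\<^esub> c))"
      by (intro coset_rels_cong[where h="\<lambda>c. (a \<otimes>\<^bsub>subfield_ring UNIV\<^esub> b) \<odot>\<^bsub>tens\<^esub> c"
            and h'="\<lambda>c. a \<odot>\<^bsub>tens\<^esub> (b \<odot>\<^bsub>tens\<^esub> c)"])
         (auto simp: frag_extend_diff mult.assoc add_subgroupD(1)[OF add_subgroup_rels])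
  next
    fix c assume "c \<in> carrier tens"
    then show "rels +>\<^bsub>tens\<^esub> (\<one>\<^bsub>subfield_ring UNIV\<^esub> \<odot>\<^bsub>tens\<^esub> c) = rels +>\<^bsub>tens\<^esub> c"
      by (intro coset_rels_cong[where h="\<lambda>c. \<one>\<^bsub>subfield_ring UNIV\<^esub> \<odot>\<^bsub>tens\<^esub> c" and h'="\<lambda>c. c"])
         (auto simp: frag_extend_diff add_subgroupD(1)[OF add_subgroup_rels])
  next
    fix a c assume "c \<in> carrier tens"
    then show "rels +>\<^bsub>tens\<^esub> nabla tens (a \<odot>\<^bsub>tens\<^esub> c) =
        rels +>\<^bsub>tens\<^esub> (d a \<odot>\<^bsub>tens\<^esub> c \<oplus>\<^bsub>tens\<^esub> a \<odot>\<^bsub>tens\<^esub> nabla tens c)"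
      by (intro coset_rels_cong[where h="\<lambda>c. nabla tens (a \<odot>\<^bsub>tens\<^esub> c)"
            and h'="\<lambda>c. d a \<odot>\<^bsub>tens\<^esub> c \<oplus>\<^bsub>tens\<^esub> a \<odot>\<^bsub>tens\<^esub> nabla tens c"])
         (auto simp: frag_extend_diff frag_extend_add d_mult rels_gens diff_diff_eq[symmetric] intro!: frags_on_add)
  qed (auto simp: smult_rels nabla_rels frag_extend_add intro!: frags_on_extend frags_on_add)
  then show ?thesis
    by (intro diff_vector_space.intro U.diff_subfield_axioms)
qed

lemma ext_simps:
  "carrier ext = a_rcosets\<^bsub>tens\<^esub> rels" "ring.zero ext = rels" "ring.add ext = set_add tens"
  by (simp_all add: scalar_ext_def)

lemma pure_closed [simp, intro]: "x \<in> carrier M \<Longrightarrow> pure s x \<in> carrier ext"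
  unfolding pure_def ext_simps
  by (intro abelian_group.a_rcosetsI[OF abelian_group_tensor_pre]) (auto dest: rels_in)

lemma ext_add_coset:
  "c \<in> frags_on (UNIV \<times> carrier M) \<Longrightarrow> c' \<in> frags_on (UNIV \<times> carrier M) \<Longrightarrow>
    (rels +>\<^bsub>tens\<^esub> c) \<oplus>\<^bsub>ext\<^esub> (rels +>\<^bsub>tens\<^esub> c') = rels +>\<^bsub>tens\<^esub> (c + c')"
  using abelian_subgroup.a_rcos_sum[OF abelian_subgroup_rels, of c c'] by (simp add: ext_simps)

lemma ext_smult_coset:
  assumes "c \<in> frags_on (UNIV \<times> carrier M)"
  shows "s \<odot>\<^bsub>ext\<^esub> (rels +>\<^bsub>tens\<^esub> c) = rels +>\<^bsub>tens\<^esub> frag_extend (\<lambda>(a, x). frag_of (s * a, x)) c"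
  unfolding scalar_ext_def quot_dmod_simps tensor_pre_simps
  by (rule abelian_subgroup.induced_map_on_coset[OF abelian_subgroup_rels _ _ abelian_subgroup_rels])
     (use assms in \<open>auto simp: smult_rels frag_extend_add intro!: frags_on_extend\<close>)

lemma ext_nabla_coset:
  assumes "c \<in> frags_on (UNIV \<times> carrier M)"
  shows "nabla ext (rels +>\<^bsub>tens\<^esub> c) =
    rels +>\<^bsub>tens\<^esub> frag_extend (\<lambda>(a, x). frag_of (d a, x) + frag_of (a, nabla M x)) c"
  unfolding scalar_ext_def quot_dmod_simps tensor_pre_simps
  by (rule abelian_subgroup.induced_map_on_coset[OF abelian_subgroup_rels _ _ abelian_subgroup_rels])
     (use assms in \<open>auto simp: nabla_rels frag_extend_add intro!: frags_on_extend frags_on_add\<close>)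

lemma ext_smult_pure: "x \<in> carrier M \<Longrightarrow> s \<odot>\<^bsub>ext\<^esub> pure t x = pure (s * t) x"
  by (simp add: pure_def ext_smult_coset)

lemma pure_conv: "x \<in> carrier M \<Longrightarrow> pure s x = s \<odot>\<^bsub>ext\<^esub> pure 1 x"
  by (simp add: ext_smult_pure)

lemma pure_add: "x \<in> carrier M \<Longrightarrow> y \<in> carrier M \<Longrightarrow> pure s (x \<oplus> y) = pure s x \<oplus>\<^bsub>ext\<^esub> pure s y"
  by (simp add: pure_def ext_add_coset coset_rels_eq_iff frags_on_add rels_gens diff_diff_eq[symmetric])

lemma pure_smult: "r \<in> A \<Longrightarrow> x \<in> carrier M \<Longrightarrow> pure s (r \<odot> x) = pure (s * r) x"
  using rels_gens(3)[of r x s] by (simp add: pure_def coset_rels_eq_iff[THEN iffD2, symmetric])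

lemma ext_nabla_pure:
  assumes x: "x \<in> carrier M"
  shows "nabla ext (pure 1 x) = pure 1 (nabla M x)"
  using x rels_zero[OF x] by (simp add: pure_def ext_nabla_coset coset_rels_eq_iff frags_on_add)

lemma ext_induct [consumes 1, case_names pure add]:
  assumes C: "C \<in> carrier ext"
    and p: "\<And>s x. x \<in> carrier M \<Longrightarrow> P (pure s x)"
    and add: "\<And>C D. C \<in> carrier ext \<Longrightarrow> D \<in> carrier ext \<Longrightarrow> P C \<Longrightarrow> P D \<Longrightarrow> P (C \<oplus>\<^bsub>ext\<^esub> D)"
  shows "P C"
proof -
  interpret rels: abelian_subgroup rels tens by (rule abelian_subgroup_rels)
  have closed: "rels +>\<^bsub>tens\<^esub> c \<in> carrier ext" if "c \<in> frags_on (UNIV \<times> carrier M)" for c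
    using that unfolding ext_simps by (intro rels.a_rcosetsI) (auto dest: rels_in)
  obtain c where c: "c \<in> frags_on (UNIV \<times> carrier M)" "C = rels +>\<^bsub>tens\<^esub> c"
    using C rels.a_rcosets_cases unfolding ext_simps by (metis tensor_pre_simps(1))
  have "c \<in> frags_on (UNIV \<times> carrier M) \<and> P (rels +>\<^bsub>tens\<^esub> c) \<and> P (rels +>\<^bsub>tens\<^esub> (- c))"
    using c(1)
  proof (induction c rule: frags_on_induct)
    case zero
    have "rels +>\<^bsub>tens\<^esub> 0 = pure 0 \<zero>"
      using rels_zero[of "\<zero>"] add_subgroupD(3)[OF add_subgroup_rels] by (simp add: pure_def coset_rels_eq_iff)
    then show ?case using p[of "\<zero>" 0] by simp
  next
    case (one q)
    obtain s x where q: "q = (s, x)" "x \<in> carrier M" using one by auto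
    have "frag_of (s + - s, x) - frag_of (s, x) - frag_of (- s, x) \<in> rels"
      using q by (intro rels_gens)
    then have "frag_of (0, x) - (- frag_of (s, x) - frag_of (- s, x) + frag_of (0, x)) \<in> rels"
      using rels_zero[OF q(2)] add_subgroupD(2)[OF add_subgroup_rels] by fastforce
    then have "- (frag_of (s, x) + frag_of (- s, x)) \<in> rels"
      using \<open>frag_of (s + - s, x) - frag_of (s, x) - frag_of (- s, x) \<in> rels\<close>
        add_subgroupD(2)[OF add_subgroup_rels _ rels_zero[OF q(2)]] by fastforce
    then have "rels +>\<^bsub>tens\<^esub> (- frag_of (s, x)) = pure (- s) x"
      using q by (simp add: pure_def coset_rels_eq_iff)
    then show ?case using p[OF q(2), of s] p[OF q(2), of "- s"] q by (simp add: pure_def)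
  next
    case (diff a b)
    have "rels +>\<^bsub>tens\<^esub> (a - b) = (rels +>\<^bsub>tens\<^esub> a) \<oplus>\<^bsub>ext\<^esub> (rels +>\<^bsub>tens\<^esub> (- b))"
      "rels +>\<^bsub>tens\<^esub> (- (a - b)) = (rels +>\<^bsub>tens\<^esub> (- a)) \<oplus>\<^bsub>ext\<^esub> (rels +>\<^bsub>tens\<^esub> b)"
      using diff by (simp_all add: ext_add_coset)
    then show ?case using diff by (auto intro!: add closed frags_on_diff)
  qed
  then show ?thesis using c by simp
qed

lemma ext_lincomb_pure:
  assumes "finite I" "e \<in> I \<rightarrow> carrier M"
  shows "subfield_module.lincomb ext I (\<lambda>i. pure 1 (e i)) s = rels +>\<^bsub>tens\<^esub> (\<Sum>i\<in>I. frag_of (s i, e i))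
    \<and> (\<Sum>i\<in>I. frag_of (s i, e i)) \<in> frags_on (UNIV \<times> carrier M)"
proof -
  interpret ext: diff_vector_space UNIV d ext by (rule ext_diff_vector_space)
  interpret rels: abelian_subgroup rels tens by (rule abelian_subgroup_rels)
  show ?thesis
    using assms
  proof (induction I rule: finite_induct)
    case empty then show ?case
      using rels.a_rcos_const[of 0] add_subgroupD(1)[OF add_subgroup_rels] by (simp add: ext_simps)
  next
    case (insert i I)
    then have 1: "e i \<in> carrier M" "e \<in> I \<rightarrow> carrier M" by auto
    have 2: "(\<lambda>i. pure 1 (e i)) \<in> insert i I \<rightarrow> carrier ext" using insert.prems by auto
    show ?case
      using insert 1 2 pure_conv[OF 1(1), of "s i", symmetric]
      by (auto simp: ext.lincomb_insert ext_add_coset pure_def[of "s i"] frags_on_add)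
  qed
qed

text \<open>
  For independence the \<open>k\<close>-th coordinate is extended to the additive map \<open>a \<otimes> x \<mapsto> a x\<^sub>k\<close> on the free
  group, which kills all relations and picks out the \<open>k\<close>-th coefficient of a combination.
\<close>

lemma ext_coord_basis:
  assumes b: "coord_basis I e"
  shows "subfield_module.coord_basis UNIV ext I (\<lambda>i. pure 1 (e i))"
proof -
  interpret ext: diff_vector_space UNIV d ext by (rule ext_diff_vector_space)
  note fin = coord_basisD(1,2)[OF b]
  have pe: "(\<lambda>i. pure 1 (e i)) \<in> I \<rightarrow> carrier ext" using fin by auto
  have pure_x: "\<exists>c. pure s x = ext.lincomb I (\<lambda>i. pure 1 (e i)) c" if x: "x \<in> carrier M" for s x
  proof -
    have lin: "pure 1 (lincomb J e c) = ext.lincomb J (\<lambda>i. pure 1 (e i)) c"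
      if "finite J" "e \<in> J \<rightarrow> carrier M" "c \<in> J \<rightarrow> A" for J c
      using that
    proof (induction J rule: finite_induct)
      case empty
      have "pure 1 \<zero> = pure 0 \<zero>" using pure_smult[of 0 "\<zero>" 1] by simp
      also have "\<dots> = \<zero>\<^bsub>ext\<^esub>" using pure_conv[of "\<zero>" 0] by simp
      finally show ?case by simp
    next
      case (insert i J)
      then have 1: "e i \<in> carrier M" "c i \<in> A" "e \<in> J \<rightarrow> carrier M" "c \<in> J \<rightarrow> A" by auto
      have 2: "(\<lambda>i. pure 1 (e i)) \<in> insert i J \<rightarrow> carrier ext" using insert.prems by auto
      have "pure 1 (lincomb (insert i J) e c) = pure (c i) (e i) \<oplus>\<^bsub>ext\<^esub> pure 1 (lincomb J e c)"
        using insert 1 by (simp add: lincomb_insert pure_add pure_smult)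
      then show ?case using insert 1 2 pure_conv[OF 1(1), of "c i"]
        by (simp add: ext.lincomb_insert)
    qed
    have "pure 1 x = ext.lincomb I (\<lambda>i. pure 1 (e i)) (coord I e x)"
      using lin[OF fin coord_in(1)[OF b x]] coord_in(3)[OF b x] by simp
    then have "pure s x = ext.lincomb I (\<lambda>i. pure 1 (e i)) (\<lambda>i. s * coord I e x i)"
      using fin pe pure_conv[OF x, of s] by (subst ext.lincomb_smult) auto
    then show ?thesis by blast
  qed
  have span: "\<exists>c. C = ext.lincomb I (\<lambda>i. pure 1 (e i)) c" if "C \<in> carrier ext" for C
    using that
  proof (induction rule: ext_induct)
    case (pure s x) then show ?case by (rule pure_x)
  next
    case (add C D)
    then obtain c c' where "C = ext.lincomb I (\<lambda>i. pure 1 (e i)) c" "D = ext.lincomb I (\<lambda>i. pure 1 (e i)) c'"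
      by blast
    then have "C \<oplus>\<^bsub>ext\<^esub> D = ext.lincomb I (\<lambda>i. pure 1 (e i)) (\<lambda>i. c i + c' i)"
      using fin pe by (subst ext.lincomb_add) auto
    then show ?case by blast
  qed
  have indep: "s k = 0" if 0: "ext.lincomb I (\<lambda>i. pure 1 (e i)) s = \<zero>\<^bsub>ext\<^esub>" and k: "k \<in> I" for s k
  proof -
    define \<phi> where "\<phi> = (\<lambda>(a, x). a * coord I e x k)"
    have "rels +>\<^bsub>tens\<^esub> (\<Sum>i\<in>I. frag_of (s i, e i)) = rels +>\<^bsub>tens\<^esub> 0"
      using ext_lincomb_pure[OF fin, of s] 0 abelian_subgroup.a_rcos_const[OF abelian_subgroup_rels, of 0]
        add_subgroupD(1)[OF add_subgroup_rels] by (simp add: ext_simps)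
    then have rel: "(\<Sum>i\<in>I. frag_of (s i, e i)) \<in> rels"
      using ext_lincomb_pure[OF fin, of s] by (simp add: coset_rels_eq_iff)
    have "frag_eval \<phi> (\<Sum>i\<in>I. frag_of (s i, e i)) \<in> {0}"
      by (rule additive_map_rels[OF rel])
         (auto simp: add_subgroup_def frag_eval_diff \<phi>_def coord_add[OF b] coord_smult[OF b] k algebra_simps)
    moreover have "frag_eval \<phi> (\<Sum>i\<in>I. frag_of (s i, e i)) = (\<Sum>i\<in>I. if i = k then s k else 0)"
      unfolding frag_eval_sum[OF fin(1)] using k by (intro sum.cong) (auto simp: \<phi>_def coord_unit[OF b])
    ultimately show ?thesis using fin k by simp
  qed
  show ?thesis
    unfolding ext.coord_basis_def using fin pe span indep by fastforce
qed

text \<open>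
  \<open>x \<mapsto> 1 \<otimes> x\<close> preserves coordinates, which can be read off by \<open>a \<otimes> x \<mapsto> a x\<^sub>k\<close>.
\<close>

lemma pure_inj:
  assumes b: "coord_basis I e" and x: "x \<in> carrier M" and y: "y \<in> carrier M" and eq: "pure 1 x = pure 1 y"
  shows "x = y"
proof (rule coord_eqI[OF b x y])
  fix k assume k: "k \<in> I"
  define \<phi> where "\<phi> = (\<lambda>(a, x). a * coord I e x k)"
  have rel: "frag_of (1, x) - frag_of (1, y) \<in> rels" using eq x y by (simp add: pure_def coset_rels_eq_iff)
  have "frag_eval \<phi> (frag_of (1, x) - frag_of (1, y)) \<in> {0}"
    by (rule additive_map_rels[OF rel])
       (auto simp: add_subgroup_def frag_eval_diff \<phi>_def coord_add[OF b] coord_smult[OF b] k algebra_simps)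
  then show "coord I e x k = coord I e y k" by (simp add: frag_eval_diff \<phi>_def)
qed

lemma ext_lin_maps_eqI:
  assumes f: "f \<in> lin_maps (subfield_ring UNIV) ext N" and g: "g \<in> lin_maps (subfield_ring UNIV) ext N"
    and eq: "\<And>x. x \<in> carrier M \<Longrightarrow> f (pure 1 x) = g (pure 1 x)"
  shows "f = g"
proof (rule lin_maps_eqI[OF f g])
  fix C assume "C \<in> carrier ext"
  then show "f C = g C"
  proof (induction rule: ext_induct)
    case (pure s x)
    then show ?case using eq[OF pure] lin_mapsD(3)[OF f, of s "pure 1 x"] lin_mapsD(3)[OF g, of s "pure 1 x"]
      by (simp add: ext_smult_pure)
  qed (simp add: lin_mapsD(2)[OF f] lin_mapsD(2)[OF g])
qed

lemma ext_horizontalI: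
  assumes f: "f \<in> lin_maps (subfield_ring UNIV) ext N" and N: "diff_vector_space UNIV d N"
    and eq: "\<And>x. x \<in> carrier M \<Longrightarrow> f (pure 1 (nabla M x)) = nabla N (f (pure 1 x))"
  shows "f \<in> dmod_hom (subfield_ring UNIV) ext N"
proof (rule dmod_homI[OF f])
  interpret N: diff_vector_space UNIV d N by (rule N)
  interpret ext: diff_vector_space UNIV d ext by (rule ext_diff_vector_space)
  fix C assume "C \<in> carrier ext"
  then show "f (nabla ext C) = nabla N (f C)"
  proof (induction rule: ext_induct)
    case (pure s x)
    have "f (nabla ext (s \<odot>\<^bsub>ext\<^esub> pure 1 x)) = nabla N (s \<odot>\<^bsub>N\<^esub> f (pure 1 x))"
      using pure eq[OF pure]
      by (simp add: ext.nabla_smult N.nabla_smult ext_nabla_pure lin_mapsD[OF f])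
    then show ?case using pure lin_mapsD(3)[OF f, of s "pure 1 x"] by (simp add: ext_smult_pure)
  qed (simp add: lin_mapsD[OF f] ext.nabla_add N.nabla_add)
qed

end

locale diff_vector_spaces = M: diff_vector_space A d M + N: diff_vector_space A d N
  for A :: "'a::field set" and d and M :: "('a, 'm) dmod" and N :: "('a, 'n) dmod"

sublocale diff_vector_spaces \<subseteq> subfield_modules A M N
  by unfold_locales

context diff_vector_spaces
begin

abbreviation "ext_map f \<equiv> scalar_ext_map (subfield_ring A) (subfield_ring UNIV) d M N f"

lemma push_rels:
  assumes f: "f \<in> lin_maps (subfield_ring A) M N" and c: "c \<in> M.rels"
  shows "frag_extend (\<lambda>(a, x). frag_of (a, f x)) c \<in> N.rels"
  by (rule M.additive_map_rels[OF c N.add_subgroup_rels])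
     (simp_all add: frag_extend_diff N.rels_gens lin_mapsD[OF f])

lemma ext_map_coset:
  assumes f: "f \<in> lin_maps (subfield_ring A) M N" and c: "c \<in> frags_on (UNIV \<times> carrier M)"
  shows "ext_map f (M.rels +>\<^bsub>M.tens\<^esub> c) = N.rels +>\<^bsub>N.tens\<^esub> frag_extend (\<lambda>(a, x). frag_of (a, f x)) c"
proof -
  have "M.rels +>\<^bsub>M.tens\<^esub> c \<in> carrier M.ext"
    unfolding M.ext_simps
    by (intro abelian_group.a_rcosetsI[OF M.abelian_group_tensor_pre]) (use c M.rels_in in auto)
  moreover have "N.rels <+>\<^bsub>N.tens\<^esub> (frag_extend (\<lambda>(a, x). frag_of (a, f x)) ` (M.rels +>\<^bsub>M.tens\<^esub> c))
      = N.rels +>\<^bsub>N.tens\<^esub> frag_extend (\<lambda>(a, x). frag_of (a, f x)) c"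
    by (rule abelian_subgroup.induced_map_on_coset[OF M.abelian_subgroup_rels _ _ N.abelian_subgroup_rels])
       (use c in \<open>auto simp: push_rels[OF f] frag_extend_add lin_mapsD[OF f] intro!: frags_on_extend\<close>)
  ultimately show ?thesis by (simp add: scalar_ext_map_def)
qed

lemma ext_map_pure:
  assumes f: "f \<in> lin_maps (subfield_ring A) M N" and x: "x \<in> carrier M"
  shows "ext_map f (M.pure s x) = N.pure s (f x)"
  using x by (simp add: M.pure_def N.pure_def ext_map_coset[OF f])

lemma ext_map_lin:
  assumes f: "f \<in> lin_maps (subfield_ring A) M N"
  shows "ext_map f \<in> lin_maps (subfield_ring UNIV) M.ext N.ext"
proof -
  interpret rels: abelian_subgroup M.rels M.tens by (rule M.abelian_subgroup_rels)
  interpret relsN: abelian_subgroup N.rels N.tens by (rule N.abelian_subgroup_rels)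
  let ?p = "frag_extend (\<lambda>(a, x). frag_of (a, f x))"
  have rep: "\<exists>c. c \<in> frags_on (UNIV \<times> carrier M) \<and> C = M.rels +>\<^bsub>M.tens\<^esub> c" if "C \<in> carrier M.ext" for C
    using that rels.a_rcosets_cases unfolding M.ext_simps by (metis M.tensor_pre_simps(1))
  have keys: "(?p c) \<in> frags_on (UNIV \<times> carrier N)" if "c \<in> frags_on (UNIV \<times> carrier M)" for c
    using that by (rule frags_on_extend) (auto simp: lin_mapsD[OF f])
  show ?thesis
  proof (rule lin_mapsI)
    fix C assume C: "C \<in> carrier M.ext"
    obtain c where c: "c \<in> frags_on (UNIV \<times> carrier M)" "C = M.rels +>\<^bsub>M.tens\<^esub> c"
      using rep[OF C] by blast
    have "N.rels +>\<^bsub>N.tens\<^esub> ?p c \<in> carrier N.ext"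
      unfolding N.ext_simps using keys[OF c(1)] by (intro relsN.a_rcosetsI) (auto dest: N.rels_in)
    then show "ext_map f C \<in> carrier N.ext" using c by (simp add: ext_map_coset[OF f])
    fix s :: 'a
    have "?p (frag_extend (\<lambda>(a, x). frag_of (s * a, x)) c) = frag_extend (\<lambda>(a, x). frag_of (s * a, x)) (?p c)"
    proof -
      have "?p (frag_extend (\<lambda>(a, x). frag_of (s * a, x)) c) - frag_extend (\<lambda>(a, x). frag_of (s * a, x)) (?p c) \<in> {0}"
        by (rule frag_additive_in[where S=UNIV]) (auto simp: add_subgroup_def frag_extend_diff frags_on_def)
      then show ?thesis by simp
    qed
    then show "ext_map f (s \<odot>\<^bsub>M.ext\<^esub> C) = s \<odot>\<^bsub>N.ext\<^esub> ext_map f C"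
      using c keys[OF c(1)]
      by (simp add: M.ext_smult_coset N.ext_smult_coset ext_map_coset[OF f] frags_on_extend case_prod_unfold)
         (subst ext_map_coset[OF f], auto simp: case_prod_unfold intro!: frags_on_extend)
    fix D assume D: "D \<in> carrier M.ext"
    obtain c' where c': "c' \<in> frags_on (UNIV \<times> carrier M)" "D = M.rels +>\<^bsub>M.tens\<^esub> c'"
      using rep[OF D] by blast
    show "ext_map f (C \<oplus>\<^bsub>M.ext\<^esub> D) = ext_map f C \<oplus>\<^bsub>N.ext\<^esub> ext_map f D"
      using c c' keys
      by (simp add: M.ext_add_coset N.ext_add_coset[OF keys[OF c(1)] keys[OF c'(1)]] ext_map_coset[OF f]
          frags_on_add frag_extend_add)
  qed (simp add: scalar_ext_map_def)
qed

lemma ext_map_hom: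
  assumes f: "f \<in> dmod_hom (subfield_ring A) M N"
  shows "ext_map f \<in> dmod_hom (subfield_ring UNIV) M.ext N.ext"
proof (rule M.ext_horizontalI[OF ext_map_lin[OF dmod_homD(1)[OF f]] N.ext_diff_vector_space])
  fix x assume x: "x \<in> carrier M"
  then show "ext_map f (M.pure 1 (nabla M x)) = nabla N.ext (ext_map f (M.pure 1 x))"
    using lin_mapsD(1)[OF dmod_homD(1)[OF f] x]
    by (simp add: ext_map_pure[OF dmod_homD(1)[OF f]] dmod_homD(2)[OF f] N.ext_nabla_pure)
qed

end

section \<open>Internal Hom in coordinates\<close>

context abelian_group
begin

lemma add_minus_cancel_left:
  assumes "u \<in> carrier G" "x \<in> carrier G" "y \<in> carrier G"
  shows "(u \<oplus> x) \<ominus> (u \<oplus> y) = x \<ominus> y"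
proof -
  have "(u \<oplus> x) \<ominus> (u \<oplus> y) = u \<oplus> (\<ominus> u \<oplus> (x \<oplus> \<ominus> y))"
    using assms by (simp add: a_minus_def minus_add a_ac)
  then show ?thesis using assms by (simp add: r_neg2 a_minus_def)
qed

lemma add_minus_add:
  assumes "u \<in> carrier G" "v \<in> carrier G" "x \<in> carrier G" "y \<in> carrier G"
  shows "(u \<oplus> v) \<ominus> (x \<oplus> y) = (u \<ominus> x) \<oplus> (v \<ominus> y)"
  using assms by (simp add: a_minus_def minus_add a_ac)

lemma add_minus_assoc:
  assumes "u \<in> carrier G" "x \<in> carrier G" "y \<in> carrier G"
  shows "(u \<oplus> x) \<ominus> y = u \<oplus> (x \<ominus> y)"
  using assms by (simp add: a_minus_def a_ac)

lemma add_minus_self: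
  assumes "x \<in> carrier G" "y \<in> carrier G"
  shows "x \<oplus> (y \<ominus> x) = y"
proof -
  have "x \<oplus> (y \<ominus> x) = x \<oplus> (\<ominus> x \<oplus> y)" using assms by (simp add: a_minus_def a_ac)
  then show ?thesis using assms by (simp add: r_neg2)
qed

end

context subfield_module
begin

lemma smult_minus: "a \<in> A \<Longrightarrow> x \<in> carrier M \<Longrightarrow> y \<in> carrier M \<Longrightarrow> a \<odot> (x \<ominus> y) = a \<odot> x \<ominus> a \<odot> y"
  by (simp add: a_minus_def smult_add_right smult_minus_right)

lemma additive_lincomb:
  fixes h :: "'b \<Rightarrow> 'c::comm_ring_1"
  assumes add: "\<And>x y. x \<in> carrier M \<Longrightarrow> y \<in> carrier M \<Longrightarrow> h (x \<oplus> y) = h x + h y"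
    and smult: "\<And>a x. a \<in> A \<Longrightarrow> x \<in> carrier M \<Longrightarrow> h (a \<odot> x) = g a * h x"
    and I: "finite I" "t \<in> I \<rightarrow> carrier M" "c \<in> I \<rightarrow> A"
  shows "h (lincomb I t c) = (\<Sum>i\<in>I. g (c i) * h (t i))"
  using I
proof (induction I rule: finite_induct)
  case empty
  have "h \<zero> = 0" using add[of "\<zero>" "\<zero>"] by simp
  then show ?case by simp
next
  case (insert i I)
  then have "t i \<in> carrier M" "c i \<in> A" "t \<in> I \<rightarrow> carrier M" "c \<in> I \<rightarrow> A" by auto
  then show ?case using insert by (simp add: lincomb_insert add smult)
qed

lemma coord_lincomb_sum:
  assumes "coord_basis I e" "finite L" "t \<in> L \<rightarrow> carrier M" "c \<in> L \<rightarrow> A" "i \<in> I"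
  shows "coord I e (lincomb L t c) i = (\<Sum>l\<in>L. c l * coord I e (t l) i)"
  using assms by (intro additive_lincomb[where g="\<lambda>a. a"]) (auto simp: coord_add coord_smult)

end

context diff_vector_space
begin

definition conn_matrix :: "'i set \<Rightarrow> ('i \<Rightarrow> 'b) \<Rightarrow> 'i \<Rightarrow> 'i \<Rightarrow> 'a" where
  "conn_matrix I e i l = coord I e (nabla M (e l)) i"

lemma coord_nabla:
  assumes b: "coord_basis I e" and x: "x \<in> carrier M" and i: "i \<in> I"
  shows "coord I e (nabla M x) i = d (coord I e x i) + (\<Sum>l\<in>I. conn_matrix I e i l * coord I e x l)"
proof -
  note fin = coord_basisD(1,2)[OF b]
  define c where "c = coord I e x"
  have c: "c \<in> I \<rightarrow> A" "lincomb I e c = x" using coord_in[OF b x] by (auto simp: c_def)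
  have t: "(\<lambda>i. nabla M (e i)) \<in> I \<rightarrow> carrier M" using fin by auto
  have dc: "(\<lambda>i. d (c i)) \<in> I \<rightarrow> A" using c by auto
  have "nabla M x = lincomb I e (\<lambda>i. d (c i)) \<oplus> lincomb I (\<lambda>i. nabla M (e i)) c"
    using nabla_lincomb[OF fin c(1)] c(2) by simp
  moreover have "lincomb I e (\<lambda>i. d (c i)) \<in> carrier M" "lincomb I (\<lambda>i. nabla M (e i)) c \<in> carrier M"
    using fin t c dc by auto
  ultimately have "coord I e (nabla M x) i = coord I e (lincomb I e (\<lambda>i. d (c i))) i + coord I e (lincomb I (\<lambda>i. nabla M (e i)) c) i"
    using i by (simp add: coord_add[OF b])
  also have "coord I e (lincomb I e (\<lambda>i. d (c i))) i = d (c i)" by (rule coord_lincomb[OF b dc i])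
  also have "coord I e (lincomb I (\<lambda>i. nabla M (e i)) c) i = (\<Sum>l\<in>I. c l * coord I e (nabla M (e l)) i)"
    by (rule coord_lincomb_sum[OF b fin(1) t c(1) i])
  finally have "coord I e (nabla M x) i = d (c i) + (\<Sum>l\<in>I. c l * coord I e (nabla M (e l)) i)" .
  then show ?thesis by (simp add: c_def conn_matrix_def mult.commute)
qed

lemma ext_coord_pure:
  assumes b: "coord_basis I e" and x: "x \<in> carrier M" and i: "i \<in> I"
  shows "subfield_module.coord UNIV ext I (\<lambda>i. pure 1 (e i)) (pure 1 x) i = coord I e x i"
proof -
  interpret ext: diff_vector_space UNIV d ext by (rule ext_diff_vector_space)
  note be = ext_coord_basis[OF b] and fin = coord_basisD(1,2)[OF b]
  have "pure 1 (lincomb J e c) = ext.lincomb J (\<lambda>i. pure 1 (e i)) c"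
    if "finite J" "e \<in> J \<rightarrow> carrier M" "c \<in> J \<rightarrow> A" for J c
    using that
  proof (induction J rule: finite_induct)
    case empty
    have "pure 1 \<zero> = pure 0 \<zero>" using pure_smult[of 0 "\<zero>" 1] by simp
    also have "\<dots> = \<zero>\<^bsub>ext\<^esub>" using pure_conv[of "\<zero>" 0] by simp
    finally show ?case by simp
  next
    case (insert i J)
    then have 1: "e i \<in> carrier M" "c i \<in> A" "e \<in> J \<rightarrow> carrier M" "c \<in> J \<rightarrow> A" by auto
    have 2: "(\<lambda>i. pure 1 (e i)) \<in> insert i J \<rightarrow> carrier ext" using insert.prems by auto
    have "pure 1 (lincomb (insert i J) e c) = pure (c i) (e i) \<oplus>\<^bsub>ext\<^esub> pure 1 (lincomb J e c)"
      using insert 1 by (simp add: lincomb_insert pure_add pure_smult)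
    then show ?case using insert 1 2 pure_conv[OF 1(1), of "c i"] by (simp add: ext.lincomb_insert)
  qed
  from this[OF fin coord_in(1)[OF b x]]
  have "pure 1 x = ext.lincomb I (\<lambda>i. pure 1 (e i)) (coord I e x)" by (simp add: coord_in(3)[OF b x])
  then show ?thesis using ext.coord_lincomb[OF be, of "coord I e x" i] i by simp
qed

lemma ext_conn_matrix:
  assumes b: "coord_basis I e" and i: "i \<in> I" and l: "l \<in> I"
  shows "diff_vector_space.conn_matrix UNIV ext I (\<lambda>i. pure 1 (e i)) i l = conn_matrix I e i l"
proof -
  interpret ext: diff_vector_space UNIV d ext by (rule ext_diff_vector_space)
  show ?thesis
    using coord_basisD(3)[OF b l] i
    by (simp add: ext.conn_matrix_def conn_matrix_def ext_nabla_pure ext_coord_pure[OF b])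
qed

end

lemma internal_hom_simps [simp]:
  "carrier (internal_hom R M N) = lin_maps R M N"
  "x \<in> carrier M \<Longrightarrow> \<zero>\<^bsub>internal_hom R M N\<^esub> x = \<zero>\<^bsub>N\<^esub>"
  "x \<in> carrier M \<Longrightarrow> (f \<oplus>\<^bsub>internal_hom R M N\<^esub> g) x = f x \<oplus>\<^bsub>N\<^esub> g x"
  "x \<in> carrier M \<Longrightarrow> (a \<odot>\<^bsub>internal_hom R M N\<^esub> f) x = a \<odot>\<^bsub>N\<^esub> f x"
  "x \<in> carrier M \<Longrightarrow> nabla (internal_hom R M N) f x = nabla N (f x) \<ominus>\<^bsub>N\<^esub> f (nabla M x)"
  by (simp_all add: internal_hom_def)

context diff_vector_spaces
begin

abbreviation "Hom \<equiv> internal_hom (subfield_ring A) M N"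

lemma Hom_closed:
  shows Hom_zero_closed: "\<zero>\<^bsub>Hom\<^esub> \<in> lin_maps (subfield_ring A) M N"
    and Hom_add_closed: "\<lbrakk>f \<in> lin_maps (subfield_ring A) M N; g \<in> lin_maps (subfield_ring A) M N\<rbrakk> \<Longrightarrow>
      f \<oplus>\<^bsub>Hom\<^esub> g \<in> lin_maps (subfield_ring A) M N"
    and Hom_smult_closed: "\<lbrakk>a \<in> A; f \<in> lin_maps (subfield_ring A) M N\<rbrakk> \<Longrightarrow>
      a \<odot>\<^bsub>Hom\<^esub> f \<in> lin_maps (subfield_ring A) M N"
    and Hom_nabla_closed: "f \<in> lin_maps (subfield_ring A) M N \<Longrightarrow>
      nabla Hom f \<in> lin_maps (subfield_ring A) M N"
proof -
  show "\<zero>\<^bsub>Hom\<^esub> \<in> lin_maps (subfield_ring A) M N"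
    by (rule lin_mapsI) (auto simp: internal_hom_def)
  assume f: "f \<in> lin_maps (subfield_ring A) M N"
  note fD = lin_mapsD[OF f]
  show "f \<oplus>\<^bsub>Hom\<^esub> g \<in> lin_maps (subfield_ring A) M N" if g: "g \<in> lin_maps (subfield_ring A) M N"
    by (rule lin_mapsI)
       (auto simp: internal_hom_def fD lin_mapsD[OF g] N.smult_add_right N.D.M.a_ac)
  show "a \<odot>\<^bsub>Hom\<^esub> f \<in> lin_maps (subfield_ring A) M N" if "a \<in> A"
    using that
    by (intro lin_mapsI)
       (auto simp: internal_hom_def fD N.smult_add_right N.smult_mult[symmetric] mult.commute)
  have smult: "nabla N (f (a \<odot>\<^bsub>M\<^esub> x)) \<ominus>\<^bsub>N\<^esub> f (nabla M (a \<odot>\<^bsub>M\<^esub> x))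
      = a \<odot>\<^bsub>N\<^esub> (nabla N (f x) \<ominus>\<^bsub>N\<^esub> f (nabla M x))" if a: "a \<in> A" and x: "x \<in> carrier M" for a x
  proof -
    have cl: "d a \<odot>\<^bsub>N\<^esub> f x \<in> carrier N" "a \<odot>\<^bsub>N\<^esub> nabla N (f x) \<in> carrier N"
      "a \<odot>\<^bsub>N\<^esub> f (nabla M x) \<in> carrier N" using a x fD by auto
    have "nabla N (f (a \<odot>\<^bsub>M\<^esub> x)) \<ominus>\<^bsub>N\<^esub> f (nabla M (a \<odot>\<^bsub>M\<^esub> x))
        = (d a \<odot>\<^bsub>N\<^esub> f x \<oplus>\<^bsub>N\<^esub> a \<odot>\<^bsub>N\<^esub> nabla N (f x)) \<ominus>\<^bsub>N\<^esub> (d a \<odot>\<^bsub>N\<^esub> f x \<oplus>\<^bsub>N\<^esub> a \<odot>\<^bsub>N\<^esub> f (nabla M x))"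
      using a x fD by (simp add: M.nabla_smult N.nabla_smult)
    also have "\<dots> = a \<odot>\<^bsub>N\<^esub> nabla N (f x) \<ominus>\<^bsub>N\<^esub> a \<odot>\<^bsub>N\<^esub> f (nabla M x)"
      using cl by (rule N.D.M.add_minus_cancel_left)
    also have "\<dots> = a \<odot>\<^bsub>N\<^esub> (nabla N (f x) \<ominus>\<^bsub>N\<^esub> f (nabla M x))"
      using a x fD by (simp add: N.smult_minus)
    finally show ?thesis .
  qed
  have add: "nabla N (f (x \<oplus>\<^bsub>M\<^esub> y)) \<ominus>\<^bsub>N\<^esub> f (nabla M (x \<oplus>\<^bsub>M\<^esub> y))
      = (nabla N (f x) \<ominus>\<^bsub>N\<^esub> f (nabla M x)) \<oplus>\<^bsub>N\<^esub> (nabla N (f y) \<ominus>\<^bsub>N\<^esub> f (nabla M y))"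
    if "x \<in> carrier M" "y \<in> carrier M" for x y
    using that fD
    by (simp add: M.nabla_add N.nabla_add a_minus_def N.D.M.minus_add N.D.M.a_ac)
  show "nabla Hom f \<in> lin_maps (subfield_ring A) M N"
  proof (rule lin_mapsI)
    show "nabla Hom f x \<in> carrier N" if "x \<in> carrier M" for x using that fD by simp
    show "nabla Hom f x = undefined" if "x \<notin> carrier M" for x using that by (simp add: internal_hom_def)
    show "nabla Hom f (x \<oplus>\<^bsub>M\<^esub> y) = nabla Hom f x \<oplus>\<^bsub>N\<^esub> nabla Hom f y"
      if "x \<in> carrier M" "y \<in> carrier M" for x y using add[OF that] that by simp
    show "nabla Hom f (a \<odot>\<^bsub>M\<^esub> x) = a \<odot>\<^bsub>N\<^esub> nabla Hom f x"
      if "a \<in> carrier (subfield_ring A)" "x \<in> carrier M" for a x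
      using smult[of a x] that by simp
  qed
qed

lemma lin_in: "f \<in> lin_maps (subfield_ring A) M N \<Longrightarrow> x \<in> carrier M \<Longrightarrow> f x \<in> carrier N"
  by (rule lin_mapsD(1))

lemma Hom_eqI:
  assumes "f \<in> lin_maps (subfield_ring A) M N" "g \<in> lin_maps (subfield_ring A) M N"
    "\<And>x. x \<in> carrier M \<Longrightarrow> f x = g x"
  shows "f = g"
  using assms by (rule lin_maps_eqI)

lemma Hom_diff_vector_space: "diff_vector_space A d Hom"
proof -
  have "module (subfield_ring A) Hom"
  proof (rule moduleI[OF M.cring_subfield_ring])
    show "abelian_group Hom"
    proof (rule abelian_groupI)
      fix f assume f: "f \<in> carrier Hom"
      then have "(- 1) \<odot>\<^bsub>Hom\<^esub> f \<oplus>\<^bsub>Hom\<^esub> f = \<zero>\<^bsub>Hom\<^esub>"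
        by (intro Hom_eqI) (auto simp: Hom_closed lin_in N.smult_uminus N.D.M.l_neg)
      then show "\<exists>g\<in>carrier Hom. g \<oplus>\<^bsub>Hom\<^esub> f = \<zero>\<^bsub>Hom\<^esub>"
        using f Hom_smult_closed[of "- 1" f] by auto
    next
      fix f g h assume "f \<in> carrier Hom" "g \<in> carrier Hom" "h \<in> carrier Hom"
      then show "f \<oplus>\<^bsub>Hom\<^esub> g \<oplus>\<^bsub>Hom\<^esub> h = f \<oplus>\<^bsub>Hom\<^esub> (g \<oplus>\<^bsub>Hom\<^esub> h)"
        by (intro Hom_eqI) (auto simp: Hom_closed lin_in N.D.M.a_assoc)
    next
      fix f g assume "f \<in> carrier Hom" "g \<in> carrier Hom"
      then show "f \<oplus>\<^bsub>Hom\<^esub> g = g \<oplus>\<^bsub>Hom\<^esub> f"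
        by (intro Hom_eqI) (auto simp: Hom_closed lin_in N.D.M.a_comm)
    next
      fix f assume "f \<in> carrier Hom"
      then show "\<zero>\<^bsub>Hom\<^esub> \<oplus>\<^bsub>Hom\<^esub> f = f"
        by (intro Hom_eqI) (auto simp: Hom_closed lin_in)
    qed (auto simp: Hom_closed)
  next
    fix a b f assume "a \<in> carrier (subfield_ring A)" "b \<in> carrier (subfield_ring A)" "f \<in> carrier Hom"
    then show "(a \<oplus>\<^bsub>subfield_ring A\<^esub> b) \<odot>\<^bsub>Hom\<^esub> f = a \<odot>\<^bsub>Hom\<^esub> f \<oplus>\<^bsub>Hom\<^esub> b \<odot>\<^bsub>Hom\<^esub> f"
      by (intro Hom_eqI) (auto simp: Hom_closed lin_in N.smult_add_left)
  next
    fix a f g assume "a \<in> carrier (subfield_ring A)" "f \<in> carrier Hom" "g \<in> carrier Hom"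
    then show "a \<odot>\<^bsub>Hom\<^esub> (f \<oplus>\<^bsub>Hom\<^esub> g) = a \<odot>\<^bsub>Hom\<^esub> f \<oplus>\<^bsub>Hom\<^esub> a \<odot>\<^bsub>Hom\<^esub> g"
      by (intro Hom_eqI) (auto simp: Hom_closed lin_in N.smult_add_right)
  next
    fix a b f assume "a \<in> carrier (subfield_ring A)" "b \<in> carrier (subfield_ring A)" "f \<in> carrier Hom"
    then show "a \<otimes>\<^bsub>subfield_ring A\<^esub> b \<odot>\<^bsub>Hom\<^esub> f = a \<odot>\<^bsub>Hom\<^esub> (b \<odot>\<^bsub>Hom\<^esub> f)"
      by (intro Hom_eqI) (auto simp: Hom_closed lin_in N.smult_mult)
  next
    fix f assume "f \<in> carrier Hom"
    then show "\<one>\<^bsub>subfield_ring A\<^esub> \<odot>\<^bsub>Hom\<^esub> f = f"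
      by (intro Hom_eqI) (auto simp: Hom_closed lin_in)
  qed (auto simp: Hom_closed)
  then interpret H: module "subfield_ring A" Hom .
  have "diff_module (subfield_ring A) d Hom"
  proof unfold_locales
    fix f g assume fg: "f \<in> carrier Hom" "g \<in> carrier Hom"
    have "nabla N (f x \<oplus>\<^bsub>N\<^esub> g x) \<ominus>\<^bsub>N\<^esub> (f (nabla M x) \<oplus>\<^bsub>N\<^esub> g (nabla M x))
        = (nabla N (f x) \<ominus>\<^bsub>N\<^esub> f (nabla M x)) \<oplus>\<^bsub>N\<^esub> (nabla N (g x) \<ominus>\<^bsub>N\<^esub> g (nabla M x))"
      if "x \<in> carrier M" for x
      using that fg lin_in[of f x] lin_in[of g x] lin_in[of f "nabla M x"] lin_in[of g "nabla M x"]
      by (simp add: N.nabla_add N.D.M.add_minus_add)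
    then show "nabla Hom (f \<oplus>\<^bsub>Hom\<^esub> g) = nabla Hom f \<oplus>\<^bsub>Hom\<^esub> nabla Hom g"
      using fg by (intro Hom_eqI) (auto simp: Hom_closed)
  next
    fix a f assume a: "a \<in> carrier (subfield_ring A)" and f: "f \<in> carrier Hom"
    have "nabla N (a \<odot>\<^bsub>N\<^esub> f x) \<ominus>\<^bsub>N\<^esub> a \<odot>\<^bsub>N\<^esub> f (nabla M x)
        = d a \<odot>\<^bsub>N\<^esub> f x \<oplus>\<^bsub>N\<^esub> a \<odot>\<^bsub>N\<^esub> (nabla N (f x) \<ominus>\<^bsub>N\<^esub> f (nabla M x))"
      if "x \<in> carrier M" for x
      using that a f lin_in[of f x] lin_in[of f "nabla M x"]
      by (simp add: N.nabla_smult N.smult_minus N.D.M.add_minus_assoc)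
    then show "nabla Hom (a \<odot>\<^bsub>Hom\<^esub> f) = d a \<odot>\<^bsub>Hom\<^esub> f \<oplus>\<^bsub>Hom\<^esub> a \<odot>\<^bsub>Hom\<^esub> nabla Hom f"
      using a f by (intro Hom_eqI) (auto simp: Hom_closed)
  qed (auto simp: Hom_closed)
  then show ?thesis by (intro diff_vector_space.intro M.diff_subfield_axioms)
qed

lemma Hom_nabla_horizontal:
  assumes f: "f \<in> dmod_hom (subfield_ring A) M N"
  shows "nabla Hom f = \<zero>\<^bsub>Hom\<^esub>"
proof (rule Hom_eqI)
  note fD = dmod_homD[OF f]
  show "nabla Hom f \<in> lin_maps (subfield_ring A) M N" by (rule Hom_nabla_closed[OF fD(1)])
  show "nabla Hom f x = \<zero>\<^bsub>Hom\<^esub> x" if "x \<in> carrier M" for x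
    using that lin_in[OF fD(1) that] by (simp add: fD(2) a_minus_def N.D.M.r_neg)
qed (rule Hom_zero_closed)

text \<open>
  The matrix of a linear map with respect to bases of source and target, as a vector indexed by
  pairs (row, column).
\<close>

definition hom_chart :: "'i set \<Rightarrow> ('i \<Rightarrow> 'm) \<Rightarrow> 'j set \<Rightarrow> ('j \<Rightarrow> 'n) \<Rightarrow> ('m \<Rightarrow> 'n) \<Rightarrow> 'j \<times> 'i \<Rightarrow> 'a" where
  "hom_chart I e J f Y = (\<lambda>(j, i). N.coord J f (Y (e i)) j)"

text \<open>
  The matrix of the connection \<open>Y \<mapsto> \<nabla> Y - Y \<nabla>\<close> in this chart: with \<open>B\<close> and \<open>C\<close> the connection
  matrices of \<open>N\<close> and \<open>M\<close> it is \<open>Y \<mapsto> Y' + B Y - Y C\<close>.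
\<close>

definition hom_matrix :: "'i set \<Rightarrow> ('i \<Rightarrow> 'm) \<Rightarrow> 'j set \<Rightarrow> ('j \<Rightarrow> 'n) \<Rightarrow> 'j \<times> 'i \<Rightarrow> 'j \<times> 'i \<Rightarrow> 'a" where
  "hom_matrix I e J f = (\<lambda>(j, i) (k, l).
     (if l = i then N.conn_matrix J f j k else 0) - (if k = j then M.conn_matrix I e l i else 0))"

lemma hom_chart_in:
  assumes bM: "M.coord_basis I e" and bN: "N.coord_basis J f"
    and Y: "Y \<in> lin_maps (subfield_ring A) M N" and p: "p \<in> J \<times> I"
  shows "hom_chart I e J f Y p \<in> A"
proof -
  obtain j i where ji: "p = (j, i)" "j \<in> J" "i \<in> I" using p by auto
  show ?thesis
    using N.coord_in(2)[OF bN lin_in[OF Y M.coord_basisD(3)[OF bM ji(3)]] ji(2)] by (simp add: hom_chart_def ji)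
qed

lemma hom_chart_inj:
  assumes bM: "M.coord_basis I e" and bN: "N.coord_basis J f"
    and Y: "Y \<in> lin_maps (subfield_ring A) M N" and Z: "Z \<in> lin_maps (subfield_ring A) M N"
    and eq: "\<And>p. p \<in> J \<times> I \<Longrightarrow> hom_chart I e J f Y p = hom_chart I e J f Z p"
  shows "Y = Z"
proof (rule lin_maps_basis_eqI[OF bM Y Z])
  fix i assume i: "i \<in> I"
  have ei: "e i \<in> carrier M" using M.coord_basisD(3)[OF bM i] .
  show "Y (e i) = Z (e i)"
    using eq i by (intro N.coord_eqI[OF bN lin_mapsD(1)[OF Y ei] lin_mapsD(1)[OF Z ei]]) (auto simp: hom_chart_def)
qed

lemma hom_chart_surj:
  assumes bM: "M.coord_basis I e" and bN: "N.coord_basis J f" and y: "\<And>p. p \<in> J \<times> I \<Longrightarrow> y p \<in> A"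
  shows "\<exists>Y\<in>lin_maps (subfield_ring A) M N. \<forall>p\<in>J \<times> I. hom_chart I e J f Y p = y p"
proof -
  have "(\<lambda>i. N.lincomb J f (\<lambda>j. y (j, i))) \<in> I \<rightarrow> carrier N"
    using N.coord_basisD(2)[OF bN] y by (auto intro!: N.lincomb_closed)
  from lin_map_exists[OF bM this] obtain Y where
    Y: "Y \<in> lin_maps (subfield_ring A) M N" "\<forall>i\<in>I. Y (e i) = N.lincomb J f (\<lambda>j. y (j, i))" by blast
  have "hom_chart I e J f Y (j, i) = y (j, i)" if "j \<in> J" "i \<in> I" for j i
    using that Y(2) y N.coord_lincomb[OF bN, of "\<lambda>j. y (j, i)" j] by (auto simp: hom_chart_def)
  then show ?thesis using Y(1) by auto
qed

lemma hom_chart_add: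
  assumes bM: "M.coord_basis I e" and bN: "N.coord_basis J f"
    and Y: "Y \<in> lin_maps (subfield_ring A) M N" and Z: "Z \<in> lin_maps (subfield_ring A) M N"
    and p: "p \<in> J \<times> I"
  shows "hom_chart I e J f (Y \<oplus>\<^bsub>Hom\<^esub> Z) p = hom_chart I e J f Y p + hom_chart I e J f Z p"
proof -
  obtain j i where ji: "p = (j, i)" "j \<in> J" "i \<in> I" using p by auto
  note ei = M.coord_basisD(3)[OF bM ji(3)]
  show ?thesis
    using N.coord_add[OF bN lin_in[OF Y ei] lin_in[OF Z ei] ji(2)] ei by (simp add: hom_chart_def ji)
qed

lemma hom_chart_smult:
  assumes bM: "M.coord_basis I e" and bN: "N.coord_basis J f"
    and Y: "Y \<in> lin_maps (subfield_ring A) M N" and a: "a \<in> A" and p: "p \<in> J \<times> I"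
  shows "hom_chart I e J f (a \<odot>\<^bsub>Hom\<^esub> Y) p = a * hom_chart I e J f Y p"
proof -
  obtain j i where ji: "p = (j, i)" "j \<in> J" "i \<in> I" using p by auto
  note ei = M.coord_basisD(3)[OF bM ji(3)]
  show ?thesis
    using N.coord_smult[OF bN lin_in[OF Y ei] a ji(2)] ei by (simp add: hom_chart_def ji)
qed

lemma hom_chart_zero:
  assumes bM: "M.coord_basis I e" and bN: "N.coord_basis J f" and p: "p \<in> J \<times> I"
  shows "hom_chart I e J f \<zero>\<^bsub>Hom\<^esub> p = 0"
  using p by (auto simp: hom_chart_def N.coord_zero[OF bN] M.coord_basisD(3)[OF bM])

lemma hom_chart_nabla:
  assumes bM: "M.coord_basis I e" and bN: "N.coord_basis J f"
    and Y: "Y \<in> lin_maps (subfield_ring A) M N" and p: "p \<in> J \<times> I"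
  shows "hom_chart I e J f (nabla Hom Y) p
    = d (hom_chart I e J f Y p) + (\<Sum>q\<in>J \<times> I. hom_matrix I e J f p q * hom_chart I e J f Y q)"
proof -
  obtain j i where ji: "p = (j, i)" "j \<in> J" "i \<in> I" using p by auto
  have fin: "finite I" "finite J" using M.coord_basisD(1)[OF bM] N.coord_basisD(1)[OF bN] by auto
  have ei: "e l \<in> carrier M" if "l \<in> I" for l using M.coord_basisD(3)[OF bM that] .
  have Ye: "Y (e l) \<in> carrier N" if "l \<in> I" for l using lin_mapsD(1)[OF Y ei[OF that]] .
  have "N.coord J f (Y (nabla M (e i))) j = N.coord J f (Y (M.lincomb I e (M.coord I e (nabla M (e i))))) j"
    using ei[OF ji(3)] by (simp add: M.coord_in[OF bM])
  also have "\<dots> = (\<Sum>l\<in>I. M.conn_matrix I e l i * N.coord J f (Y (e l)) j)"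
    using M.coord_basisD(1,2)[OF bM] M.coord_in(1)[OF bM M.nabla_in[OF ei[OF ji(3)]]] Ye ji
    by (simp add: lin_lincomb[OF Y] N.coord_lincomb_sum[OF bN] M.conn_matrix_def)
  finally have "N.coord J f (nabla Hom Y (e i)) j =
      d (N.coord J f (Y (e i)) j) + (\<Sum>k\<in>J. N.conn_matrix J f j k * N.coord J f (Y (e i)) k)
      - (\<Sum>l\<in>I. M.conn_matrix I e l i * N.coord J f (Y (e l)) j)"
    using ei[OF ji(3)] Ye[OF ji(3)] lin_mapsD(1)[OF Y M.nabla_in[OF ei[OF ji(3)]]] ji
    by (simp add: N.coord_minus[OF bN] N.coord_nabla[OF bN])
  moreover have "(\<Sum>q\<in>J \<times> I. hom_matrix I e J f p q * hom_chart I e J f Y q)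
      = (\<Sum>k\<in>J. \<Sum>l\<in>I. (if l = i then N.conn_matrix J f j k * N.coord J f (Y (e i)) k else 0)
          - (if k = j then M.conn_matrix I e l i * N.coord J f (Y (e l)) j else 0))"
    unfolding sum.cartesian_product ji hom_matrix_def hom_chart_def
    by (intro sum.cong refl) (auto simp: left_diff_distrib)
  moreover have "\<dots> = (\<Sum>k\<in>J. N.conn_matrix J f j k * N.coord J f (Y (e i)) k)
      - (\<Sum>k\<in>J. \<Sum>l\<in>I. if k = j then M.conn_matrix I e l i * N.coord J f (Y (e l)) j else 0)"
    using fin ji by (simp add: sum_subtractf)
  moreover have "(\<Sum>k\<in>J. \<Sum>l\<in>I. if k = j then M.conn_matrix I e l i * N.coord J f (Y (e l)) j else 0)
      = (\<Sum>l\<in>I. M.conn_matrix I e l i * N.coord J f (Y (e l)) j)"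
    using fin ji by (subst sum.swap) simp
  ultimately show ?thesis by (simp add: ji hom_chart_def)
qed

end

section \<open>De Rham cohomology in coordinates\<close>

lemma restrict_scalars_simps [simp]:
  "carrier (restrict_scalars \<phi> M) = carrier M"
  "\<zero>\<^bsub>restrict_scalars \<phi> M\<^esub> = \<zero>\<^bsub>M\<^esub>"
  "ring.add (restrict_scalars \<phi> M) = ring.add M"
  "c \<odot>\<^bsub>restrict_scalars \<phi> M\<^esub> x = \<phi> c \<odot>\<^bsub>M\<^esub> x"
  by (simp_all add: restrict_scalars_def)

lemma abelian_group_cong:
  assumes "abelian_group M" "carrier N = carrier M" "ring.add N = ring.add M" "\<zero>\<^bsub>N\<^esub> = \<zero>\<^bsub>M\<^esub>"
  shows "abelian_group N"
proof -
  interpret abelian_group M by fact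
  show ?thesis
  proof (rule abelian_groupI)
    show "\<exists>y\<in>carrier N. y \<oplus>\<^bsub>N\<^esub> x = \<zero>\<^bsub>N\<^esub>" if "x \<in> carrier N" for x
      using that assms by (intro bexI[of _ "\<ominus>\<^bsub>M\<^esub> x"]) (auto simp: l_neg)
  qed (auto simp: assms a_ac)
qed

locale laurent_subfield = diff_subfield A fls_deriv for A :: "'k::field_char_0 fls set" +
  assumes const_in [simp, intro]: "fls_const c \<in> A"
    and intpow_in: "fls_X_intpow n \<in> A"
    and finite_in: "(\<exists>L. \<forall>l\<ge>L. f $$ l = 0) \<Longrightarrow> f \<in> A"
begin

lemma horizontal_coords_in:
  assumes "finite P" "coord_index_zero A P G" "coord_index_zero A P (dual_matrix G)"
    and "\<And>p. p \<in> P \<Longrightarrow> coord_conn P (dual_matrix G) \<phi> p = 0" "p \<in> P"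
  shows "\<phi> p \<in> A"
  by (rule horizontal_over_subfield[OF assms(1) zero_in intpow_in const_in _ _ assms(2,3)]) (use assms(4,5) in auto)

lemma exact_coords_in:
  assumes "finite P" "coord_index_zero A P G" "coord_index_zero A P (dual_matrix G)"
    and "\<And>p. p \<in> P \<Longrightarrow> y p \<in> A" "\<And>p. p \<in> P \<Longrightarrow> y p = coord_conn P G x p"
  shows "\<exists>z. (\<forall>p\<in>P. z p \<in> A) \<and> (\<forall>p\<in>P. y p = coord_conn P G z p)"
  by (rule exact_over_subfield[OF assms(1) zero_in intpow_in const_in _ _ assms(2,3)]) (use assms(4,5) in auto)

lemma const_smult:
  assumes "diff_vector_space A fls_deriv H" "x \<in> carrier H"
  shows "y \<in> carrier H \<Longrightarrow> fls_const c \<odot>\<^bsub>H\<^esub> (x \<oplus>\<^bsub>H\<^esub> y) = fls_const c \<odot>\<^bsub>H\<^esub> x \<oplus>\<^bsub>H\<^esub> fls_const c \<odot>\<^bsub>H\<^esub> y"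
    and "fls_const (a + b) \<odot>\<^bsub>H\<^esub> x = fls_const a \<odot>\<^bsub>H\<^esub> x \<oplus>\<^bsub>H\<^esub> fls_const b \<odot>\<^bsub>H\<^esub> x"
    and "fls_const (a * b) \<odot>\<^bsub>H\<^esub> x = fls_const a \<odot>\<^bsub>H\<^esub> (fls_const b \<odot>\<^bsub>H\<^esub> x)"
    and "nabla H (fls_const c \<odot>\<^bsub>H\<^esub> x) = fls_const c \<odot>\<^bsub>H\<^esub> nabla H x"
proof -
  interpret H: diff_vector_space A fls_deriv H by fact
  note x = assms(2)
  show "y \<in> carrier H \<Longrightarrow> fls_const c \<odot>\<^bsub>H\<^esub> (x \<oplus>\<^bsub>H\<^esub> y) = fls_const c \<odot>\<^bsub>H\<^esub> x \<oplus>\<^bsub>H\<^esub> fls_const c \<odot>\<^bsub>H\<^esub> y"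
    using x by (simp add: H.smult_add_right)
  show "fls_const (a + b) \<odot>\<^bsub>H\<^esub> x = fls_const a \<odot>\<^bsub>H\<^esub> x \<oplus>\<^bsub>H\<^esub> fls_const b \<odot>\<^bsub>H\<^esub> x"
    using H.smult_add_left[OF const_in const_in x, of a b] by (simp add: fls_plus_const)
  show "fls_const (a * b) \<odot>\<^bsub>H\<^esub> x = fls_const a \<odot>\<^bsub>H\<^esub> (fls_const b \<odot>\<^bsub>H\<^esub> x)"
    using H.smult_mult[OF const_in const_in x, of a b] by (simp add: fls_const_mult_const)
  show "nabla H (fls_const c \<odot>\<^bsub>H\<^esub> x) = fls_const c \<odot>\<^bsub>H\<^esub> nabla H x"
    using x by (simp add: H.nabla_smult)
qed

lemma restrict_to_constants_module:
  assumes "diff_vector_space A fls_deriv H"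
  shows "subfield_module UNIV (restrict_scalars fls_const H)"
proof -
  interpret H: diff_vector_space A fls_deriv H by fact
  interpret K: subfield_set "UNIV :: 'k set" by (rule subfield_set_UNIV)
  have "abelian_group (restrict_scalars fls_const H)"
    by (rule abelian_group_cong[OF H.D.M.abelian_group_axioms]) simp_all
  then have "module (subfield_ring UNIV) (restrict_scalars fls_const H)"
    by (intro moduleI[OF K.cring_subfield_ring])
       (auto simp: const_smult[OF assms])
  then show ?thesis by (intro subfield_module.intro K.subfield_set_axioms)
qed

text \<open>
  The chart \<open>m\<close> identifies \<open>H\<close> with vectors over \<open>A\<close> indexed by \<open>P\<close>.  Bases of the two cohomology
  spaces have equal size since the Euler characteristic vanishes; a basis of the kernel gives the
  vectors \<open>u\<close>, and representatives of a basis of the cokernel give the vectors \<open>w\<close>.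
\<close>

lemma coord_index_zeroI:
  fixes H :: "('k fls, 'h) dmod" and m :: "'h \<Rightarrow> 'p \<Rightarrow> 'k fls"
  assumes H: "diff_vector_space A fls_deriv H"
    and m_in: "\<And>Y p. Y \<in> carrier H \<Longrightarrow> p \<in> P \<Longrightarrow> m Y p \<in> A"
    and m_inj: "\<And>Y Z. Y \<in> carrier H \<Longrightarrow> Z \<in> carrier H \<Longrightarrow> (\<And>p. p \<in> P \<Longrightarrow> m Y p = m Z p) \<Longrightarrow> Y = Z"
    and m_surj: "\<And>y. (\<And>p. p \<in> P \<Longrightarrow> y p \<in> A) \<Longrightarrow> \<exists>Y\<in>carrier H. \<forall>p\<in>P. m Y p = y p"
    and m_add: "\<And>Y Z p. Y \<in> carrier H \<Longrightarrow> Z \<in> carrier H \<Longrightarrow> p \<in> P \<Longrightarrow> m (Y \<oplus>\<^bsub>H\<^esub> Z) p = m Y p + m Z p"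
    and m_smult: "\<And>a Y p. a \<in> A \<Longrightarrow> Y \<in> carrier H \<Longrightarrow> p \<in> P \<Longrightarrow> m (a \<odot>\<^bsub>H\<^esub> Y) p = a * m Y p"
    and m_nabla: "\<And>Y p. Y \<in> carrier H \<Longrightarrow> p \<in> P \<Longrightarrow> m (nabla H Y) p = coord_conn P G (m Y) p"
    and fin0: "fin_dim const_field (H0_dR H)" and fin1: "fin_dim const_field (H1_dR H)"
    and chi: "chi_dR H = 0"
  shows "coord_index_zero A P G"
proof -
  interpret H: diff_vector_space A fls_deriv H by fact
  interpret K: subfield_set "UNIV :: 'k set" by (rule subfield_set_UNIV)
  let ?RS = "restrict_scalars fls_const H"
  interpret RS: subfield_module UNIV ?RS by (rule restrict_to_constants_module[OF H])
  let ?K = "subfield_ring (UNIV :: 'k set)"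
  note nabla_const = const_smult(4)[OF H]
  have RS_uminus: "\<ominus>\<^bsub>?RS\<^esub> x = \<ominus>\<^bsub>H\<^esub> x" if "x \<in> carrier H" for x
    using that by (intro RS.V.M.minus_equality) (auto simp: H.D.M.l_neg)
  have sub0: "submodule {x \<in> carrier H. nabla H x = \<zero>\<^bsub>H\<^esub>} ?K ?RS"
    by (rule RS.submoduleI) (auto simp: RS_uminus H.nabla_add H.nabla_uminus nabla_const)
  have sub1: "submodule (nabla H ` carrier H) ?K ?RS"
  proof (rule RS.submoduleI)
    show "\<zero>\<^bsub>?RS\<^esub> \<in> nabla H ` carrier H" by (auto intro!: image_eqI[of _ _ "\<zero>\<^bsub>H\<^esub>"])
    show "\<ominus>\<^bsub>?RS\<^esub> a \<in> nabla H ` carrier H" if "a \<in> nabla H ` carrier H" for a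
      using that by (auto simp: RS_uminus H.nabla_uminus[symmetric])
    show "a \<oplus>\<^bsub>?RS\<^esub> b \<in> nabla H ` carrier H" if "a \<in> nabla H ` carrier H" "b \<in> nabla H ` carrier H" for a b
      using that by (auto simp: H.nabla_add[symmetric])
    show "c \<odot>\<^bsub>?RS\<^esub> a \<in> nabla H ` carrier H" if "a \<in> nabla H ` carrier H" for c a
      using that by (auto simp: nabla_const[symmetric])
  qed auto
  define U where "U = nabla H ` carrier H"
  have U: "abelian_subgroup U ?RS"
    using submodule.axioms(1)[OF sub1] RS.V.M.abelian_group_axioms
    by (intro abelian_subgroupI3) (auto simp: additive_subgroup_def U_def)
  interpret U: abelian_subgroup U ?RS by (rule U)

  have "module ?K (H0_dR H)" unfolding H0_dR_def
    by (rule submodule.submodule_is_module[OF sub0 RS.V.module_axioms])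
  then interpret H0: subfield_module UNIV "H0_dR H" by (intro subfield_module.intro K.subfield_set_axioms)
  have "module ?K (H1_dR H)" unfolding H1_dR_def U_def[symmetric]
    by (rule quotient_is_module[OF K.cring_subfield_ring U quot_module_simps])
       (auto simp: const_smult(1-3)[OF H] U_def nabla_const[symmetric])
  then interpret H1: subfield_module UNIV "H1_dR H" by (intro subfield_module.intro K.subfield_set_axioms)

  define S0 where "S0 = (SOME S. mod_basis const_field (H0_dR H) S)"
  define S1 where "S1 = (SOME S. mod_basis const_field (H1_dR H) S)"
  have "mod_basis const_field (H0_dR H) S0"
    unfolding S0_def by (rule someI_ex) (use fin0 in \<open>auto simp: fin_dim_def\<close>)
  moreover have "mod_basis const_field (H1_dR H) S1"
    unfolding S1_def by (rule someI_ex) (use fin1 in \<open>auto simp: fin_dim_def\<close>)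
  ultimately have b0: "H0.coord_basis S0 (\<lambda>b. b)" and b1: "H1.coord_basis S1 (\<lambda>b. b)"
    using fin0 fin1
    by (intro H0.mod_basis_coord_basis H1.mod_basis_coord_basis; simp only: subfield_ring_UNIV)+
  define d where "d = card S0"
  have "card S1 = d"
    using chi by (simp add: chi_dR_def vdim_def S0_def[symmetric] S1_def[symmetric] d_def)
  then obtain s0 s1 where s0: "bij_betw s0 {..<d} S0" and s1: "bij_betw s1 {..<d} S1"
    using H0.coord_basisD(1)[OF b0] H1.coord_basisD(1)[OF b1] ex_bij_betw_nat_finite
    unfolding d_def atLeast0LessThan by metis
  have H0c: "carrier (H0_dR H) = {x \<in> carrier H. nabla H x = \<zero>\<^bsub>H\<^esub>}"
    "ring.add (H0_dR H) = ring.add H" "c \<odot>\<^bsub>H0_dR H\<^esub> x = fls_const c \<odot>\<^bsub>H\<^esub> x" "\<zero>\<^bsub>H0_dR H\<^esub> = \<zero>\<^bsub>H\<^esub>" for c x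
    by (simp_all add: H0_dR_def)
  have H1c: "carrier (H1_dR H) = a_rcosets\<^bsub>?RS\<^esub> U" "ring.add (H1_dR H) = set_add ?RS"
    by (simp_all add: H1_dR_def U_def)
  have m0: "m \<zero>\<^bsub>H\<^esub> p = 0" if "p \<in> P" for p
    using m_add[of "\<zero>\<^bsub>H\<^esub>" "\<zero>\<^bsub>H\<^esub>" p] that by simp

  define rep where "rep C = (SOME x. x \<in> C)" for C :: "'h set"
  have rep: "rep C \<in> carrier H" "U +>\<^bsub>?RS\<^esub> rep C = C" if "C \<in> carrier (H1_dR H)" for C
  proof -
    have "C \<in> a_rcosets\<^bsub>?RS\<^esub> U" using that unfolding H1c .
    then obtain x where x: "x \<in> carrier ?RS" "C = U +>\<^bsub>?RS\<^esub> x" by (rule U.a_rcosets_cases)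
    from U.some_in_coset[OF x(1)] show "rep C \<in> carrier H" "U +>\<^bsub>?RS\<^esub> rep C = C" unfolding rep_def x(2) by simp_all
  qed
  have s0S: "s0 j \<in> carrier H" "nabla H (s0 j) = \<zero>\<^bsub>H\<^esub>" if "j < d" for j
    using that s0 H0.coord_basisD(3)[OF b0, of "s0 j"] by (auto simp: bij_betw_def H0c)
  have s1S: "s1 j \<in> carrier (H1_dR H)" if "j < d" for j
    using that s1 H1.coord_basisD(3)[OF b1, of "s1 j"] by (auto simp: bij_betw_def)

  have "coord_index_zero_bases A P G d (\<lambda>j. m (s0 j)) (\<lambda>j. m (rep (s1 j)))"
    unfolding coord_index_zero_bases_def
  proof (intro conjI allI impI ballI)
    fix j p assume j: "j < d" and p: "p \<in> P"
    show "m (s0 j) p \<in> A" using s0S[OF j] p by (intro m_in)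
    show "coord_conn P G (m (s0 j)) p = 0" using m_nabla[OF s0S(1)[OF j] p] s0S(2)[OF j] m0[OF p] by simp
  next
    fix k j assume k: "\<forall>p\<in>P. (\<Sum>j<d. fls_const (k j) * m (s0 j) p) = 0" and j: "j < d"
    define c where "c s = k (inv_into {..<d} s0 s)" for s
    let ?x = "H0.lincomb S0 (\<lambda>b. b) c"
    note fin = H0.coord_basisD(1,2)[OF b0]
    have x: "?x \<in> carrier (H0_dR H)" using fin by (intro H0.lincomb_closed) auto
    have "m ?x p = 0" if p: "p \<in> P" for p
    proof -
      have "m ?x p = (\<Sum>s\<in>S0. fls_const (c s) * m s p)"
        by (rule H0.additive_lincomb[where h="\<lambda>x. m x p"]) (use p fin in \<open>auto simp: H0c m_add m_smult\<close>)
      also have "\<dots> = (\<Sum>j<d. fls_const (c (s0 j)) * m (s0 j) p)"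
        by (rule sum.reindex_bij_betw[OF s0, symmetric])
      also have "\<dots> = (\<Sum>j<d. fls_const (k j) * m (s0 j) p)"
        using s0 by (intro sum.cong) (auto simp: c_def bij_betw_def)
      finally show ?thesis using k p by simp
    qed
    then have "?x = \<zero>\<^bsub>H0_dR H\<^esub>" using x m0 by (intro m_inj) (auto simp: H0c)
    then have "c (s0 j) = 0" using b0 s0 j by (auto simp: H0.coord_basis_def bij_betw_def)
    then show "k j = 0" using s0 j by (simp add: c_def bij_betw_def)
  next
    fix y assume "\<forall>p\<in>P. y p \<in> A"
    then obtain Y where Y: "Y \<in> carrier H" "\<And>p. p \<in> P \<Longrightarrow> m Y p = y p" using m_surj[of y] by blast
    note fin = H1.coord_basisD(1,2)[OF b1]
    interpret Q: subfield_modules UNIV ?RS "H1_dR H" by unfold_locales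
    define q where "q = (\<lambda>x\<in>carrier H. U +>\<^bsub>?RS\<^esub> x)"
    have q: "q \<in> lin_maps ?K ?RS (H1_dR H)"
    proof (rule lin_mapsI)
      show "q x \<in> carrier (H1_dR H)" if "x \<in> carrier ?RS" for x
        using that RS.V.M.a_rcosetsI[of U x] unfolding q_def H1c by (auto simp: U_def)
      show "q (x \<oplus>\<^bsub>?RS\<^esub> y) = q x \<oplus>\<^bsub>H1_dR H\<^esub> q y" if "x \<in> carrier ?RS" "y \<in> carrier ?RS" for x y
        using that U.a_rcos_sum[of x y] by (simp add: q_def H1c)
      show "q (c \<odot>\<^bsub>?RS\<^esub> x) = c \<odot>\<^bsub>H1_dR H\<^esub> q x" if "c \<in> carrier ?K" "x \<in> carrier ?RS" for c x
      proof -
        have "U <+>\<^bsub>?RS\<^esub> ((\<lambda>x. c \<odot>\<^bsub>?RS\<^esub> x) ` (U +>\<^bsub>?RS\<^esub> x)) = U +>\<^bsub>?RS\<^esub> (c \<odot>\<^bsub>?RS\<^esub> x)"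
          using that by (intro U.induced_map_on_coset[OF _ _ U])
            (auto simp: H.smult_add_right U_def nabla_const[symmetric])
        then show ?thesis using that by (simp add: q_def H1_dR_def U_def)
      qed
    qed (simp add: q_def)
    have repS: "rep \<in> S1 \<rightarrow> carrier ?RS" using fin rep(1) by auto
    obtain c where c: "c \<in> S1 \<rightarrow> UNIV" "q Y = H1.lincomb S1 (\<lambda>b. b) c"
      using b1 lin_mapsD(1)[OF q, of Y] Y(1) unfolding H1.coord_basis_def by auto
    define W where "W = RS.lincomb S1 rep c"
    have W: "W \<in> carrier H" using RS.lincomb_closed[OF repS c(1)] by (simp add: W_def)
    have "q W = H1.lincomb S1 (\<lambda>i. q (rep i)) c"
      unfolding W_def by (rule Q.lin_lincomb[OF q fin(1) repS c(1)])
    also have "\<dots> = H1.lincomb S1 (\<lambda>b. b) c"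
    proof -
      have "q (rep i) = i" if "i \<in> S1" for i
        using that rep[of i] fin(2) by (simp add: q_def Pi_iff)
      then show ?thesis
        unfolding H1.lincomb_def using fin c by (intro H1.V.M.finsum_cong' refl) (auto simp: Pi_iff)
    qed
    finally have "q Y = q W" using c by simp
    then have "Y \<ominus>\<^bsub>?RS\<^esub> W \<in> U" using Y W U.coset_eq_iff[of Y W] by (simp add: q_def)
    then obtain Z where Z: "Z \<in> carrier H" "Y \<ominus>\<^bsub>?RS\<^esub> W = nabla H Z" by (auto simp: U_def)
    have "Y = W \<oplus>\<^bsub>H\<^esub> nabla H Z"
      using Y(1) W H.D.M.add_minus_self[OF W Y(1)] by (simp add: Z(2)[symmetric] a_minus_def RS_uminus)
    then have "y p = (\<Sum>j<d. fls_const (c (s1 j)) * m (rep (s1 j)) p) + coord_conn P G (m Z) p" if p: "p \<in> P" for p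
    proof -
      have "m W p = (\<Sum>s\<in>S1. fls_const (c s) * m (rep s) p)"
        unfolding W_def
        by (rule RS.additive_lincomb[where h="\<lambda>x. m x p"]) (use p fin repS in \<open>auto simp: m_add m_smult\<close>)
      also have "\<dots> = (\<Sum>j<d. fls_const (c (s1 j)) * m (rep (s1 j)) p)"
        by (rule sum.reindex_bij_betw[OF s1, symmetric])
      finally show ?thesis using Y(2)[OF p] \<open>Y = _\<close> W Z(1) p by (simp add: m_add m_nabla)
    qed
    then show "\<exists>k z. (\<forall>p\<in>P. z p \<in> A) \<and>
        (\<forall>p\<in>P. y p = (\<Sum>j<d. fls_const (k j) * m (rep (s1 j)) p) + coord_conn P G z p)"
      using Z(1) m_in by (intro exI[of _ "\<lambda>j. c (s1 j)"] exI[of _ "m Z"]) auto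
  qed
  then show ?thesis unfolding coord_index_zero_def by blast
qed

end

section \<open>Comparison of convergent and formal cohomology\<close>

locale laurent_hom = laurent_subfield A + diff_vector_spaces A fls_deriv M N
  for A :: "'k::field_char_0 fls set" and M :: "('k fls, 'm) dmod" and N :: "('k fls, 'n) dmod"
begin

sublocale MN: diff_vector_spaces UNIV fls_deriv M.ext N.ext
  by (intro diff_vector_spaces.intro M.ext_diff_vector_space N.ext_diff_vector_space)

sublocale NM: diff_vector_spaces A fls_deriv N M
  by unfold_locales

text \<open>
  The hypothesis for \<open>Hom(M, N)\<close> and for its dual \<open>Hom(N, M)\<close>: the residue pairing compares the two.
\<close>

abbreviation index_zero :: bool where
  "index_zero \<equiv>
     fin_dim const_field (H0_dR (internal_hom (subfield_ring A) M N)) \<and>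
     fin_dim const_field (H1_dR (internal_hom (subfield_ring A) M N)) \<and>
     chi_dR (internal_hom (subfield_ring A) M N) = 0 \<and>
     fin_dim const_field (H0_dR (internal_hom (subfield_ring A) N M)) \<and>
     fin_dim const_field (H1_dR (internal_hom (subfield_ring A) N M)) \<and>
     chi_dR (internal_hom (subfield_ring A) N M) = 0"

text \<open>
  \<open>Hom(N, M)\<close> is dual to \<open>Hom(M, N)\<close> by the trace pairing; in charts duality is transposition of the
  index pair.
\<close>

lemma dual_hom_matrix:
  "dual_matrix (hom_matrix I e J f) (j, i) (k, l) = NM.hom_matrix J f I e (i, j) (l, k)"
  by (auto simp: hom_matrix_def NM.hom_matrix_def)

lemma coord_index_zero_Hom:
  assumes bM: "M.coord_basis I e" and bN: "N.coord_basis J f" and ind: index_zero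
  shows "coord_index_zero A (J \<times> I) (hom_matrix I e J f)"
    and "coord_index_zero A (J \<times> I) (dual_matrix (hom_matrix I e J f))"
proof -
  show "coord_index_zero A (J \<times> I) (hom_matrix I e J f)"
    by (rule coord_index_zeroI[where m="hom_chart I e J f", OF Hom_diff_vector_space])
       (use ind hom_chart_in[OF bM bN] hom_chart_inj[OF bM bN] hom_chart_surj[OF bM bN]
          hom_chart_add[OF bM bN] hom_chart_smult[OF bM bN] hom_chart_nabla[OF bM bN] in
        \<open>simp_all add: coord_conn_def\<close>)
  show "coord_index_zero A (J \<times> I) (dual_matrix (hom_matrix I e J f))"
  proof (rule coord_index_zeroI[where m="\<lambda>Z (j, i). NM.hom_chart J f I e Z (i, j)", OF NM.Hom_diff_vector_space])
    fix Y p assume Y: "Y \<in> carrier NM.Hom" and p: "p \<in> J \<times> I"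
    show "(\<lambda>(j, i). NM.hom_chart J f I e Y (i, j)) p \<in> A"
      using Y p NM.hom_chart_in[OF bN bM, of Y] by auto
  next
    fix Y Z assume "Y \<in> carrier NM.Hom" "Z \<in> carrier NM.Hom"
      "\<And>p. p \<in> J \<times> I \<Longrightarrow> (\<lambda>(j, i). NM.hom_chart J f I e Y (i, j)) p = (\<lambda>(j, i). NM.hom_chart J f I e Z (i, j)) p"
    then show "Y = Z" by (intro NM.hom_chart_inj[OF bN bM]) auto
  next
    fix y assume y: "\<And>p. p \<in> J \<times> I \<Longrightarrow> y p \<in> A"
    from NM.hom_chart_surj[OF bN bM, of "\<lambda>(i, j). y (j, i)"] y
    show "\<exists>Y\<in>carrier NM.Hom. \<forall>p\<in>J \<times> I. (\<lambda>(j, i). NM.hom_chart J f I e Y (i, j)) p = y p"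
      by fastforce
  next
    fix Y Z p assume "Y \<in> carrier NM.Hom" "Z \<in> carrier NM.Hom" "p \<in> J \<times> I"
    then show "(\<lambda>(j, i). NM.hom_chart J f I e (Y \<oplus>\<^bsub>NM.Hom\<^esub> Z) (i, j)) p =
        (\<lambda>(j, i). NM.hom_chart J f I e Y (i, j)) p + (\<lambda>(j, i). NM.hom_chart J f I e Z (i, j)) p"
      using NM.hom_chart_add[OF bN bM, of Y Z] by auto
  next
    fix a Y p assume "a \<in> A" "Y \<in> carrier NM.Hom" "p \<in> J \<times> I"
    then show "(\<lambda>(j, i). NM.hom_chart J f I e (a \<odot>\<^bsub>NM.Hom\<^esub> Y) (i, j)) p =
        a * (\<lambda>(j, i). NM.hom_chart J f I e Y (i, j)) p"
      using NM.hom_chart_smult[OF bN bM, of Y a] by auto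
  next
    fix Y p assume Y: "Y \<in> carrier NM.Hom" and p: "p \<in> J \<times> I"
    obtain j i where ji: "p = (j, i)" "j \<in> J" "i \<in> I" using p by auto
    have "(\<Sum>q\<in>I \<times> J. NM.hom_matrix J f I e (i, j) q * NM.hom_chart J f I e Y q)
        = (\<Sum>q\<in>J \<times> I. dual_matrix (hom_matrix I e J f) (j, i) q * (\<lambda>(j, i). NM.hom_chart J f I e Y (i, j)) q)"
      by (rule sum.reindex_bij_witness[of _ prod.swap prod.swap])
         (auto simp: dual_hom_matrix[symmetric])
    then show "(\<lambda>(j, i). NM.hom_chart J f I e (nabla NM.Hom Y) (i, j)) p =
        coord_conn (J \<times> I) (dual_matrix (hom_matrix I e J f)) (\<lambda>(j, i). NM.hom_chart J f I e Y (i, j)) p"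
      using NM.hom_chart_nabla[OF bN bM, of Y "(i, j)"] Y ji by (simp add: coord_conn_def)
  qed (use ind in auto)
qed

lemma hom_chart_ext_map:
  assumes bM: "M.coord_basis I e" and bN: "N.coord_basis J f"
    and Y: "Y \<in> lin_maps (subfield_ring A) M N" and p: "p \<in> J \<times> I"
  shows "MN.hom_chart I (\<lambda>i. M.pure 1 (e i)) J (\<lambda>j. N.pure 1 (f j)) (ext_map Y) p = hom_chart I e J f Y p"
proof -
  obtain j i where ji: "p = (j, i)" "j \<in> J" "i \<in> I" using p by auto
  note ei = M.coord_basisD(3)[OF bM ji(3)]
  show ?thesis
    using N.ext_coord_pure[OF bN lin_in[OF Y ei] ji(2)]
    by (simp add: MN.hom_chart_def hom_chart_def ji ext_map_pure[OF Y ei])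
qed

lemma hom_matrix_ext:
  assumes bM: "M.coord_basis I e" and bN: "N.coord_basis J f" and p: "p \<in> J \<times> I" and q: "q \<in> J \<times> I"
  shows "MN.hom_matrix I (\<lambda>i. M.pure 1 (e i)) J (\<lambda>j. N.pure 1 (f j)) p q = hom_matrix I e J f p q"
  using p q M.ext_conn_matrix[OF bM] N.ext_conn_matrix[OF bN]
  by (auto simp: MN.hom_matrix_def hom_matrix_def)

lemma hom_chart_ext_nabla:
  assumes bM: "M.coord_basis I e" and bN: "N.coord_basis J f"
    and \<phi>: "\<phi> \<in> lin_maps (subfield_ring UNIV) M.ext N.ext" and p: "p \<in> J \<times> I"
  shows "MN.hom_chart I (\<lambda>i. M.pure 1 (e i)) J (\<lambda>j. N.pure 1 (f j)) (nabla MN.Hom \<phi>) p =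
    coord_conn (J \<times> I) (hom_matrix I e J f)
      (MN.hom_chart I (\<lambda>i. M.pure 1 (e i)) J (\<lambda>j. N.pure 1 (f j)) \<phi>) p"
  using MN.hom_chart_nabla[OF M.ext_coord_basis[OF bM] N.ext_coord_basis[OF bN] \<phi> p] p
  by (simp add: coord_conn_def hom_matrix_ext[OF bM bN])

text \<open>
  A formal morphism is a horizontal element of the formal internal Hom.  Its chart is horizontal for
  the bidual of the connection matrix, so the comparison applies with the roles of \<open>Hom(M, N)\<close> and
  its dual exchanged.
\<close>

theorem horizontal_hom_descends:
  assumes bM: "M.coord_basis I e" and bN: "N.coord_basis J f" and ind: index_zero
    and \<phi>: "\<phi> \<in> dmod_hom (subfield_ring UNIV) M.ext N.ext"
  shows "\<exists>g\<in>dmod_hom (subfield_ring A) M N. \<phi> = ext_map g"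
proof -
  note bM' = M.ext_coord_basis[OF bM] and bN' = N.ext_coord_basis[OF bN]
  let ?c = "MN.hom_chart I (\<lambda>i. M.pure 1 (e i)) J (\<lambda>j. N.pure 1 (f j))"
  note \<phi>D = dmod_homD[OF \<phi>]
  have fin: "finite (J \<times> I)" using M.coord_basisD(1)[OF bM] N.coord_basisD(1)[OF bN] by simp
  note z = coord_index_zero_Hom[OF bM bN ind]
  have z': "coord_index_zero A (J \<times> I) (dual_matrix (dual_matrix (hom_matrix I e J f)))"
    using z(1) by simp
  have "coord_conn (J \<times> I) (dual_matrix (dual_matrix (hom_matrix I e J f))) (?c \<phi>) p = 0" if p: "p \<in> J \<times> I" for p
    using hom_chart_ext_nabla[OF bM bN \<phi>D(1) p] MN.hom_chart_zero[OF bM' bN' p]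
    by (simp add: MN.Hom_nabla_horizontal[OF \<phi>])
  then have "?c \<phi> p \<in> A" if "p \<in> J \<times> I" for p
    by (rule horizontal_coords_in[OF fin z(2) z' _ that])
  then have "\<exists>Y\<in>lin_maps (subfield_ring A) M N. \<forall>p\<in>J \<times> I. hom_chart I e J f Y p = ?c \<phi> p"
    by (rule hom_chart_surj[OF bM bN])
  then obtain g where g: "g \<in> lin_maps (subfield_ring A) M N"
    and gc: "\<forall>p\<in>J \<times> I. hom_chart I e J f g p = ?c \<phi> p" by (elim bexE)
  have \<phi>g: "\<phi> = ext_map g"
  proof (rule MN.hom_chart_inj[OF bM' bN' \<phi>D(1) ext_map_lin[OF g]])
    fix p assume p: "p \<in> J \<times> I"
    show "?c \<phi> p = ?c (ext_map g) p" unfolding hom_chart_ext_map[OF bM bN g p] using bspec[OF gc p] by (rule sym)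
  qed
  have "g (nabla M x) = nabla N (g x)" if x: "x \<in> carrier M" for x
  proof (rule N.pure_inj[OF bN])
    have "N.pure 1 (g (nabla M x)) = \<phi> (nabla M.ext (M.pure 1 x))"
      using x by (simp add: \<phi>g ext_map_pure[OF g] M.ext_nabla_pure)
    also have "\<dots> = nabla N.ext (\<phi> (M.pure 1 x))" using x by (intro \<phi>D(2)) simp
    also have "\<dots> = N.pure 1 (nabla N (g x))"
      using x lin_in[OF g x] by (simp add: \<phi>g ext_map_pure[OF g] N.ext_nabla_pure)
    finally show "N.pure 1 (g (nabla M x)) = N.pure 1 (nabla N (g x))" .
  qed (use x lin_in[OF g] in auto)
  then have "g \<in> dmod_hom (subfield_ring A) M N" using g by (intro dmod_homI)
  with \<phi>g show ?thesis by blast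
qed

theorem exact_hom_descends:
  assumes bM: "M.coord_basis I e" and bN: "N.coord_basis J f" and ind: index_zero
    and Y: "Y \<in> lin_maps (subfield_ring A) M N"
    and \<phi>: "\<phi> \<in> lin_maps (subfield_ring UNIV) M.ext N.ext" and eq: "ext_map Y = nabla MN.Hom \<phi>"
  shows "\<exists>Z\<in>lin_maps (subfield_ring A) M N. Y = nabla Hom Z"
proof -
  let ?c = "MN.hom_chart I (\<lambda>i. M.pure 1 (e i)) J (\<lambda>j. N.pure 1 (f j))"
  have fin: "finite (J \<times> I)" using M.coord_basisD(1)[OF bM] N.coord_basisD(1)[OF bN] by simp
  have ex: "\<exists>z. (\<forall>p\<in>J \<times> I. z p \<in> A) \<and>
      (\<forall>p\<in>J \<times> I. hom_chart I e J f Y p = coord_conn (J \<times> I) (hom_matrix I e J f) z p)"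
  proof (rule exact_coords_in[OF fin coord_index_zero_Hom[OF bM bN ind]])
    show "hom_chart I e J f Y p = coord_conn (J \<times> I) (hom_matrix I e J f) (?c \<phi>) p" if p: "p \<in> J \<times> I" for p
      using hom_chart_ext_nabla[OF bM bN \<phi> p] hom_chart_ext_map[OF bM bN Y p] eq by simp
  qed (rule hom_chart_in[OF bM bN Y])
  from ex obtain z where zA: "\<forall>p\<in>J \<times> I. z p \<in> A" and
      z: "\<forall>p\<in>J \<times> I. hom_chart I e J f Y p = coord_conn (J \<times> I) (hom_matrix I e J f) z p"
    by (elim exE conjE)
  have "z p \<in> A" if "p \<in> J \<times> I" for p using bspec[OF zA that] .
  then have "\<exists>Y\<in>lin_maps (subfield_ring A) M N. \<forall>p\<in>J \<times> I. hom_chart I e J f Y p = z p"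
    by (rule hom_chart_surj[OF bM bN])
  then obtain Z where Z: "Z \<in> lin_maps (subfield_ring A) M N"
    and Zc: "\<forall>p\<in>J \<times> I. hom_chart I e J f Z p = z p" by (elim bexE)
  have "Y = nabla Hom Z"
  proof (rule hom_chart_inj[OF bM bN Y Hom_nabla_closed[OF Z]])
    fix p assume p: "p \<in> J \<times> I"
    have "coord_conn (J \<times> I) (hom_matrix I e J f) z p = coord_conn (J \<times> I) (hom_matrix I e J f) (hom_chart I e J f Z) p"
      using p by (simp add: coord_conn_def bspec[OF Zc])
    then show "hom_chart I e J f Y p = hom_chart I e J f (nabla Hom Z) p"
      using bspec[OF z p] hom_chart_nabla[OF bM bN Z p] by (simp add: coord_conn_def)
  qed
  then show ?thesis using Z by blast
qed

theorem hom_is_convergent_modulo_exact: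
  assumes bM: "M.coord_basis I e" and bN: "N.coord_basis J f"
    and \<psi>: "\<psi> \<in> lin_maps (subfield_ring UNIV) M.ext N.ext"
  shows "\<exists>Y\<in>lin_maps (subfield_ring A) M N. \<exists>\<phi>\<in>lin_maps (subfield_ring UNIV) M.ext N.ext.
    \<psi> = ext_map Y \<oplus>\<^bsub>MN.Hom\<^esub> nabla MN.Hom \<phi>"
proof -
  note bM' = M.ext_coord_basis[OF bM] and bN' = N.ext_coord_basis[OF bN]
  let ?c = "MN.hom_chart I (\<lambda>i. M.pure 1 (e i)) J (\<lambda>j. N.pure 1 (f j))"
  have fin: "finite (J \<times> I)" using M.coord_basisD(1)[OF bM] N.coord_basisD(1)[OF bN] by simp
  obtain x where x: "\<And>p. p \<in> J \<times> I \<Longrightarrow>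
      \<exists>L. \<forall>l\<ge>L. (?c \<psi> p - coord_conn (J \<times> I) (hom_matrix I e J f) x p) $$ l = 0"
    using coord_conn_onto_modulo_polynomials[OF fin, of "?c \<psi>"] by blast
  obtain \<phi> where \<phi>: "\<phi> \<in> lin_maps (subfield_ring UNIV) M.ext N.ext" "\<And>p. p \<in> J \<times> I \<Longrightarrow> ?c \<phi> p = x p"
    using MN.hom_chart_surj[OF bM' bN', of x] by blast
  define y where "y p = ?c \<psi> p - coord_conn (J \<times> I) (hom_matrix I e J f) x p" for p
  have "y p \<in> A" if "p \<in> J \<times> I" for p using x[OF that] unfolding y_def by (rule finite_in)
  then obtain Y where Y: "Y \<in> lin_maps (subfield_ring A) M N" "\<And>p. p \<in> J \<times> I \<Longrightarrow> hom_chart I e J f Y p = y p"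
    using hom_chart_surj[OF bM bN, of y] by blast
  have "\<psi> = ext_map Y \<oplus>\<^bsub>MN.Hom\<^esub> nabla MN.Hom \<phi>"
  proof (rule MN.hom_chart_inj[OF bM' bN' \<psi> MN.Hom_add_closed[OF ext_map_lin[OF Y(1)] MN.Hom_nabla_closed[OF \<phi>(1)]]])
    fix p assume p: "p \<in> J \<times> I"
    have "coord_conn (J \<times> I) (hom_matrix I e J f) (?c \<phi>) p = coord_conn (J \<times> I) (hom_matrix I e J f) x p"
      using \<phi>(2) p by (simp add: coord_conn_def)
    then show "?c \<psi> p = ?c (ext_map Y \<oplus>\<^bsub>MN.Hom\<^esub> nabla MN.Hom \<phi>) p"
      using MN.hom_chart_add[OF bM' bN' ext_map_lin[OF Y(1)] MN.Hom_nabla_closed[OF \<phi>(1)] p]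
        hom_chart_ext_map[OF bM bN Y(1) p] Y(2)[OF p] hom_chart_ext_nabla[OF bM bN \<phi>(1) p]
      by (simp add: y_def)
  qed
  then show ?thesis using Y(1) \<phi>(1) by blast
qed

end

section \<open>Extensions and their cocycles\<close>

text \<open>
  The extension with underlying module \<open>N \<times> M\<close> whose connection is twisted by the cocycle \<open>y\<close>.
\<close>

definition split_dmod :: "('a, 'm) dmod \<Rightarrow> ('a, 'n) dmod \<Rightarrow> ('m \<Rightarrow> 'n) \<Rightarrow> ('a, 'n \<times> 'm) dmod" where
  "split_dmod M N y =
     \<lparr>carrier = carrier N \<times> carrier M, monoid.mult = undefined, monoid.one = undefined,
      ring.zero = (\<zero>\<^bsub>N\<^esub>, \<zero>\<^bsub>M\<^esub>),
      ring.add = (\<lambda>(n, m) (n', m'). (n \<oplus>\<^bsub>N\<^esub> n', m \<oplus>\<^bsub>M\<^esub> m')),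
      module.smult = (\<lambda>a (n, m). (a \<odot>\<^bsub>N\<^esub> n, a \<odot>\<^bsub>M\<^esub> m)),
      nabla = (\<lambda>(n, m). (nabla N n \<oplus>\<^bsub>N\<^esub> y m, nabla M m))\<rparr>"

definition split_ext :: "('a, 'm) dmod \<Rightarrow> ('a, 'n) dmod \<Rightarrow> ('m \<Rightarrow> 'n) \<Rightarrow> ('a, 'n, 'n \<times> 'm, 'm) extn" where
  "split_ext M N y = (split_dmod M N y, \<lambda>n\<in>carrier N. (n, \<zero>\<^bsub>M\<^esub>), \<lambda>z\<in>carrier N \<times> carrier M. snd z)"

lemma split_dmod_simps [simp]:
  "carrier (split_dmod M N y) = carrier N \<times> carrier M"
  "\<zero>\<^bsub>split_dmod M N y\<^esub> = (\<zero>\<^bsub>N\<^esub>, \<zero>\<^bsub>M\<^esub>)"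
  "(n, m) \<oplus>\<^bsub>split_dmod M N y\<^esub> (n', m') = (n \<oplus>\<^bsub>N\<^esub> n', m \<oplus>\<^bsub>M\<^esub> m')"
  "a \<odot>\<^bsub>split_dmod M N y\<^esub> (n, m) = (a \<odot>\<^bsub>N\<^esub> n, a \<odot>\<^bsub>M\<^esub> m)"
  "nabla (split_dmod M N y) (n, m) = (nabla N n \<oplus>\<^bsub>N\<^esub> y m, nabla M m)"
  by (simp_all add: split_dmod_def)

lemma extensionsD:
  assumes "(E, i, p) \<in> extensions R d M N"
  shows "diff_module R d E" "i \<in> dmod_hom R N E" "p \<in> dmod_hom R E M" "inj_on i (carrier N)"
    "i ` carrier N = {x \<in> carrier E. p x = \<zero>\<^bsub>M\<^esub>}" "p ` carrier E = carrier M"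
  using assms by (auto simp: extensions_def short_exact_def a_kernel_def')

lemma extensionsI:
  assumes "diff_module R d E" "i \<in> dmod_hom R N E" "p \<in> dmod_hom R E M" "inj_on i (carrier N)"
    "i ` carrier N = {x \<in> carrier E. p x = \<zero>\<^bsub>M\<^esub>}" "p ` carrier E = carrier M"
  shows "(E, i, p) \<in> extensions R d M N"
  using assms by (auto simp: extensions_def short_exact_def a_kernel_def')

lemma ext_equivI:
  assumes "g \<in> dmod_iso R E E'" "\<And>x. x \<in> carrier N \<Longrightarrow> g (i x) = i' x" "\<And>y. y \<in> carrier E \<Longrightarrow> p' (g y) = p y"
  shows "ext_equiv R M N (E, i, p) (E', i', p')"
  using assms by (auto simp: ext_equiv_def)

lemma ext_equivE:
  assumes "ext_equiv R M N (E, i, p) (E', i', p')"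
  obtains g where "g \<in> dmod_iso R E E'" "\<And>x. x \<in> carrier N \<Longrightarrow> g (i x) = i' x"
    "\<And>y. y \<in> carrier E \<Longrightarrow> p' (g y) = p y"
  using assms by (auto simp: ext_equiv_def)

lemma ext_equiv_sym:
  assumes E: "diff_module R d E" and i: "\<And>x. x \<in> carrier N \<Longrightarrow> i x \<in> carrier E"
    and eq: "ext_equiv R M N (E, i, p) (E', i', p')"
  shows "ext_equiv R M N (E', i', p') (E, i, p)"
proof -
  obtain g where g: "g \<in> dmod_iso R E E'" "\<And>x. x \<in> carrier N \<Longrightarrow> g (i x) = i' x"
    "\<And>y. y \<in> carrier E \<Longrightarrow> p' (g y) = p y" using eq by (rule ext_equivE) blast
  note gD = dmod_isoD[OF g(1)]
  let ?h = "\<lambda>y\<in>carrier E'. inv_into (carrier E) g y"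
  have hg: "?h (g x) = x" if "x \<in> carrier E" for x
    using that gD(3) lin_mapsD(1)[OF gD(2) that] by simp
  show ?thesis
  proof (rule ext_equivI[OF dmod_iso_inverse[OF E g(1)]])
    show "?h (i' x) = i x" if "x \<in> carrier N" for x
      using hg[OF i[OF that]] g(2)[OF that] by simp
    fix y assume "y \<in> carrier E'"
    then obtain x where x: "x \<in> carrier E" "y = g x" using gD(4) by blast
    show "p (?h y) = p' y" unfolding x(2) hg[OF x(1)] g(3)[OF x(1)] ..
  qed
qed

lemma ext_equiv_trans:
  assumes E: "diff_module R d E" and i: "\<And>x. x \<in> carrier N \<Longrightarrow> i x \<in> carrier E"
    and eq: "ext_equiv R M N (E, i, p) (E', i', p')" and eq': "ext_equiv R M N (E', i', p') (E'', i'', p'')"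
  shows "ext_equiv R M N (E, i, p) (E'', i'', p'')"
proof -
  obtain g where g: "g \<in> dmod_iso R E E'" "\<And>x. x \<in> carrier N \<Longrightarrow> g (i x) = i' x"
    "\<And>y. y \<in> carrier E \<Longrightarrow> p' (g y) = p y" using eq by (rule ext_equivE) blast
  obtain h where h: "h \<in> dmod_iso R E' E''" "\<And>x. x \<in> carrier N \<Longrightarrow> h (i' x) = i'' x"
    "\<And>y. y \<in> carrier E' \<Longrightarrow> p'' (h y) = p' y" using eq' by (rule ext_equivE) blast
  show ?thesis
    by (rule ext_equivI[OF dmod_iso_comp[OF E g(1) h(1)]])
       (simp_all add: g h i lin_mapsD(1)[OF dmod_isoD(2)[OF g(1)]])
qed

context diff_vector_spaces
begin

lemma split_dmod_diff_module:
  assumes y: "y \<in> lin_maps (subfield_ring A) M N"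
  shows "diff_module (subfield_ring A) d (split_dmod M N y)"
proof -
  have "abelian_group (split_dmod M N y)"
  proof (rule abelian_groupI)
    fix x assume "x \<in> carrier (split_dmod M N y)"
    then obtain n m where "x = (n, m)" "n \<in> carrier N" "m \<in> carrier M" by auto
    then show "\<exists>z\<in>carrier (split_dmod M N y). z \<oplus>\<^bsub>split_dmod M N y\<^esub> x = \<zero>\<^bsub>split_dmod M N y\<^esub>"
      by (intro bexI[of _ "(\<ominus>\<^bsub>N\<^esub> n, \<ominus>\<^bsub>M\<^esub> m)"]) (auto simp: N.D.M.l_neg M.D.M.l_neg)
  qed (auto simp: N.D.M.a_ac M.D.M.a_ac)
  then have "module (subfield_ring A) (split_dmod M N y)"
    by (intro moduleI[OF M.cring_subfield_ring])
       (auto simp: M.smult_add_left M.smult_add_right M.smult_mult N.smult_add_left N.smult_add_right N.smult_mult)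
  then interpret S: module "subfield_ring A" "split_dmod M N y" .
  show ?thesis
    by unfold_locales
       (auto simp: lin_in[OF y] lin_mapsD(2,3)[OF y] M.nabla_add N.nabla_add M.nabla_smult N.nabla_smult
         N.smult_add_right N.D.M.a_ac)
qed

lemma split_ext_extension:
  assumes y: "y \<in> lin_maps (subfield_ring A) M N"
  shows "split_ext M N y \<in> extensions (subfield_ring A) d M N"
  unfolding split_ext_def
proof (rule extensionsI[OF split_dmod_diff_module[OF y]])
  show "(\<lambda>n\<in>carrier N. (n, \<zero>\<^bsub>M\<^esub>)) \<in> dmod_hom (subfield_ring A) N (split_dmod M N y)"
    by (intro dmod_homI lin_mapsI) (auto simp: lin_zero[OF y])
  show "(\<lambda>z\<in>carrier N \<times> carrier M. snd z) \<in> dmod_hom (subfield_ring A) (split_dmod M N y) M"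
    by (intro dmod_homI lin_mapsI) (auto simp: lin_in[OF y])
  show "inj_on (\<lambda>n\<in>carrier N. (n, \<zero>\<^bsub>M\<^esub>)) (carrier N)" by (auto simp: inj_on_def)
  show "(\<lambda>z\<in>carrier N \<times> carrier M. snd z) ` carrier (split_dmod M N y) = carrier M"
    using N.D.M.zero_closed by (auto simp: image_iff)
qed auto

end

text \<open>
  A linear section \<open>s\<close> of \<open>p\<close> need not commute with the connections; the defect
  \<open>\<nabla> (s m) - s (\<nabla> m)\<close> lies in the image of \<open>i\<close> and defines the cocycle \<open>y\<close>.
\<close>

definition splits_with_cocycle ::
    "'a ring \<Rightarrow> ('a, 'm) dmod \<Rightarrow> ('a, 'n) dmod \<Rightarrow> ('m \<Rightarrow> 'n) \<Rightarrow> ('a, 'n, 'e, 'm) extn \<Rightarrow> ('m \<Rightarrow> 'e) \<Rightarrow> bool" where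
  "splits_with_cocycle R M N y = (\<lambda>(E, i, p) s. s \<in> lin_maps R M E \<and>
     (\<forall>m\<in>carrier M. p (s m) = m \<and> nabla E (s m) = s (nabla M m) \<oplus>\<^bsub>E\<^esub> i (y m)))"

locale dmod_extension = diff_vector_spaces A d M N + E: diff_vector_space A d E
  for A :: "'a::field set" and d and M :: "('a, 'm) dmod" and N :: "('a, 'n) dmod" and E :: "('a, 'e) dmod" +
  fixes i :: "'n \<Rightarrow> 'e" and p :: "'e \<Rightarrow> 'm"
  assumes ext: "(E, i, p) \<in> extensions (subfield_ring A) d M N"
begin

sublocale NE: diff_vector_spaces A d N E by unfold_locales
sublocale EM: diff_vector_spaces A d E M by unfold_locales
sublocale ME: diff_vector_spaces A d M E by unfold_locales
sublocale EN: diff_vector_spaces A d E N by unfold_locales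

lemma i_lin: "i \<in> lin_maps (subfield_ring A) N E" and p_lin: "p \<in> lin_maps (subfield_ring A) E M"
  and i_nabla: "n \<in> carrier N \<Longrightarrow> i (nabla N n) = nabla E (i n)"
  and p_nabla: "x \<in> carrier E \<Longrightarrow> p (nabla E x) = nabla M (p x)"
  using extensionsD[OF ext] by (auto dest: dmod_homD)

lemmas i_in = NE.lin_in[OF i_lin] and p_in = EM.lin_in[OF p_lin]
lemmas i_simps = lin_mapsD(2,3)[OF i_lin] and p_simps = lin_mapsD(2,3)[OF p_lin]

lemma p_i [simp]: "n \<in> carrier N \<Longrightarrow> p (i n) = \<zero>\<^bsub>M\<^esub>"
  using extensionsD(5)[OF ext] by blast

lemma i_inj: "n \<in> carrier N \<Longrightarrow> n' \<in> carrier N \<Longrightarrow> i n = i n' \<Longrightarrow> n = n'"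
  using extensionsD(4)[OF ext] by (auto dest: inj_onD)

lemma kernel_p: "x \<in> carrier E \<Longrightarrow> p x = \<zero>\<^bsub>M\<^esub> \<Longrightarrow> \<exists>n\<in>carrier N. x = i n"
  using extensionsD(5)[OF ext] by blast

lemma p_surj: "m \<in> carrier M \<Longrightarrow> \<exists>x\<in>carrier E. p x = m"
  using extensionsD(6)[OF ext] by (metis imageE)

text \<open>
  Lift a basis of \<open>M\<close> to \<open>E\<close> and extend linearly.  The defect of the resulting section is its
  derivative in \<open>Hom(M, E)\<close>, hence linear, and \<open>p\<close> kills it.
\<close>

lemma splitting_exists:
  assumes b: "M.coord_basis I e"
  shows "\<exists>y\<in>lin_maps (subfield_ring A) M N. \<exists>s. splits_with_cocycle (subfield_ring A) M N y (E, i, p) s"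
proof -
  have "\<forall>k\<in>I. \<exists>x\<in>carrier E. p x = e k" using p_surj M.coord_basisD(3)[OF b] by blast
  then obtain t where t: "\<And>k. k \<in> I \<Longrightarrow> t k \<in> carrier E" "\<And>k. k \<in> I \<Longrightarrow> p (t k) = e k" by metis
  have "t \<in> I \<rightarrow> carrier E" using t(1) by auto
  from ME.lin_map_exists[OF b this] obtain s where
    s: "s \<in> lin_maps (subfield_ring A) M E" "\<And>k. k \<in> I \<Longrightarrow> s (e k) = t k" by blast
  interpret MM: diff_vector_spaces A d M M by unfold_locales
  have ps: "p (s m) = m" if m: "m \<in> carrier M" for m
  proof -
    have "(\<lambda>m\<in>carrier M. p (s m)) = (\<lambda>m\<in>carrier M. m)"
    proof (rule MM.lin_maps_basis_eqI[OF b])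
      show "(\<lambda>m\<in>carrier M. p (s m)) \<in> lin_maps (subfield_ring A) M M"
        by (rule lin_maps_comp[OF s(1) p_lin]) auto
      show "(\<lambda>m\<in>carrier M. m) \<in> lin_maps (subfield_ring A) M M" by (rule lin_mapsI) auto
    qed (simp add: s t M.coord_basisD(3)[OF b])
    then show ?thesis using m by (metis restrict_apply')
  qed
  define \<delta> where "\<delta> = nabla ME.Hom s"
  have \<delta>: "\<delta> \<in> lin_maps (subfield_ring A) M E" unfolding \<delta>_def by (rule ME.Hom_nabla_closed[OF s(1)])
  have \<delta>_eq: "\<delta> m = nabla E (s m) \<ominus>\<^bsub>E\<^esub> s (nabla M m)" if "m \<in> carrier M" for m using that by (simp add: \<delta>_def)
  have "p (\<delta> m) = \<zero>\<^bsub>M\<^esub>" if m: "m \<in> carrier M" for m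
    using m ME.lin_in[OF s(1)] EM.lin_minus[OF p_lin, of "nabla E (s m)" "s (nabla M m)"]
    by (simp add: \<delta>_eq p_nabla ps a_minus_def M.D.M.r_neg)
  then have "\<forall>m\<in>carrier M. \<exists>n\<in>carrier N. \<delta> m = i n" using kernel_p ME.lin_in[OF \<delta>] by blast
  then obtain y0 where y0: "\<And>m. m \<in> carrier M \<Longrightarrow> y0 m \<in> carrier N" "\<And>m. m \<in> carrier M \<Longrightarrow> i (y0 m) = \<delta> m"
    by metis
  define y where "y = (\<lambda>m\<in>carrier M. y0 m)"
  have y: "y \<in> lin_maps (subfield_ring A) M N"
  proof (rule lin_mapsI)
    show "y (m \<oplus>\<^bsub>M\<^esub> m') = y m \<oplus>\<^bsub>N\<^esub> y m'" if "m \<in> carrier M" "m' \<in> carrier M" for m m'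
      using that by (intro i_inj) (auto simp: y_def y0 i_simps lin_mapsD(2)[OF \<delta>])
    show "y (a \<odot>\<^bsub>M\<^esub> m) = a \<odot>\<^bsub>N\<^esub> y m" if "a \<in> carrier (subfield_ring A)" "m \<in> carrier M" for a m
      using that by (intro i_inj) (auto simp: y_def y0 i_simps lin_mapsD(3)[OF \<delta>])
  qed (auto simp: y_def y0)
  have "nabla E (s m) = s (nabla M m) \<oplus>\<^bsub>E\<^esub> i (y m)" if m: "m \<in> carrier M" for m
    using m ME.lin_in[OF s(1)] by (simp add: y_def y0 \<delta>_eq E.D.M.add_minus_self)
  then show ?thesis using y s(1) ps by (auto simp: splits_with_cocycle_def)
qed

context
  fixes y s
  assumes y: "y \<in> lin_maps (subfield_ring A) M N"
    and split: "splits_with_cocycle (subfield_ring A) M N y (E, i, p) s"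
begin

lemma s_lin: "s \<in> lin_maps (subfield_ring A) M E"
  and p_s [simp]: "m \<in> carrier M \<Longrightarrow> p (s m) = m"
  and s_nabla: "m \<in> carrier M \<Longrightarrow> nabla E (s m) = s (nabla M m) \<oplus>\<^bsub>E\<^esub> i (y m)"
  using split by (auto simp: splits_with_cocycle_def)

lemmas s_in = ME.lin_in[OF s_lin]
lemmas s_simps = lin_mapsD(2,3)[OF s_lin]

lemma decomposition:
  assumes x: "x \<in> carrier E"
  shows "\<exists>n\<in>carrier N. x = i n \<oplus>\<^bsub>E\<^esub> s (p x)"
proof -
  have px: "p x \<in> carrier M" "s (p x) \<in> carrier E" using x p_in s_in by auto
  have "p (x \<ominus>\<^bsub>E\<^esub> s (p x)) = \<zero>\<^bsub>M\<^esub>"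
    unfolding EM.lin_minus[OF p_lin x px(2)] p_s[OF px(1)] using px by (simp add: a_minus_def M.D.M.r_neg)
  then obtain n where n: "n \<in> carrier N" "x \<ominus>\<^bsub>E\<^esub> s (p x) = i n" using kernel_p x px by blast
  have "x = s (p x) \<oplus>\<^bsub>E\<^esub> (x \<ominus>\<^bsub>E\<^esub> s (p x))" using x px by (simp add: E.D.M.add_minus_self)
  then show ?thesis using n px i_in by (metis E.D.M.a_comm)
qed

lemma decomposition_unique:
  assumes n: "n \<in> carrier N" "n' \<in> carrier N" and m: "m \<in> carrier M" "m' \<in> carrier M"
    and eq: "i n \<oplus>\<^bsub>E\<^esub> s m = i n' \<oplus>\<^bsub>E\<^esub> s m'"
  shows "n = n' \<and> m = m'"
proof -
  have "p (i n \<oplus>\<^bsub>E\<^esub> s m) = p (i n' \<oplus>\<^bsub>E\<^esub> s m')" using eq by simp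
  then have "m = m'" using n m by (simp add: p_simps i_in s_in)
  then show ?thesis using eq n m i_in s_in i_inj by simp
qed

lemma split_ext_equiv: "ext_equiv (subfield_ring A) M N (split_ext M N y) (E, i, p)"
  unfolding split_ext_def
proof (rule ext_equivI)
  let ?g = "\<lambda>z\<in>carrier N \<times> carrier M. i (fst z) \<oplus>\<^bsub>E\<^esub> s (snd z)"
  show "?g \<in> dmod_iso (subfield_ring A) (split_dmod M N y) E"
  proof (intro dmod_isoI dmod_homI lin_mapsI)
    show "inj_on ?g (carrier (split_dmod M N y))"
      using decomposition_unique by (auto simp: inj_on_def)
    show "?g ` carrier (split_dmod M N y) = carrier E"
    proof (intro equalityI subsetI)
      fix x assume x: "x \<in> carrier E"
      then obtain n where "n \<in> carrier N" "x = i n \<oplus>\<^bsub>E\<^esub> s (p x)" using decomposition by blast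
      then show "x \<in> ?g ` carrier (split_dmod M N y)"
        using p_in[OF x] by (intro image_eqI[of _ _ "(n, p x)"]) auto
    qed (auto simp: i_in s_in)
  qed (auto simp: i_in s_in i_simps s_simps lin_in[OF y] E.smult_add_right E.nabla_add s_nabla i_nabla E.D.M.a_ac)
  show "?g ((\<lambda>n\<in>carrier N. (n, \<zero>\<^bsub>M\<^esub>)) n) = i n" if "n \<in> carrier N" for n
    using that by (simp add: ME.lin_zero[OF s_lin] i_in)
  show "p (?g z) = (\<lambda>z\<in>carrier N \<times> carrier M. snd z) z" if "z \<in> carrier (split_dmod M N y)" for z
    using that by (auto simp: p_simps i_in s_in)
qed

end

lemma splitting_of_equiv:
  assumes y: "y \<in> lin_maps (subfield_ring A) M N"
    and eq: "ext_equiv (subfield_ring A) M N (split_ext M N y) (E, i, p)"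
  shows "\<exists>s. splits_with_cocycle (subfield_ring A) M N y (E, i, p) s"
proof -
  obtain g where g: "g \<in> dmod_iso (subfield_ring A) (split_dmod M N y) E"
    and gi: "\<And>n. n \<in> carrier N \<Longrightarrow> g ((\<lambda>n\<in>carrier N. (n, \<zero>\<^bsub>M\<^esub>)) n) = i n"
    and pg: "\<And>z. z \<in> carrier (split_dmod M N y) \<Longrightarrow> p (g z) = (\<lambda>z\<in>carrier N \<times> carrier M. snd z) z"
    using eq unfolding split_ext_def by (rule ext_equivE) blast
  note gD = lin_mapsD[OF dmod_isoD(2)[OF g]] dmod_homD(2)[OF dmod_isoD(1)[OF g]]
  let ?s = "\<lambda>m\<in>carrier M. g (\<zero>\<^bsub>N\<^esub>, m)"
  have "splits_with_cocycle (subfield_ring A) M N y (E, i, p) ?s"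
    unfolding splits_with_cocycle_def prod.case
  proof (intro conjI ballI lin_mapsI)
    show "?s (m \<oplus>\<^bsub>M\<^esub> m') = ?s m \<oplus>\<^bsub>E\<^esub> ?s m'" if "m \<in> carrier M" "m' \<in> carrier M" for m m'
      using that gD(2)[of "(\<zero>\<^bsub>N\<^esub>, m)" "(\<zero>\<^bsub>N\<^esub>, m')"] by simp
    show "?s (a \<odot>\<^bsub>M\<^esub> m) = a \<odot>\<^bsub>E\<^esub> ?s m" if "a \<in> carrier (subfield_ring A)" "m \<in> carrier M" for a m
      using that gD(3)[of a "(\<zero>\<^bsub>N\<^esub>, m)"] by simp
    fix m assume m: "m \<in> carrier M"
    show "p (?s m) = m" using m pg[of "(\<zero>\<^bsub>N\<^esub>, m)"] by simp
    have ym: "y m \<in> carrier N" using lin_in[OF y m] .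
    have "nabla E (?s m) = g (nabla (split_dmod M N y) (\<zero>\<^bsub>N\<^esub>, m))"
      using m gD(5)[of "(\<zero>\<^bsub>N\<^esub>, m)"] by simp
    also have "\<dots> = g ((\<zero>\<^bsub>N\<^esub>, nabla M m) \<oplus>\<^bsub>split_dmod M N y\<^esub> (y m, \<zero>\<^bsub>M\<^esub>))" using m ym by simp
    also have "\<dots> = ?s (nabla M m) \<oplus>\<^bsub>E\<^esub> i (y m)"
      using m ym gD(2)[of "(\<zero>\<^bsub>N\<^esub>, nabla M m)" "(y m, \<zero>\<^bsub>M\<^esub>)"] gi[OF ym] by simp
    finally show "nabla E (?s m) = ?s (nabla M m) \<oplus>\<^bsub>E\<^esub> i (y m)" .
  qed (use gD(1) in auto)
  then show ?thesis by blast
qed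

end

context diff_vector_spaces
begin

lemma dmod_extensionI:
  assumes "(E, i, p) \<in> extensions (subfield_ring A) d M N"
  shows "dmod_extension A d M N E i p"
proof -
  have "diff_vector_space A d E"
    using extensionsD(1)[OF assms] by (intro diff_vector_space.intro M.diff_subfield_axioms)
  then show ?thesis using assms
    by (intro dmod_extension.intro diff_vector_spaces_axioms dmod_extension_axioms.intro)
qed

text \<open>
  Sections of \<open>N \<times> M \<rightarrow> M\<close> are the maps \<open>m \<mapsto> (z m, m)\<close>, and passing from \<open>z = 0\<close> to \<open>z\<close> changes the
  cocycle by \<open>\<nabla> z\<close>.
\<close>

lemma split_ext_equiv_iff:
  assumes y: "y \<in> lin_maps (subfield_ring A) M N" and y': "y' \<in> lin_maps (subfield_ring A) M N"
  shows "ext_equiv (subfield_ring A) M N (split_ext M N y) (split_ext M N y') \<longleftrightarrow>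
    (\<exists>z\<in>lin_maps (subfield_ring A) M N. y = y' \<oplus>\<^bsub>Hom\<^esub> nabla Hom z)"
proof -
  let ?E = "split_dmod M N y'" and ?i = "\<lambda>n\<in>carrier N. (n, \<zero>\<^bsub>M\<^esub>)" and ?p = "\<lambda>z\<in>carrier N \<times> carrier M. snd z"
  interpret E: dmod_extension A d M N ?E ?i ?p
    using split_ext_extension[OF y'] unfolding split_ext_def by (rule dmod_extensionI)
  show ?thesis
  proof
    assume "ext_equiv (subfield_ring A) M N (split_ext M N y) (split_ext M N y')"
    then obtain s where split: "splits_with_cocycle (subfield_ring A) M N y (?E, ?i, ?p) s"
      using E.splitting_of_equiv[OF y] unfolding split_ext_def by blast
    note s = E.s_lin[OF y split] and ps = E.p_s[OF y split] and snab = E.s_nabla[OF y split]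
    note s_in = E.ME.lin_in[OF s]
    define z where "z = (\<lambda>m\<in>carrier M. fst (s m))"
    have s_eq: "s m = (z m, m)" and z_in: "z m \<in> carrier N" if m: "m \<in> carrier M" for m
      using m s_in[OF m] ps[OF m] by (auto simp: z_def prod_eq_iff split: if_splits)
    have z: "z \<in> lin_maps (subfield_ring A) M N"
    proof (rule lin_mapsI)
      show "z (m \<oplus>\<^bsub>M\<^esub> m') = z m \<oplus>\<^bsub>N\<^esub> z m'" if "m \<in> carrier M" "m' \<in> carrier M" for m m'
        using that lin_mapsD(2)[OF s that] by (simp add: s_eq)
      show "z (a \<odot>\<^bsub>M\<^esub> m) = a \<odot>\<^bsub>N\<^esub> z m" if "a \<in> carrier (subfield_ring A)" "m \<in> carrier M" for a m
        using that lin_mapsD(3)[OF s that] by (simp add: s_eq)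
    qed (use z_in in \<open>auto simp: z_def\<close>)
    have "y m = y' m \<oplus>\<^bsub>N\<^esub> (nabla N (z m) \<ominus>\<^bsub>N\<^esub> z (nabla M m))" if m: "m \<in> carrier M" for m
    proof -
      have cl: "y m \<in> carrier N" "y' m \<in> carrier N" "nabla N (z m) \<in> carrier N" "z (nabla M m) \<in> carrier N"
        using m lin_in[OF y] lin_in[OF y'] z_in by auto
      have "nabla N (z m) \<oplus>\<^bsub>N\<^esub> y' m = z (nabla M m) \<oplus>\<^bsub>N\<^esub> y m"
        using snab[OF m] m cl by (simp add: s_eq)
      then have "y m = \<ominus>\<^bsub>N\<^esub> z (nabla M m) \<oplus>\<^bsub>N\<^esub> (nabla N (z m) \<oplus>\<^bsub>N\<^esub> y' m)"
        using cl by (simp add: N.D.M.r_neg1)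
      then show ?thesis using cl by (simp add: a_minus_def N.D.M.a_ac)
    qed
    then have "y = y' \<oplus>\<^bsub>Hom\<^esub> nabla Hom z"
      by (intro Hom_eqI[OF y Hom_add_closed[OF y' Hom_nabla_closed[OF z]]]) simp
    then show "\<exists>z\<in>lin_maps (subfield_ring A) M N. y = y' \<oplus>\<^bsub>Hom\<^esub> nabla Hom z" using z by blast
  next
    assume "\<exists>z\<in>lin_maps (subfield_ring A) M N. y = y' \<oplus>\<^bsub>Hom\<^esub> nabla Hom z"
    then obtain z where z: "z \<in> lin_maps (subfield_ring A) M N" "y = y' \<oplus>\<^bsub>Hom\<^esub> nabla Hom z" by blast
    have "splits_with_cocycle (subfield_ring A) M N y (?E, ?i, ?p) (\<lambda>m\<in>carrier M. (z m, m))"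
      unfolding splits_with_cocycle_def prod.case
    proof (intro conjI ballI lin_mapsI)
      fix m assume m: "m \<in> carrier M"
      have cl: "z m \<in> carrier N" "y' m \<in> carrier N" "z (nabla M m) \<in> carrier N"
        using m lin_in[OF z(1)] lin_in[OF y'] by auto
      have "z (nabla M m) \<oplus>\<^bsub>N\<^esub> (y' m \<oplus>\<^bsub>N\<^esub> (nabla N (z m) \<ominus>\<^bsub>N\<^esub> z (nabla M m)))
          = y' m \<oplus>\<^bsub>N\<^esub> (z (nabla M m) \<oplus>\<^bsub>N\<^esub> (nabla N (z m) \<ominus>\<^bsub>N\<^esub> z (nabla M m)))"
        using cl by (simp add: N.D.M.a_lcomm)
      also have "\<dots> = nabla N (z m) \<oplus>\<^bsub>N\<^esub> y' m" using cl by (simp add: N.D.M.add_minus_self N.D.M.a_comm)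
      finally show "nabla ?E ((\<lambda>m\<in>carrier M. (z m, m)) m) =
          (\<lambda>m\<in>carrier M. (z m, m)) (nabla M m) \<oplus>\<^bsub>?E\<^esub> ?i (y m)"
        using m cl lin_in[OF y m] by (simp add: z(2))
    qed (auto simp: lin_in[OF z(1)] lin_mapsD(2,3)[OF z(1)])
    from E.split_ext_equiv[OF y this]
    show "ext_equiv (subfield_ring A) M N (split_ext M N y) (split_ext M N y')"
      by (simp add: split_ext_def[of M N y'])
  qed
qed

end

section \<open>Baer sums\<close>

text \<open>
  What symmetry and transitivity of equivalence need.  For a Baer sum this is available before the
  remaining properties of an extension are.
\<close>

definition extension_data ::
    "'a ring \<Rightarrow> ('a \<Rightarrow> 'a) \<Rightarrow> ('a, 'n) dmod \<Rightarrow> ('a, 'n, 'e, 'm) extn \<Rightarrow> bool" where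
  "extension_data R d N = (\<lambda>(E, i, p). diff_module R d E \<and> (\<forall>n\<in>carrier N. i n \<in> carrier E))"

lemma extension_data_extension:
  assumes "e \<in> extensions R d M N"
  shows "extension_data R d N e"
proof -
  obtain E i p where e: "e = (E, i, p)" by (cases e) auto
  show ?thesis
    using extensionsD(1,2)[OF assms[unfolded e]]
    by (auto simp: extension_data_def e dest: dmod_homD(1) lin_mapsD(1))
qed

lemma extension_equiv_sym:
  assumes "extension_data R d N e" "ext_equiv R M N e e'"
  shows "ext_equiv R M N e' e"
  using assms by (cases e; cases e') (auto simp: extension_data_def intro: ext_equiv_sym)

lemma extension_equiv_trans:
  assumes "extension_data R d N e" "ext_equiv R M N e e'" "ext_equiv R M N e' e''"
  shows "ext_equiv R M N e e''"
  using assms by (cases e; cases e'; cases e'') (auto simp: extension_data_def intro: ext_equiv_trans)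

lemma fibre_product_simps [simp]:
  "carrier (fibre_product E p E' p') = {(x, y). x \<in> carrier E \<and> y \<in> carrier E' \<and> p x = p' y}"
  "\<zero>\<^bsub>fibre_product E p E' p'\<^esub> = (\<zero>\<^bsub>E\<^esub>, \<zero>\<^bsub>E'\<^esub>)"
  "(x, y) \<oplus>\<^bsub>fibre_product E p E' p'\<^esub> (x', y') = (x \<oplus>\<^bsub>E\<^esub> x', y \<oplus>\<^bsub>E'\<^esub> y')"
  "a \<odot>\<^bsub>fibre_product E p E' p'\<^esub> (x, y) = (a \<odot>\<^bsub>E\<^esub> x, a \<odot>\<^bsub>E'\<^esub> y)"
  "nabla (fibre_product E p E' p') (x, y) = (nabla E x, nabla E' y)"
  by (simp_all add: fibre_product_def)

lemma (in abelian_group) uminus_zero [simp]: "\<ominus> \<zero> = \<zero>"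
  by (rule minus_equality) auto

lemma (in abelian_subgroup) coset_absorb:
  assumes "h \<in> H" "x \<in> carrier G"
  shows "H +> (h \<oplus> x) = H +> x"
proof -
  have "h \<oplus> x \<in> H +> x" using assms by (auto simp: a_r_coset_def')
  from a_repr_independence'[OF this assms(2)] show ?thesis by simp
qed

text \<open>
  The Baer sum is the quotient of the fibre product \<open>P\<close> by the antidiagonal \<open>U\<close>.
\<close>

locale dmod_extension_pair = X1: dmod_extension A d M N E i p + X2: dmod_extension A d M N E' i' p'
  for A :: "'a::field set" and d and M :: "('a, 'm) dmod" and N :: "('a, 'n) dmod"
    and E :: "('a, 'e) dmod" and i p and E' :: "('a, 'f) dmod" and i' p'
begin

abbreviation "P \<equiv> fibre_product E p E' p'"
abbreviation "U \<equiv> (\<lambda>n. (i n, \<ominus>\<^bsub>E'\<^esub> i' n)) ` carrier N"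

lemma abelian_group_fibre_product: "abelian_group P"
proof (rule abelian_groupI)
  fix z assume "z \<in> carrier P"
  then obtain x y where z: "z = (x, y)" "x \<in> carrier E" "y \<in> carrier E'" "p x = p' y" by auto
  then show "\<exists>w\<in>carrier P. w \<oplus>\<^bsub>P\<^esub> z = \<zero>\<^bsub>P\<^esub>"
    by (intro bexI[of _ "(\<ominus>\<^bsub>E\<^esub> x, \<ominus>\<^bsub>E'\<^esub> y)"])
       (auto simp: X1.E.D.M.l_neg X2.E.D.M.l_neg X1.EM.lin_uminus[OF X1.p_lin] X2.EM.lin_uminus[OF X2.p_lin])
qed (auto simp: X1.p_simps X2.p_simps X1.E.D.M.a_ac X2.E.D.M.a_ac
    X1.EM.lin_zero[OF X1.p_lin] X2.EM.lin_zero[OF X2.p_lin])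

lemma antidiagonal_eq: "n \<in> carrier N \<Longrightarrow> (i n, \<ominus>\<^bsub>E'\<^esub> i' n) = (i n, i' (\<ominus>\<^bsub>N\<^esub> n))"
  by (simp add: X2.NE.lin_uminus[OF X2.i_lin])

lemma U_eq: "U = (\<lambda>n. (i n, i' (\<ominus>\<^bsub>N\<^esub> n))) ` carrier N"
  by (intro image_cong refl antidiagonal_eq)

lemma U_in: "z \<in> U \<Longrightarrow> z \<in> carrier P"
  unfolding U_eq by (auto simp: X1.i_in X2.i_in)

lemma U_subgroup: "abelian_subgroup U P"
proof (rule abelian_subgroupI3[OF _ abelian_group_fibre_product])
  interpret P: abelian_group P by (rule abelian_group_fibre_product)
  show "additive_subgroup U P"
  proof (intro additive_subgroup.intro subgroup.intro)
    show "U \<subseteq> carrier (add_monoid P)" using U_in by auto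
    show "x \<otimes>\<^bsub>add_monoid P\<^esub> y \<in> U" if x: "x \<in> U" and y: "y \<in> U" for x y
    proof -
      obtain n where n: "n \<in> carrier N" "x = (i n, i' (\<ominus>\<^bsub>N\<^esub> n))" using x unfolding U_eq by (rule imageE)
      obtain k where k: "k \<in> carrier N" "y = (i k, i' (\<ominus>\<^bsub>N\<^esub> k))" using y unfolding U_eq by (rule imageE)
      have "x \<otimes>\<^bsub>add_monoid P\<^esub> y = (i (n \<oplus>\<^bsub>N\<^esub> k), i' (\<ominus>\<^bsub>N\<^esub> (n \<oplus>\<^bsub>N\<^esub> k)))"
        using n k by (simp add: X1.i_simps X2.i_simps X1.N.D.M.minus_add)
      then show ?thesis unfolding U_eq using n(1) k(1) by (metis (no_types, lifting) X1.N.D.M.a_closed imageI)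
    qed
    show "\<one>\<^bsub>add_monoid P\<^esub> \<in> U"
      unfolding U_eq
      by (intro image_eqI[of _ _ "\<zero>\<^bsub>N\<^esub>"]) (auto simp: X1.NE.lin_zero[OF X1.i_lin] X2.NE.lin_zero[OF X2.i_lin])
    show "inv\<^bsub>add_monoid P\<^esub> x \<in> U" if x: "x \<in> U" for x
    proof -
      obtain n where n: "n \<in> carrier N" "x = (i n, i' (\<ominus>\<^bsub>N\<^esub> n))" using x unfolding U_eq by (rule imageE)
      have u: "(i (\<ominus>\<^bsub>N\<^esub> n), i' (\<ominus>\<^bsub>N\<^esub> (\<ominus>\<^bsub>N\<^esub> n))) \<in> U"
        unfolding U_eq by (rule imageI) (use n in simp)
      have "(i (\<ominus>\<^bsub>N\<^esub> n), i' (\<ominus>\<^bsub>N\<^esub> (\<ominus>\<^bsub>N\<^esub> n))) \<oplus>\<^bsub>P\<^esub> x = \<zero>\<^bsub>P\<^esub>"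
        using n(1) unfolding n(2)
        by (simp add: X1.i_simps(1)[symmetric] X2.i_simps(1)[symmetric] X1.N.D.M.l_neg X1.N.D.M.r_neg
            X1.NE.lin_zero[OF X1.i_lin] X2.NE.lin_zero[OF X2.i_lin])
      then have "\<ominus>\<^bsub>P\<^esub> x = (i (\<ominus>\<^bsub>N\<^esub> n), i' (\<ominus>\<^bsub>N\<^esub> (\<ominus>\<^bsub>N\<^esub> n)))"
        by (rule P.minus_equality[OF _ U_in[OF x] U_in[OF u]])
      then show ?thesis using u unfolding a_inv_def[symmetric] by simp
    qed
  qed
qed

lemma U_smult: "a \<in> A \<Longrightarrow> z \<in> U \<Longrightarrow> a \<odot>\<^bsub>P\<^esub> z \<in> U"
  by (auto simp: X2.E.smult_minus_right X1.i_simps(2)[symmetric] X2.i_simps(2)[symmetric] X2.i_in)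

lemma U_nabla: "z \<in> U \<Longrightarrow> nabla P z \<in> U"
  by (auto simp: X2.E.nabla_uminus X1.i_nabla[symmetric] X2.i_nabla[symmetric] X2.i_in)

lemma baer_smult_coset:
  assumes "a \<in> A" "z \<in> carrier P"
  shows "U <+>\<^bsub>P\<^esub> ((\<lambda>x. a \<odot>\<^bsub>P\<^esub> x) ` (U +>\<^bsub>P\<^esub> z)) = U +>\<^bsub>P\<^esub> (a \<odot>\<^bsub>P\<^esub> z)"
  by (rule abelian_subgroup.induced_map_on_coset[OF U_subgroup _ _ U_subgroup U_smult[OF assms(1)] assms(2)])
     (use assms in \<open>auto simp: X1.p_simps X2.p_simps X1.E.smult_add_right X2.E.smult_add_right\<close>)

lemma baer_nabla_coset:
  assumes "z \<in> carrier P"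
  shows "U <+>\<^bsub>P\<^esub> (nabla P ` (U +>\<^bsub>P\<^esub> z)) = U +>\<^bsub>P\<^esub> nabla P z"
  by (rule abelian_subgroup.induced_map_on_coset[OF U_subgroup _ _ U_subgroup U_nabla assms])
     (use assms in \<open>auto simp: X1.p_nabla X2.p_nabla X1.E.nabla_add X2.E.nabla_add\<close>)

text \<open>
  Sections \<open>s\<close> and \<open>s'\<close> with cocycles \<open>y\<close> and \<open>y'\<close> combine to the section \<open>m \<mapsto> (s m, s' m)\<close> of the Baer
  sum.  Its defect is \<open>(i (y m), i' (y' m))\<close>, which modulo the antidiagonal equals
  \<open>(i (y m + y' m), 0)\<close>.
\<close>

lemma baer_sum_cocycle:
  assumes y: "y \<in> lin_maps (subfield_ring A) M N" and y': "y' \<in> lin_maps (subfield_ring A) M N"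
    and eq: "ext_equiv (subfield_ring A) M N (split_ext M N y) (E, i, p)"
    and eq': "ext_equiv (subfield_ring A) M N (split_ext M N y') (E', i', p')"
  shows "ext_equiv (subfield_ring A) M N (split_ext M N (y \<oplus>\<^bsub>X1.Hom\<^esub> y')) (baer_sum N (E, i, p) (E', i', p'))"
    and "extension_data (subfield_ring A) d N (baer_sum N (E, i, p) (E', i', p'))"
proof -
  interpret U: abelian_subgroup U P by (rule U_subgroup)
  obtain s where split: "splits_with_cocycle (subfield_ring A) M N y (E, i, p) s"
    using X1.splitting_of_equiv[OF y eq] by blast
  obtain s' where split': "splits_with_cocycle (subfield_ring A) M N y' (E', i', p') s'"
    using X2.splitting_of_equiv[OF y' eq'] by blast
  note s = X1.s_lin[OF y split] X1.p_s[OF y split] X1.s_nabla[OF y split] X1.s_in[OF y split] X1.s_simps[OF y split]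
  note s' = X2.s_lin[OF y' split'] X2.p_s[OF y' split'] X2.s_nabla[OF y' split'] X2.s_in[OF y' split'] X2.s_simps[OF y' split']
  let ?g = "\<lambda>n m. (i n \<oplus>\<^bsub>E\<^esub> s m, s' m)"
  have g_in: "?g n m \<in> carrier P" if "n \<in> carrier N" "m \<in> carrier M" for n m
    using that by (simp add: X1.i_in s s' X1.p_simps)
  define Q where "Q = quot_dmod P U"
  define G where "G = (\<lambda>z\<in>carrier N \<times> carrier M. U +>\<^bsub>P\<^esub> ?g (fst z) (snd z))"
  have G: "G (n, m) = U +>\<^bsub>P\<^esub> ?g n m" if "n \<in> carrier N" "m \<in> carrier M" for n m
    using that by (simp add: G_def)
  have Y: "(y \<oplus>\<^bsub>X1.Hom\<^esub> y') m = y m \<oplus>\<^bsub>N\<^esub> y' m" if "m \<in> carrier M" for m using that by simp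
  have yin: "y m \<in> carrier N" "y' m \<in> carrier N" if "m \<in> carrier M" for m
    using X1.lin_in[OF y that] X1.lin_in[OF y' that] by auto
  let ?S = "split_dmod M N (y \<oplus>\<^bsub>X1.Hom\<^esub> y')"
  have iso: "G \<in> dmod_iso (subfield_ring A) ?S Q"
  proof (intro dmod_isoI dmod_homI lin_mapsI)
    fix z assume z: "z \<in> carrier ?S"
    then obtain n m where nm: "z = (n, m)" "n \<in> carrier N" "m \<in> carrier M" by auto
    show "G z \<in> carrier Q"
      using nm g_in[OF nm(2,3)] U.a_subset by (simp add: G Q_def U.a_rcosetsI)
    show "G (a \<odot>\<^bsub>?S\<^esub> z) = a \<odot>\<^bsub>Q\<^esub> G z" if "a \<in> carrier (subfield_ring A)" for a
    proof -
      have "a \<odot>\<^bsub>Q\<^esub> G z = U +>\<^bsub>P\<^esub> (a \<odot>\<^bsub>P\<^esub> ?g n m)"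
        using nm that baer_smult_coset[OF _ g_in[OF nm(2,3)], of a] by (simp add: G Q_def)
      then show ?thesis using nm that by (simp add: G X1.i_simps s s' X1.E.smult_add_right X1.i_in)
    qed
    have k: "(\<ominus>\<^bsub>N\<^esub> y' m) \<in> carrier N" using yin nm by simp
    have cl: "i (nabla N n) \<in> carrier E" "i (y m) \<in> carrier E" "i (y' m) \<in> carrier E" "s (nabla M m) \<in> carrier E"
      using nm yin by (auto simp: X1.i_in s)
    \<comment> \<open>Moving \<open>y' m\<close> from the second component to the first costs the antidiagonal element of
      \<open>- y' m\<close>.\<close>
    have "nabla P (?g n m) = (i (\<ominus>\<^bsub>N\<^esub> y' m), \<ominus>\<^bsub>E'\<^esub> i' (\<ominus>\<^bsub>N\<^esub> y' m))
        \<oplus>\<^bsub>P\<^esub> ?g (nabla N n \<oplus>\<^bsub>N\<^esub> (y m \<oplus>\<^bsub>N\<^esub> y' m)) (nabla M m)"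
    proof -
      have "\<ominus>\<^bsub>E\<^esub> i (y' m) \<oplus>\<^bsub>E\<^esub> (i (nabla N n) \<oplus>\<^bsub>E\<^esub> (i (y m) \<oplus>\<^bsub>E\<^esub> i (y' m)) \<oplus>\<^bsub>E\<^esub> s (nabla M m))
          = \<ominus>\<^bsub>E\<^esub> i (y' m) \<oplus>\<^bsub>E\<^esub> (i (y' m) \<oplus>\<^bsub>E\<^esub> (i (nabla N n) \<oplus>\<^bsub>E\<^esub> (s (nabla M m) \<oplus>\<^bsub>E\<^esub> i (y m))))"
        using cl by (simp add: X1.E.D.M.a_ac)
      also have "\<dots> = i (nabla N n) \<oplus>\<^bsub>E\<^esub> (s (nabla M m) \<oplus>\<^bsub>E\<^esub> i (y m))"
        using cl by (simp add: X1.E.D.M.r_neg1)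
      finally show ?thesis
        using nm yin cl
        by (simp add: X1.NE.lin_uminus[OF X1.i_lin] X2.NE.lin_uminus[OF X2.i_lin] X1.i_simps X2.i_in X1.i_in
            X1.E.nabla_add X1.i_nabla[symmetric] s s' X2.E.D.M.a_comm)
    qed
    then have "nabla Q (G z) = U +>\<^bsub>P\<^esub> ?g (nabla N n \<oplus>\<^bsub>N\<^esub> (y m \<oplus>\<^bsub>N\<^esub> y' m)) (nabla M m)"
      using nm yin k baer_nabla_coset[OF g_in[OF nm(2,3)]]
        U.coset_absorb[of "(i (\<ominus>\<^bsub>N\<^esub> y' m), \<ominus>\<^bsub>E'\<^esub> i' (\<ominus>\<^bsub>N\<^esub> y' m))" "?g (nabla N n \<oplus>\<^bsub>N\<^esub> (y m \<oplus>\<^bsub>N\<^esub> y' m)) (nabla M m)"]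
        g_in[of "nabla N n \<oplus>\<^bsub>N\<^esub> (y m \<oplus>\<^bsub>N\<^esub> y' m)" "nabla M m"]
      by (simp add: G Q_def)
    then show "G (nabla ?S z) = nabla Q (G z)" using nm yin by (simp add: G Y)
    fix z' assume "z' \<in> carrier ?S"
    then obtain n' m' where nm': "z' = (n', m')" "n' \<in> carrier N" "m' \<in> carrier M" by auto
    have "?g n m \<oplus>\<^bsub>P\<^esub> ?g n' m' = ?g (n \<oplus>\<^bsub>N\<^esub> n') (m \<oplus>\<^bsub>M\<^esub> m')"
      using nm nm' by (simp add: X1.i_simps s s' X1.i_in X1.E.D.M.a_ac)
    then show "G (z \<oplus>\<^bsub>?S\<^esub> z') = G z \<oplus>\<^bsub>Q\<^esub> G z'"
      using nm nm' U.a_rcos_sum[OF g_in[OF nm(2,3)] g_in[OF nm'(2,3)]] by (simp add: G Q_def)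
  next
    show "inj_on G (carrier ?S)"
    proof (rule inj_onI)
      fix z z' assume z: "z \<in> carrier ?S" "z' \<in> carrier ?S" and eqG: "G z = G z'"
      obtain n m where nm: "z = (n, m)" "n \<in> carrier N" "m \<in> carrier M" using z(1) by auto
      obtain n' m' where nm': "z' = (n', m')" "n' \<in> carrier N" "m' \<in> carrier M" using z(2) by auto
      have "?g n m \<in> U +>\<^bsub>P\<^esub> ?g n' m'"
        using eqG nm nm' U.a_rcos_self[OF g_in[OF nm(2,3)]] by (simp add: G)
      then obtain k where k: "k \<in> carrier N" "?g n m = (i k, \<ominus>\<^bsub>E'\<^esub> i' k) \<oplus>\<^bsub>P\<^esub> ?g n' m'"
        by (auto simp: a_r_coset_def')
      then have k2: "i n \<oplus>\<^bsub>E\<^esub> s m = i k \<oplus>\<^bsub>E\<^esub> (i n' \<oplus>\<^bsub>E\<^esub> s m')" "s' m = \<ominus>\<^bsub>E'\<^esub> i' k \<oplus>\<^bsub>E'\<^esub> s' m'" by simp_all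
      have "p' (s' m) = p' (\<ominus>\<^bsub>E'\<^esub> i' k \<oplus>\<^bsub>E'\<^esub> s' m')" using k2(2) by simp
      then have m: "m = m'"
        using k(1) nm nm' by (simp add: X2.p_simps X2.i_in s' X2.EM.lin_uminus[OF X2.p_lin])
      have "i' k = \<zero>\<^bsub>E'\<^esub>"
        using k2(2) k(1) nm nm' unfolding m
        by (metis X2.E.D.M.add.r_cancel_one' X2.E.D.M.a_inv_closed X2.i_in s'(4) X2.E.D.M.minus_minus X2.E.D.M.uminus_zero)
      then have "k = \<zero>\<^bsub>N\<^esub>"
        using X2.i_inj[OF k(1) X1.N.D.M.zero_closed] X2.NE.lin_zero[OF X2.i_lin] by simp
      then have "i n \<oplus>\<^bsub>E\<^esub> s m = i n' \<oplus>\<^bsub>E\<^esub> s m'"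
        using k2(1) nm nm' by (simp add: X1.NE.lin_zero[OF X1.i_lin] X1.i_in s)
      then show "z = z'" using X1.decomposition_unique[OF y split, of n n' m m'] nm nm' by simp
    qed
    show "G ` carrier ?S = carrier Q"
    proof (intro equalityI subsetI)
      fix C assume "C \<in> G ` carrier ?S"
      then obtain n m where nm: "C = G (n, m)" "n \<in> carrier N" "m \<in> carrier M" by auto
      show "C \<in> carrier Q"
        using nm g_in[OF nm(2,3)] U.a_subset by (simp add: G Q_def U.a_rcosetsI)
    next
      fix C assume "C \<in> carrier Q"
      then have "C \<in> a_rcosets\<^bsub>P\<^esub> U" by (simp add: Q_def)
      then obtain z where z: "z \<in> carrier P" "C = U +>\<^bsub>P\<^esub> z" by (rule U.a_rcosets_cases)
      obtain x x' where x: "z = (x, x')" "x \<in> carrier E" "x' \<in> carrier E'" "p x = p' x'" using z(1) by auto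
      obtain n where n: "n \<in> carrier N" "x = i n \<oplus>\<^bsub>E\<^esub> s (p x)" using X1.decomposition[OF y split x(2)] by blast
      obtain n' where n': "n' \<in> carrier N" "x' = i' n' \<oplus>\<^bsub>E'\<^esub> s' (p x)"
        using X2.decomposition[OF y' split' x(3)] x(4) by auto
      have px: "p x \<in> carrier M" using X1.p_in[OF x(2)] .
      have cl: "i n \<in> carrier E" "i n' \<in> carrier E" "s (p x) \<in> carrier E" "i' n' \<in> carrier E'"
        using n n' px by (auto simp: X1.i_in X2.i_in s)
      have "\<ominus>\<^bsub>E\<^esub> i n' \<oplus>\<^bsub>E\<^esub> (i n \<oplus>\<^bsub>E\<^esub> i n' \<oplus>\<^bsub>E\<^esub> s (p x)) = \<ominus>\<^bsub>E\<^esub> i n' \<oplus>\<^bsub>E\<^esub> (i n' \<oplus>\<^bsub>E\<^esub> (i n \<oplus>\<^bsub>E\<^esub> s (p x)))"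
        using cl by (simp add: X1.E.D.M.a_ac)
      also have "\<dots> = i n \<oplus>\<^bsub>E\<^esub> s (p x)" using cl by (simp add: X1.E.D.M.r_neg1)
      finally have "(i n \<oplus>\<^bsub>E\<^esub> s (p x), i' n' \<oplus>\<^bsub>E'\<^esub> s' (p x)) =
          (i (\<ominus>\<^bsub>N\<^esub> n'), \<ominus>\<^bsub>E'\<^esub> i' (\<ominus>\<^bsub>N\<^esub> n')) \<oplus>\<^bsub>P\<^esub> ?g (n \<oplus>\<^bsub>N\<^esub> n') (p x)"
        using n n' cl by (simp add: X1.NE.lin_uminus[OF X1.i_lin] X2.NE.lin_uminus[OF X2.i_lin] X1.i_simps)
      then have "z = (i (\<ominus>\<^bsub>N\<^esub> n'), \<ominus>\<^bsub>E'\<^esub> i' (\<ominus>\<^bsub>N\<^esub> n')) \<oplus>\<^bsub>P\<^esub> ?g (n \<oplus>\<^bsub>N\<^esub> n') (p x)"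
        using n(2) n'(2) x(1) by metis
      then have "C = G (n \<oplus>\<^bsub>N\<^esub> n', p x)"
        using n n' px z(2) g_in[of "n \<oplus>\<^bsub>N\<^esub> n'" "p x"]
        by (simp only: G X1.N.D.M.a_closed) (intro U.coset_absorb, auto)
      then show "C \<in> G ` carrier ?S" using n n' px by (intro image_eqI[of _ _ "(n \<oplus>\<^bsub>N\<^esub> n', p x)"]) auto
    qed
  qed (auto simp: G_def)
  have pick: "p (fst (SOME w. w \<in> U +>\<^bsub>P\<^esub> ?g n m)) = m" if nm: "n \<in> carrier N" "m \<in> carrier M" for n m
  proof -
    have "(SOME w. w \<in> U +>\<^bsub>P\<^esub> ?g n m) \<in> U +>\<^bsub>P\<^esub> ?g n m"
      using U.a_rcos_self[OF g_in[OF nm]] by (rule someI)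
    then obtain k where "k \<in> carrier N" "(SOME w. w \<in> U +>\<^bsub>P\<^esub> ?g n m) = (i k, \<ominus>\<^bsub>E'\<^esub> i' k) \<oplus>\<^bsub>P\<^esub> ?g n m"
      unfolding a_r_coset_def' by blast
    then show ?thesis using nm by (simp add: X1.p_simps X1.i_in s)
  qed
  have zero: "(i n, \<zero>\<^bsub>E'\<^esub>) = ?g n \<zero>\<^bsub>M\<^esub>" if "n \<in> carrier N" for n
    using that by (simp add: X1.i_in X1.ME.lin_zero[OF s(1)] X2.ME.lin_zero[OF s'(1)])
  have Q_in: "(\<lambda>x\<in>carrier N. U +>\<^bsub>P\<^esub> (i x, \<zero>\<^bsub>E'\<^esub>)) n = G (n, \<zero>\<^bsub>M\<^esub>)" if "n \<in> carrier N" for n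
  proof -
    have "G (n, \<zero>\<^bsub>M\<^esub>) = U +>\<^bsub>P\<^esub> ?g n \<zero>\<^bsub>M\<^esub>" by (rule G[OF that X1.M.D.M.zero_closed])
    also have "?g n \<zero>\<^bsub>M\<^esub> = (i n, \<zero>\<^bsub>E'\<^esub>)" by (rule zero[OF that, symmetric])
    finally show ?thesis unfolding restrict_apply'[OF that] by (rule sym)
  qed
  show "ext_equiv (subfield_ring A) M N (split_ext M N (y \<oplus>\<^bsub>X1.Hom\<^esub> y')) (baer_sum N (E, i, p) (E', i', p'))"
    unfolding split_ext_def baer_sum_def prod.case Let_def Q_def[symmetric]
  proof (rule ext_equivI[OF iso])
    fix n assume n: "n \<in> carrier N"
    then show "G ((\<lambda>n\<in>carrier N. (n, \<zero>\<^bsub>M\<^esub>)) n) = (\<lambda>x\<in>carrier N. U +>\<^bsub>P\<^esub> (i x, \<zero>\<^bsub>E'\<^esub>)) n"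
      by (subst Q_in[OF n]) (simp only: restrict_apply'[OF n])
  next
    fix z assume z: "z \<in> carrier ?S"
    then obtain n m where nm: "z = (n, m)" "n \<in> carrier N" "m \<in> carrier M" by auto
    have "G z \<in> carrier Q" using lin_mapsD(1)[OF dmod_isoD(2)[OF iso] z] .
    then show "(\<lambda>C\<in>carrier Q. p (fst (SOME z. z \<in> C))) (G z) = (\<lambda>z\<in>carrier N \<times> carrier M. snd z) z"
      using nm pick[OF nm(2,3)] by (simp add: G)
  qed
  have Gz: "G \<zero>\<^bsub>?S\<^esub> = \<zero>\<^bsub>Q\<^esub>"
  proof -
    have "G (\<zero>\<^bsub>N\<^esub>, \<zero>\<^bsub>M\<^esub>) = U +>\<^bsub>P\<^esub> \<zero>\<^bsub>P\<^esub>"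
      by (simp add: G X1.ME.lin_zero[OF s(1)] X2.ME.lin_zero[OF s'(1)] X1.NE.lin_zero[OF X1.i_lin])
    also have "\<dots> = U"
      by (rule U.a_rcos_const[OF additive_subgroup.zero_closed[OF U.is_additive_subgroup]])
    finally show ?thesis by (simp add: Q_def)
  qed
  have "diff_module (subfield_ring A) d Q"
    by (rule diff_module_transport[OF X1.split_dmod_diff_module[OF X1.Hom_add_closed[OF y y']] iso Gz]) simp
  moreover have "(\<lambda>x\<in>carrier N. U +>\<^bsub>P\<^esub> (i x, \<zero>\<^bsub>E'\<^esub>)) n \<in> carrier Q" if "n \<in> carrier N" for n
    unfolding Q_in[OF that] by (rule lin_mapsD(1)[OF dmod_isoD(2)[OF iso]]) (use that in simp)
  ultimately show "extension_data (subfield_ring A) d N (baer_sum N (E, i, p) (E', i', p'))"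
    unfolding extension_data_def baer_sum_def prod.case Let_def Q_def[symmetric] by blast
qed

end

section \<open>Changing the type of the middle term\<close>

text \<open>
  The structure of \<open>E\<close> carried along an injection \<open>\<iota>\<close> of its carrier into another type.
\<close>

definition image_dmod :: "('e \<Rightarrow> 'f) \<Rightarrow> ('a, 'e) dmod \<Rightarrow> ('a, 'f) dmod" where
  "image_dmod \<iota> E = (let r = inv_into (carrier E) \<iota> in
     \<lparr>carrier = \<iota> ` carrier E, monoid.mult = undefined, monoid.one = undefined,
      ring.zero = \<iota> \<zero>\<^bsub>E\<^esub>,
      ring.add = (\<lambda>x y. \<iota> (r x \<oplus>\<^bsub>E\<^esub> r y)),
      module.smult = (\<lambda>a x. \<iota> (a \<odot>\<^bsub>E\<^esub> r x)),
      nabla = (\<lambda>x. \<iota> (nabla E (r x)))\<rparr>)"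

lemma image_dmod_iso:
  assumes E: "diff_module R d E" and \<iota>: "inj_on \<iota> (carrier E)"
    and d: "\<And>a. a \<in> carrier R \<Longrightarrow> d a \<in> carrier R"
  shows "(\<lambda>x\<in>carrier E. \<iota> x) \<in> dmod_iso R E (image_dmod \<iota> E)" "diff_module R d (image_dmod \<iota> E)"
proof -
  interpret E: diff_module R d E by fact
  show iso: "(\<lambda>x\<in>carrier E. \<iota> x) \<in> dmod_iso R E (image_dmod \<iota> E)"
    using \<iota>
    by (intro dmod_isoI dmod_homI lin_mapsI) (auto simp: image_dmod_def Let_def E.nabla_closed inj_on_def)
  show "diff_module R d (image_dmod \<iota> E)"
    by (rule diff_module_transport[OF E iso _ d]) (auto simp: image_dmod_def Let_def)
qed

lemma (in dmod_extension) transported_extension: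
  assumes g: "g \<in> dmod_iso (subfield_ring A) E E'" and E': "diff_module (subfield_ring A) d E'"
  shows "\<exists>i' p'. (E', i', p') \<in> extensions (subfield_ring A) d M N \<and>
    ext_equiv (subfield_ring A) M N (E, i, p) (E', i', p')"
proof -
  interpret E': diff_vector_space A d E'
    by (intro diff_vector_space.intro M.diff_subfield_axioms E')
  note gD = dmod_isoD[OF g]
  let ?h = "\<lambda>y\<in>carrier E'. inv_into (carrier E) g y"
  have h: "?h \<in> dmod_iso (subfield_ring A) E' E" by (rule dmod_iso_inverse[OF E.D.diff_module_axioms g])
  note hD = dmod_isoD[OF h]
  have g_in: "g x \<in> carrier E'" if "x \<in> carrier E" for x using lin_mapsD(1)[OF gD(2) that] .
  have h_in: "?h x \<in> carrier E" if "x \<in> carrier E'" for x using lin_mapsD(1)[OF hD(2) that] .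
  have hg: "?h (g x) = x" if "x \<in> carrier E" for x
    using that gD(3) g_in[OF that] by simp
  have gh: "g (?h x) = x" if "x \<in> carrier E'" for x
    using that gD(4) by (simp add: f_inv_into_f)
  let ?i = "\<lambda>n\<in>carrier N. g (i n)" and ?p = "\<lambda>x\<in>carrier E'. p (?h x)"
  have "(E', ?i, ?p) \<in> extensions (subfield_ring A) d M N"
  proof (rule extensionsI[OF E'])
    show "?i \<in> dmod_hom (subfield_ring A) N E'"
    proof (rule dmod_homI)
      show "?i \<in> lin_maps (subfield_ring A) N E'" by (rule lin_maps_comp[OF i_lin gD(2)]) auto
    qed (simp add: i_nabla i_in dmod_homD(2)[OF gD(1)])
    show "?p \<in> dmod_hom (subfield_ring A) E' M"
    proof (rule dmod_homI)
      show "?p \<in> lin_maps (subfield_ring A) E' M" by (rule lin_maps_comp[OF hD(2) p_lin]) auto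
      show "?p (nabla E' x) = nabla M (?p x)" if "x \<in> carrier E'" for x
        using p_nabla[OF h_in[OF that]] dmod_homD(2)[OF hD(1) that] that by simp
    qed
    show "inj_on ?i (carrier N)"
      using gD(3) i_in i_inj by (auto simp: inj_on_def)
    show "?i ` carrier N = {x \<in> carrier E'. ?p x = \<zero>\<^bsub>M\<^esub>}"
    proof (intro equalityI subsetI)
      fix x assume "x \<in> ?i ` carrier N"
      then obtain n where n: "n \<in> carrier N" "x = g (i n)" by auto
      then show "x \<in> {x \<in> carrier E'. ?p x = \<zero>\<^bsub>M\<^esub>}" using hg[OF i_in[OF n(1)]] g_in[OF i_in[OF n(1)]] by simp
    next
      fix x assume "x \<in> {x \<in> carrier E'. ?p x = \<zero>\<^bsub>M\<^esub>}"
      then have x: "x \<in> carrier E'" "p (?h x) = \<zero>\<^bsub>M\<^esub>" by auto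
      then obtain n where n: "n \<in> carrier N" "?h x = i n" using kernel_p[OF h_in] by blast
      then have "x = ?i n" using gh[OF x(1)] by simp
      then show "x \<in> ?i ` carrier N" using n(1) by (rule image_eqI)
    qed
    show "?p ` carrier E' = carrier M"
    proof (intro equalityI subsetI)
      fix m assume "m \<in> carrier M"
      then obtain x where x: "x \<in> carrier E" "p x = m" using p_surj by blast
      then show "m \<in> ?p ` carrier E'" using hg[OF x(1)] g_in[OF x(1)] by (intro image_eqI[of _ _ "g x"]) auto
    next
      fix m assume "m \<in> ?p ` carrier E'"
      then obtain x where x: "x \<in> carrier E'" "m = p (?h x)" by auto
      show "m \<in> carrier M" unfolding x(2) by (rule p_in[OF h_in[OF x(1)]])
    qed
  qed
  moreover have "ext_equiv (subfield_ring A) M N (E, i, p) (E', ?i, ?p)"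
    by (rule ext_equivI[OF g]) (use hg g_in in auto)
  ultimately show ?thesis by blast
qed

text \<open>
  The multiples of a nonzero vector by different scalars are different.
\<close>

lemma (in subfield_module) infinite_carrier:
  assumes "infinite A" "x \<in> carrier M" "x \<noteq> \<zero>"
  shows "infinite (carrier M)"
proof
  assume "finite (carrier M)"
  then have "finite ((\<lambda>a. a \<odot> x) ` A)" by (rule finite_subset[rotated]) (use assms in auto)
  moreover have "inj_on (\<lambda>a. a \<odot> x) A"
  proof (rule inj_onI, rule ccontr)
    fix a b assume ab: "a \<in> A" "b \<in> A" "a \<odot> x = b \<odot> x" "a \<noteq> b"
    have "(a - b) \<odot> x = a \<odot> x \<oplus> (- b) \<odot> x" using ab assms smult_add_left[of a "- b" x] by simp
    then have 0: "(a - b) \<odot> x = \<zero>" using ab assms by (simp add: smult_uminus V.M.r_neg)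
    have "x = (inverse (a - b) * (a - b)) \<odot> x" using ab assms by simp
    also have "\<dots> = inverse (a - b) \<odot> ((a - b) \<odot> x)" using ab assms by (intro smult_mult) auto
    also have "\<dots> = \<zero>" unfolding 0 using ab by simp
    finally show False using assms(3) by simp
  qed
  ultimately show False using assms(1) finite_imageD by blast
qed

section \<open>The extension group as first cohomology\<close>

definition cocycle_class ::
    "'a ring \<Rightarrow> ('a \<Rightarrow> 'a) \<Rightarrow> ('a, 'm) dmod \<Rightarrow> ('a, 'n) dmod \<Rightarrow> ('m \<Rightarrow> 'n) \<Rightarrow> ('a, 'n, 'e, 'm) extn set" where
  "cocycle_class R d M N y = {e \<in> extensions R d M N. ext_equiv R M N (split_ext M N y) e}"

locale ext_setting = diff_vector_spaces A d M N
  for A :: "'a::field set" and d and M :: "('a, 'b) dmod" and N :: "('a, 'b) dmod" +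
  fixes I :: "'i set" and e
  assumes basis: "M.coord_basis I e" and inf: "infinite A"
begin

abbreviation "R \<equiv> subfield_ring A"
abbreviation cls :: "('b \<Rightarrow> 'b) \<Rightarrow> ('a, 'b, 'b, 'b) extn set" where "cls \<equiv> cocycle_class R d M N"
abbreviation "lin \<equiv> lin_maps R M N"

lemmas split_data = extension_data_extension[OF split_ext_extension]

lemma cocycle_exists:
  assumes "x \<in> extensions R d M N"
  shows "\<exists>y\<in>lin. ext_equiv R M N (split_ext M N y) x"
proof -
  obtain E i p where x: "x = (E, i, p)" by (cases x) auto
  interpret x: dmod_extension A d M N E i p using assms unfolding x by (rule dmod_extensionI)
  show ?thesis using x.splitting_exists[OF basis] x.split_ext_equiv unfolding x by blast
qed

text \<open>
  The split model lives on pairs, the class on the type \<open>'b\<close>, so \<open>N \<times> M\<close> has to be embedded into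
  \<open>'b\<close>.  An infinite type is in bijection with its square; on a finite type both modules are zero.
\<close>

lemma cocycle_class_nonempty:
  assumes y: "y \<in> lin"
  shows "\<exists>x. x \<in> cls y"
proof -
  have "\<exists>\<iota> :: 'b \<times> 'b \<Rightarrow> 'b. inj_on \<iota> (carrier N \<times> carrier M)"
  proof (cases "infinite (UNIV :: 'b set)")
    case True
    then have "|(UNIV :: 'b set) \<times> (UNIV :: 'b set)| =o |UNIV :: 'b set|" by (rule card_of_Times_same_infinite)
    from card_of_ordIso[THEN iffD2, OF this]
    obtain f :: "'b \<times> 'b \<Rightarrow> 'b" where "bij_betw f (UNIV \<times> UNIV) UNIV" by (rule exE)
    then have "inj_on f UNIV" by (simp add: bij_betw_def)
    then have "inj_on f (carrier N \<times> carrier M)" by (rule inj_on_subset) simp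
    then show ?thesis by (intro exI[of _ f])
  next
    case False
    then have "finite (carrier N)" "finite (carrier M)" using finite_subset[OF subset_UNIV] by auto
    then have "carrier N \<subseteq> {\<zero>\<^bsub>N\<^esub>}" "carrier M \<subseteq> {\<zero>\<^bsub>M\<^esub>}"
      using N.infinite_carrier[OF inf] M.infinite_carrier[OF inf] by blast+
    then show ?thesis by (intro exI[of _ fst]) (auto simp: inj_on_def)
  qed
  then obtain \<iota> :: "'b \<times> 'b \<Rightarrow> 'b" where \<iota>: "inj_on \<iota> (carrier (split_dmod M N y))" by auto
  note iso = image_dmod_iso[OF split_dmod_diff_module[OF y] \<iota>]
  interpret S: dmod_extension A d M N "split_dmod M N y" "\<lambda>n\<in>carrier N. (n, \<zero>\<^bsub>M\<^esub>)" "\<lambda>z\<in>carrier N \<times> carrier M. snd z"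
    using split_ext_extension[OF y] unfolding split_ext_def by (rule dmod_extensionI)
  from S.transported_extension[OF iso] show ?thesis
    unfolding cocycle_class_def split_ext_def by auto
qed

lemma cocycle_class_eqI:
  assumes y: "y \<in> lin" and y': "y' \<in> lin" and z: "z \<in> lin" "y = y' \<oplus>\<^bsub>Hom\<^esub> nabla Hom z"
  shows "cocycle_class R d M N y = (cocycle_class R d M N y' :: ('a, 'b, 'e, 'b) extn set)"
proof -
  have eq: "ext_equiv R M N (split_ext M N y) (split_ext M N y')"
    using split_ext_equiv_iff[OF y y'] z by blast
  note eq' = extension_equiv_sym[OF split_data[OF y] eq]
  show ?thesis unfolding cocycle_class_def
    using extension_equiv_trans[OF split_data[OF y] eq] extension_equiv_trans[OF split_data[OF y'] eq'] by blast
qed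

lemma cocycle_class_eqD:
  assumes y: "y \<in> lin" and y': "y' \<in> lin" and eq: "cls y = cls y'"
  shows "\<exists>z\<in>lin. y = y' \<oplus>\<^bsub>Hom\<^esub> nabla Hom z"
proof -
  obtain x where x: "x \<in> cls y" "x \<in> cls y'" using cocycle_class_nonempty[OF y] eq by blast
  then have "ext_equiv R M N x (split_ext M N y')"
    using extension_equiv_sym[OF split_data[OF y']] by (simp add: cocycle_class_def)
  then have "ext_equiv R M N (split_ext M N y) (split_ext M N y')"
    using extension_equiv_trans[OF split_data[OF y]] x(1) by (simp add: cocycle_class_def) blast
  then show ?thesis using split_ext_equiv_iff[OF y y'] by blast
qed

lemma equivalent_in_class:
  assumes y: "y \<in> lin" and x: "x \<in> extensions R d M N" and eq: "ext_equiv R M N (split_ext M N y) x"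
  shows "{w \<in> extensions R d M N. ext_equiv R M N x w} = cocycle_class R d M N y"
  unfolding cocycle_class_def
  using extension_equiv_trans[OF split_data[OF y] eq]
    extension_equiv_trans[OF extension_data_extension[OF x] extension_equiv_sym[OF split_data[OF y] eq]] by blast

text \<open>
  Elements of the extension group are the classes of cocycles: by \<open>splitting_exists\<close> every extension
  has a cocycle, and by \<open>cocycle_class_nonempty\<close> every cocycle has an extension.
\<close>

lemma carrier_Ext: "carrier (Ext R d M N) = cls ` lin"
proof -
  let ?rel = "{(e, e'). e \<in> extensions R d M N \<and> e' \<in> extensions R d M N \<and>
    ext_equiv R M N (e :: ('a, 'b, 'b, 'b) extn) (e' :: ('a, 'b, 'b, 'b) extn)}"
  have img: "?rel `` {x} = {w \<in> extensions R d M N. ext_equiv R M N x w}" if "x \<in> extensions R d M N" for x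
    using that by auto
  show ?thesis
  proof (intro equalityI subsetI)
    fix C assume "C \<in> carrier (Ext R d M N)"
    then have "C \<in> extensions R d M N // ?rel" by (simp only: Ext_def partial_object.select_convs)
    then have "\<exists>x\<in>extensions R d M N. C = ?rel `` {x}" by (rule quotientE) (rule bexI)
    then obtain x where x: "x \<in> extensions R d M N" "C = ?rel `` {x}" by (rule bexE)
    obtain y where y: "y \<in> lin" "ext_equiv R M N (split_ext M N y) x" using cocycle_exists[OF x(1)] by blast
    have "C = cls y" unfolding x(2) img[OF x(1)] by (rule equivalent_in_class[OF y(1) x(1) y(2)])
    then show "C \<in> cls ` lin" using y(1) by blast
  next
    fix C assume "C \<in> cls ` lin"
    then obtain y where y: "y \<in> lin" "C = cls y" by blast
    obtain x where "x \<in> cls y" using cocycle_class_nonempty[OF y(1)] by blast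
    then have x: "x \<in> extensions R d M N" "ext_equiv R M N (split_ext M N y) x" by (auto simp: cocycle_class_def)
    have "C = ?rel `` {x}" unfolding y(2) img[OF x(1)] by (rule equivalent_in_class[OF y(1) x, symmetric])
    then show "C \<in> carrier (Ext R d M N)"
      using quotientI[OF x(1), of ?rel] by (simp only: Ext_def partial_object.select_convs)
  qed
qed

lemma mult_Ext:
  assumes y: "y \<in> lin" and y': "y' \<in> lin"
  shows "cls y \<otimes>\<^bsub>Ext R d M N\<^esub> cls y' = cls (y \<oplus>\<^bsub>Hom\<^esub> y')"
proof -
  let ?S = "split_ext M N (y \<oplus>\<^bsub>Hom\<^esub> y')"
  have baer: "ext_equiv R M N ?S (baer_sum N x w)" "extension_data R d N (baer_sum N x w)"
    if x: "x \<in> cls y" and w: "w \<in> cls y'" for x w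
  proof -
    obtain E i p where xe: "x = (E, i, p)" by (cases x) auto
    obtain E' i' p' where we: "w = (E', i', p')" by (cases w) auto
    have x': "(E, i, p) \<in> extensions R d M N" "ext_equiv R M N (split_ext M N y) (E, i, p)"
      and w': "(E', i', p') \<in> extensions R d M N" "ext_equiv R M N (split_ext M N y') (E', i', p')"
      using x w by (simp_all add: cocycle_class_def xe we)
    interpret dmod_extension_pair A d M N E i p E' i' p'
      by (intro dmod_extension_pair.intro dmod_extensionI x' w')
    show "ext_equiv R M N ?S (baer_sum N x w)" "extension_data R d N (baer_sum N x w)"
      unfolding xe we using baer_sum_cocycle[OF y y' x'(2) w'(2)] by auto
  qed
  have sum: "y \<oplus>\<^bsub>Hom\<^esub> y' \<in> lin" by (rule Hom_add_closed[OF y y'])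
  show ?thesis
  proof (intro equalityI subsetI)
    fix v assume "v \<in> cls y \<otimes>\<^bsub>Ext R d M N\<^esub> cls y'"
    then obtain x w where v: "v \<in> extensions R d M N" "x \<in> cls y" "w \<in> cls y'" "ext_equiv R M N (baer_sum N x w) v"
      by (auto simp: Ext_def)
    from extension_equiv_trans[OF split_data[OF sum] baer(1)[OF v(2,3)] v(4)]
    show "v \<in> cls (y \<oplus>\<^bsub>Hom\<^esub> y')" using v(1) by (simp add: cocycle_class_def)
  next
    fix v assume v: "v \<in> cls (y \<oplus>\<^bsub>Hom\<^esub> y')"
    obtain x w where xw: "x \<in> cls y" "w \<in> cls y'" using cocycle_class_nonempty[OF y] cocycle_class_nonempty[OF y'] by blast
    have v': "v \<in> extensions R d M N" "ext_equiv R M N ?S v" using v by (simp_all add: cocycle_class_def)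
    have "ext_equiv R M N (baer_sum N x w) v"
      by (rule extension_equiv_trans[OF baer(2)[OF xw] extension_equiv_sym[OF split_data[OF sum] baer(1)[OF xw]] v'(2)])
    then have "\<exists>x\<in>cls y. \<exists>w\<in>cls y'. ext_equiv R M N (baer_sum N x w) v" using xw by blast
    then show "v \<in> cls y \<otimes>\<^bsub>Ext R d M N\<^esub> cls y'" using v'(1) by (simp add: Ext_def)
  qed
qed

end

section \<open>Scalar extension of extensions\<close>

context dmod_extension
begin

text \<open>
  A linear splitting \<open>E = i(N) \<oplus> s(M)\<close> with retraction \<open>q\<close> is expressed by the identities \<open>p i = 0\<close>,
  \<open>p s = 1\<close>, \<open>q i = 1\<close> and \<open>i q + s p = 1\<close>.  These survive scalar extension, which gives exactness, and
  so does the defect of the section \<open>s\<close>, which gives the cocycle.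
\<close>

lemma scalar_extension_of_extension:
  assumes y: "y \<in> lin_maps (subfield_ring A) M N"
    and eq: "ext_equiv (subfield_ring A) M N (split_ext M N y) (E, i, p)"
  defines "e' \<equiv> ext_scalar_ext (subfield_ring A) (subfield_ring UNIV) d M N (E, i, p)"
  shows "e' \<in> extensions (subfield_ring UNIV) d M.ext N.ext"
    and "ext_equiv (subfield_ring UNIV) M.ext N.ext (split_ext M.ext N.ext (ext_map y)) e'"
proof -
  obtain s where split: "splits_with_cocycle (subfield_ring A) M N y (E, i, p) s"
    using splitting_of_equiv[OF y eq] by blast
  note s = s_lin[OF y split] and ps = p_s[OF y split] and snab = s_nabla[OF y split] and s_in = s_in[OF y split]
    and s_simps = s_simps[OF y split]
  note dec = decomposition[OF y split] and uniq = decomposition_unique[OF y split]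
  let ?S = "subfield_ring UNIV"
  interpret XM: diff_vector_space UNIV d M.ext by (rule M.ext_diff_vector_space)
  interpret XN: diff_vector_space UNIV d N.ext by (rule N.ext_diff_vector_space)
  interpret XE: diff_vector_space UNIV d E.ext by (rule E.ext_diff_vector_space)
  interpret XMN: diff_vector_spaces UNIV d M.ext N.ext by unfold_locales
  interpret XME: diff_vector_spaces UNIV d M.ext E.ext by unfold_locales
  interpret XNE: diff_vector_spaces UNIV d N.ext E.ext by unfold_locales
  interpret XEM: diff_vector_spaces UNIV d E.ext M.ext by unfold_locales
  interpret XEN: diff_vector_spaces UNIV d E.ext N.ext by unfold_locales
  have "\<forall>x\<in>carrier E. \<exists>n\<in>carrier N. x = i n \<oplus>\<^bsub>E\<^esub> s (p x)" using dec by blast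
  then obtain q0 where q0: "\<And>x. x \<in> carrier E \<Longrightarrow> q0 x \<in> carrier N \<and> x = i (q0 x) \<oplus>\<^bsub>E\<^esub> s (p x)" by metis
  define q where "q = (\<lambda>x\<in>carrier E. q0 x)"
  have q: "q x \<in> carrier N" "i (q x) \<oplus>\<^bsub>E\<^esub> s (p x) = x" if "x \<in> carrier E" for x
    using q0[OF that] that by (simp_all add: q_def)
  have q_lin: "q \<in> lin_maps (subfield_ring A) E N"
  proof (rule lin_mapsI)
    fix x x' assume x: "x \<in> carrier E" "x' \<in> carrier E"
    note cl = i_in[OF q(1)[OF x(1)]] i_in[OF q(1)[OF x(2)]] s_in[OF p_in[OF x(1)]] s_in[OF p_in[OF x(2)]]
    have "i (q (x \<oplus>\<^bsub>E\<^esub> x')) \<oplus>\<^bsub>E\<^esub> s (p (x \<oplus>\<^bsub>E\<^esub> x')) = x \<oplus>\<^bsub>E\<^esub> x'" using x by (intro q(2)) simp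
    also have "\<dots> = (i (q x) \<oplus>\<^bsub>E\<^esub> s (p x)) \<oplus>\<^bsub>E\<^esub> (i (q x') \<oplus>\<^bsub>E\<^esub> s (p x'))" using x by (simp add: q(2))
    also have "\<dots> = i (q x \<oplus>\<^bsub>N\<^esub> q x') \<oplus>\<^bsub>E\<^esub> s (p (x \<oplus>\<^bsub>E\<^esub> x'))"
      using x cl q(1) by (simp add: i_simps s_simps p_simps p_in E.D.M.a_ac)
    finally show "q (x \<oplus>\<^bsub>E\<^esub> x') = q x \<oplus>\<^bsub>N\<^esub> q x'"
      using uniq[of "q (x \<oplus>\<^bsub>E\<^esub> x')" "q x \<oplus>\<^bsub>N\<^esub> q x'" "p (x \<oplus>\<^bsub>E\<^esub> x')" "p (x \<oplus>\<^bsub>E\<^esub> x')"]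
        x q(1) p_in by simp
  next
    fix a x assume a: "a \<in> carrier (subfield_ring A)" and x: "x \<in> carrier E"
    note cl = i_in[OF q(1)[OF x]] s_in[OF p_in[OF x]]
    have "i (q (a \<odot>\<^bsub>E\<^esub> x)) \<oplus>\<^bsub>E\<^esub> s (p (a \<odot>\<^bsub>E\<^esub> x)) = a \<odot>\<^bsub>E\<^esub> x" using a x by (intro q(2)) simp
    also have "\<dots> = a \<odot>\<^bsub>E\<^esub> (i (q x) \<oplus>\<^bsub>E\<^esub> s (p x))" using x by (simp add: q(2))
    also have "\<dots> = i (a \<odot>\<^bsub>N\<^esub> q x) \<oplus>\<^bsub>E\<^esub> s (p (a \<odot>\<^bsub>E\<^esub> x))"
      using x a cl q(1) by (simp add: i_simps s_simps p_simps p_in E.smult_add_right)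
    finally show "q (a \<odot>\<^bsub>E\<^esub> x) = a \<odot>\<^bsub>N\<^esub> q x"
      using uniq[of "q (a \<odot>\<^bsub>E\<^esub> x)" "a \<odot>\<^bsub>N\<^esub> q x" "p (a \<odot>\<^bsub>E\<^esub> x)" "p (a \<odot>\<^bsub>E\<^esub> x)"]
        x a q(1) p_in by simp
  qed (simp_all add: q, simp add: q_def)
  have q_i: "q (i n) = n" if n: "n \<in> carrier N" for n
  proof -
    have "i (q (i n)) \<oplus>\<^bsub>E\<^esub> s (p (i n)) = i n \<oplus>\<^bsub>E\<^esub> s \<zero>\<^bsub>M\<^esub>"
      using q(2)[OF i_in[OF n]] n i_in[OF n] by (simp add: ME.lin_zero[OF s])
    then show ?thesis using uniq[of "q (i n)" n "p (i n)" "\<zero>\<^bsub>M\<^esub>"] n q(1)[OF i_in[OF n]] by simp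
  qed
  let ?i = "NE.ext_map i" and ?p = "EM.ext_map p" and ?s = "ME.ext_map s" and ?q = "EN.ext_map q"
  note iX = NE.ext_map_lin[OF i_lin] and pX = EM.ext_map_lin[OF p_lin]
    and sX = ME.ext_map_lin[OF s] and qX = EN.ext_map_lin[OF q_lin]
  note pure = NE.ext_map_pure[OF i_lin] EM.ext_map_pure[OF p_lin] ME.ext_map_pure[OF s] EN.ext_map_pure[OF q_lin]
    ext_map_pure[OF y]
  have pi: "?p (?i C) = \<zero>\<^bsub>M.ext\<^esub>" if C: "C \<in> carrier N.ext" for C
  proof -
    have "(\<lambda>C\<in>carrier N.ext. ?p (?i C)) = (\<lambda>C\<in>carrier N.ext. \<zero>\<^bsub>M.ext\<^esub>)"
    proof (rule N.ext_lin_maps_eqI)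
      show "(\<lambda>C\<in>carrier N.ext. ?p (?i C)) \<in> lin_maps ?S N.ext M.ext" by (rule lin_maps_comp[OF iX pX]) auto
      show "(\<lambda>C\<in>carrier N.ext. \<zero>\<^bsub>M.ext\<^esub>) \<in> lin_maps ?S N.ext M.ext" by (rule lin_mapsI) auto
      fix n assume n: "n \<in> carrier N"
      have "M.pure 1 \<zero>\<^bsub>M\<^esub> = \<zero>\<^bsub>M.ext\<^esub>"
        using M.pure_smult[of 0 "\<zero>\<^bsub>M\<^esub>" 1] M.pure_conv[of "\<zero>\<^bsub>M\<^esub>" 0] by simp
      then show "(\<lambda>C\<in>carrier N.ext. ?p (?i C)) (N.pure 1 n) = (\<lambda>C\<in>carrier N.ext. \<zero>\<^bsub>M.ext\<^esub>) (N.pure 1 n)"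
        using n by (simp add: pure i_in)
    qed
    from fun_cong[OF this, of C] show ?thesis using C by simp
  qed
  have ps': "?p (?s C) = C" if C: "C \<in> carrier M.ext" for C
  proof -
    have "(\<lambda>C\<in>carrier M.ext. ?p (?s C)) = (\<lambda>C\<in>carrier M.ext. C)"
    proof (rule M.ext_lin_maps_eqI)
      show "(\<lambda>C\<in>carrier M.ext. ?p (?s C)) \<in> lin_maps ?S M.ext M.ext" by (rule lin_maps_comp[OF sX pX]) auto
      show "(\<lambda>C\<in>carrier M.ext. C) \<in> lin_maps ?S M.ext M.ext" by (rule lin_mapsI) auto
    qed (simp add: pure s_in ps)
    from fun_cong[OF this, of C] show ?thesis using C by simp
  qed
  have qi: "?q (?i C) = C" if C: "C \<in> carrier N.ext" for C
  proof -
    have "(\<lambda>C\<in>carrier N.ext. ?q (?i C)) = (\<lambda>C\<in>carrier N.ext. C)"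
    proof (rule N.ext_lin_maps_eqI)
      show "(\<lambda>C\<in>carrier N.ext. ?q (?i C)) \<in> lin_maps ?S N.ext N.ext" by (rule lin_maps_comp[OF iX qX]) auto
      show "(\<lambda>C\<in>carrier N.ext. C) \<in> lin_maps ?S N.ext N.ext" by (rule lin_mapsI) auto
    qed (simp add: pure i_in q_i)
    from fun_cong[OF this, of C] show ?thesis using C by simp
  qed
  have iqsp: "?i (?q C) \<oplus>\<^bsub>E.ext\<^esub> ?s (?p C) = C" if C: "C \<in> carrier E.ext" for C
  proof -
    have "(\<lambda>C\<in>carrier E.ext. ?i (?q C) \<oplus>\<^bsub>E.ext\<^esub> ?s (?p C)) = (\<lambda>C\<in>carrier E.ext. C)"
    proof (rule E.ext_lin_maps_eqI)
      show "(\<lambda>C\<in>carrier E.ext. ?i (?q C) \<oplus>\<^bsub>E.ext\<^esub> ?s (?p C)) \<in> lin_maps ?S E.ext E.ext"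
        by (rule lin_mapsI)
           (auto simp: XEN.lin_in[OF qX] XNE.lin_in[OF iX] XEM.lin_in[OF pX] XME.lin_in[OF sX]
             lin_mapsD(2,3)[OF qX] lin_mapsD(2,3)[OF iX] lin_mapsD(2,3)[OF pX] lin_mapsD(2,3)[OF sX]
             XE.smult_add_right XE.D.M.a_ac)
      show "(\<lambda>C\<in>carrier E.ext. C) \<in> lin_maps ?S E.ext E.ext" by (rule lin_mapsI) auto
      show "(\<lambda>C\<in>carrier E.ext. ?i (?q C) \<oplus>\<^bsub>E.ext\<^esub> ?s (?p C)) (E.pure 1 x) = (\<lambda>C\<in>carrier E.ext. C) (E.pure 1 x)"
        if x: "x \<in> carrier E" for x
      proof -
        have "?i (?q (E.pure 1 x)) \<oplus>\<^bsub>E.ext\<^esub> ?s (?p (E.pure 1 x))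
            = E.pure 1 (i (q x)) \<oplus>\<^bsub>E.ext\<^esub> E.pure 1 (s (p x))"
          using x by (simp add: pure q(1) p_in)
        also have "\<dots> = E.pure 1 (i (q x) \<oplus>\<^bsub>E\<^esub> s (p x))"
          by (rule E.pure_add[OF i_in[OF q(1)[OF x]] s_in[OF p_in[OF x]], symmetric])
        also have "\<dots> = E.pure 1 x" by (simp only: q(2)[OF x])
        finally show ?thesis using x by (simp only: restrict_apply' E.pure_closed)
      qed
    qed
    from fun_cong[OF this, of C] show ?thesis using C by simp
  qed
  have e': "e' = (E.ext, ?i, ?p)" by (simp add: e'_def ext_scalar_ext_def)
  show ext': "e' \<in> extensions ?S d M.ext N.ext"
    unfolding e'
  proof (rule extensionsI[OF XE.D.diff_module_axioms])
    show "?i \<in> dmod_hom ?S N.ext E.ext"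
      by (rule NE.ext_map_hom) (use extensionsD(2)[OF ext] in simp)
    show "?p \<in> dmod_hom ?S E.ext M.ext"
      by (rule EM.ext_map_hom) (use extensionsD(3)[OF ext] in simp)
    show "inj_on ?i (carrier N.ext)" by (rule inj_onI) (metis qi)
    show "?i ` carrier N.ext = {C \<in> carrier E.ext. ?p C = \<zero>\<^bsub>M.ext\<^esub>}"
    proof (intro equalityI subsetI)
      fix C assume "C \<in> ?i ` carrier N.ext"
      then show "C \<in> {C \<in> carrier E.ext. ?p C = \<zero>\<^bsub>M.ext\<^esub>}" using pi XNE.lin_in[OF iX] by auto
    next
      fix C assume "C \<in> {C \<in> carrier E.ext. ?p C = \<zero>\<^bsub>M.ext\<^esub>}"
      then have C: "C \<in> carrier E.ext" "?p C = \<zero>\<^bsub>M.ext\<^esub>" by auto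
      have "?i (?q C) = C"
        using iqsp[OF C(1)] C XME.lin_zero[OF sX] XNE.lin_in[OF iX XEN.lin_in[OF qX C(1)]] by simp
      then show "C \<in> ?i ` carrier N.ext" using XEN.lin_in[OF qX C(1)] by (metis imageI)
    qed
    show "?p ` carrier E.ext = carrier M.ext"
    proof (intro equalityI subsetI)
      fix C assume C: "C \<in> carrier M.ext"
      then show "C \<in> ?p ` carrier E.ext" using ps'[OF C] XME.lin_in[OF sX C] by (metis imageI)
    qed (use XEM.lin_in[OF pX] in auto)
  qed
  interpret X: dmod_extension UNIV d M.ext N.ext E.ext ?i ?p
    using ext' unfolding e' by (rule XMN.dmod_extensionI)
  have "splits_with_cocycle ?S M.ext N.ext (ext_map y) (E.ext, ?i, ?p) ?s"
    unfolding splits_with_cocycle_def prod.case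
  proof (intro conjI ballI sX ps')
    fix C assume C: "C \<in> carrier M.ext"
    have "nabla XME.Hom ?s = (\<lambda>C\<in>carrier M.ext. ?i (ext_map y C))"
    proof (rule M.ext_lin_maps_eqI[OF XME.Hom_nabla_closed[OF sX]])
      show "(\<lambda>C\<in>carrier M.ext. ?i (ext_map y C)) \<in> lin_maps ?S M.ext E.ext"
        by (rule lin_maps_comp[OF ext_map_lin[OF y] iX]) auto
      fix m assume m: "m \<in> carrier M"
      have ym: "y m \<in> carrier N" using lin_in[OF y m] .
      note cl = s_in[OF M.nabla_in[OF m]] i_in[OF ym]
      have "nabla XME.Hom ?s (M.pure 1 m) = E.pure 1 (nabla E (s m)) \<ominus>\<^bsub>E.ext\<^esub> E.pure 1 (s (nabla M m))"
        using m s_in[OF m] by (simp add: pure M.ext_nabla_pure E.ext_nabla_pure)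
      also have "E.pure 1 (nabla E (s m)) = E.pure 1 (s (nabla M m)) \<oplus>\<^bsub>E.ext\<^esub> E.pure 1 (i (y m))"
        using snab[OF m] cl by (simp add: E.pure_add)
      also have "\<dots> \<ominus>\<^bsub>E.ext\<^esub> E.pure 1 (s (nabla M m)) = E.pure 1 (i (y m))"
        using cl by (simp add: XE.D.M.add_minus_assoc XE.D.M.add_minus_self)
      finally show "nabla XME.Hom ?s (M.pure 1 m) = (\<lambda>C\<in>carrier M.ext. ?i (ext_map y C)) (M.pure 1 m)"
        using m ym by (simp add: pure)
    qed
    from fun_cong[OF this, of C]
    have "nabla E.ext (?s C) \<ominus>\<^bsub>E.ext\<^esub> ?s (nabla M.ext C) = ?i (ext_map y C)" using C by simp
    then show "nabla E.ext (?s C) = ?s (nabla M.ext C) \<oplus>\<^bsub>E.ext\<^esub> ?i (ext_map y C)"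
      using XE.D.M.add_minus_self[of "?s (nabla M.ext C)" "nabla E.ext (?s C)"] XME.lin_in[OF sX] C by simp
  qed
  from X.split_ext_equiv[OF ext_map_lin[OF y] this]
  show "ext_equiv ?S M.ext N.ext (split_ext M.ext N.ext (ext_map y)) e'" unfolding e' .
qed

end

section \<open>Convergent Laurent series\<close>

context complete_nonarch_abs
begin

lemma v_0 [simp]: "v 0 = 0"
  by (simp add: eq_0_iff)

lemma v_1 [simp]: "v 1 = 1"
  using mult[of 1 1] eq_0_iff[of 1] by simp

lemma v_uminus [simp]: "v (- x) = v x"
proof -
  have "v (- 1) * v (- 1) = 1" using mult[of "- 1" "- 1"] by simp
  then have "v (- 1) = 1" using nonneg[of "- 1"] by (metis abs_of_nonneg abs_square_eq_1 power2_eq_square)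
  then show ?thesis using mult[of "- 1" x] by simp
qed

lemma v_sum_le:
  assumes "\<And>i. i \<in> I \<Longrightarrow> v (f i) \<le> B" "0 \<le> B"
  shows "v (sum f I) \<le> B"
  using assms
proof (induction I rule: infinite_finite_induct)
  case (insert i I)
  then have "v (f i) \<le> B" "v (sum f I) \<le> B" by auto
  then show ?case using ultrametric[of "f i" "sum f I"] insert.hyps by simp
qed simp_all

lemma v_of_nat_le: "v (of_nat n) \<le> 1"
proof (induction n)
  case (Suc n)
  then show ?case using ultrametric[of 1 "of_nat n"] by simp
qed simp

lemma v_of_int_le: "v (of_int n) \<le> 1"
  by (cases n rule: int_cases2) (simp_all add: v_of_nat_le)

text \<open>
  Geometric growth of the coefficients with a uniform rate and a uniform bound on the pole order, a
  form of convergence that can be propagated through products and inverses by estimates on single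
  coefficients.
\<close>

definition growth :: "real \<Rightarrow> int \<Rightarrow> 'k fls \<Rightarrow> bool" where
  "growth C N f \<longleftrightarrow> 1 \<le> C \<and> (\<forall>n. v (f $$ n) \<le> C ^ nat (n + N)) \<and> (\<forall>n. n < - N \<longrightarrow> f $$ n = 0)"

definition convergent_series :: "'k fls set" where
  "convergent_series = {f. conv_radius (\<lambda>n. v (f $$ int n)) > 0}"

lemma growth_mono:
  assumes "growth C N f" "C \<le> C'" "N \<le> N'"
  shows "growth C' N' f"
  unfolding growth_def
proof (intro conjI allI impI)
  have C: "1 \<le> C" using assms(1) by (simp add: growth_def)
  then show "1 \<le> C'" using assms by simp
  fix n
  have "v (f $$ n) \<le> C ^ nat (n + N)" using assms(1) by (simp add: growth_def)
  also have "\<dots> \<le> C ^ nat (n + N')" using C assms(3) by (intro power_increasing) auto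
  also have "\<dots> \<le> C' ^ nat (n + N')" using C assms(2) by (intro power_mono) auto
  finally show "v (f $$ n) \<le> C' ^ nat (n + N')" .
  show "f $$ n = 0" if "n < - N'" using that assms by (simp add: growth_def)
qed

lemma growth_common:
  assumes "growth C N f" "growth C' N' g"
  shows "growth (max C C') (max N N') f" "growth (max C C') (max N N') g"
  by (rule growth_mono[OF assms(1)] growth_mono[OF assms(2)]; simp)+

lemma growth_imp_convergent:
  assumes "growth C N f"
  shows "f \<in> convergent_series"
proof -
  define K where "K = nat \<bar>N\<bar>"
  have C: "1 \<le> C" using assms by (simp add: growth_def)
  have bound: "v (f $$ int n) \<le> C ^ K * C ^ n" for n
  proof -
    have "v (f $$ int n) \<le> C ^ nat (int n + N)" using assms by (simp add: growth_def)
    also have "\<dots> \<le> C ^ (K + n)" using C by (intro power_increasing) (auto simp: K_def)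
    finally show ?thesis by (simp add: power_add)
  qed
  define z where "z = 1 / (2 * C)"
  have "summable (\<lambda>n. v (f $$ int n) * z ^ n)"
  proof (rule summable_comparison_test')
    show "summable (\<lambda>n. C ^ K * (1 / 2) ^ n)" by (intro summable_mult summable_geometric) simp
    fix n :: nat
    have "v (f $$ int n) * z ^ n \<le> C ^ K * C ^ n * z ^ n"
      using C by (intro mult_right_mono bound) (simp add: z_def)
    also have "\<dots> = C ^ K * (C * z) ^ n" by (simp add: power_mult_distrib)
    also have "C * z = 1 / 2" using C by (simp add: z_def)
    finally show "norm (v (f $$ int n) * z ^ n) \<le> C ^ K * (1 / 2) ^ n"
      using nonneg C by (simp add: abs_mult z_def)
  qed
  then have "ereal (norm z) \<le> conv_radius (\<lambda>n. v (f $$ int n))" by (rule conv_radius_geI)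
  moreover have "0 < ereal (norm z)" using C by (simp add: z_def)
  ultimately have "0 < conv_radius (\<lambda>n. v (f $$ int n))" by (rule less_le_trans[rotated])
  then show ?thesis by (simp add: convergent_series_def)
qed

lemma convergent_imp_growth:
  assumes "f \<in> convergent_series"
  shows "\<exists>C N. growth C N f"
proof -
  obtain r where r: "0 < r" "ereal r < conv_radius (\<lambda>n. v (f $$ int n))"
    using assms ereal_dense2[of 0 "conv_radius (\<lambda>n. v (f $$ int n))"] by (auto simp: convergent_series_def zero_ereal_def)
  then have "summable (\<lambda>n. v (f $$ int n) * r ^ n)" by (intro summable_in_conv_radius) simp
  then have "Bseq (\<lambda>n. v (f $$ int n) * r ^ n)" by (rule summable_imp_Bseq)
  then obtain B where B: "\<And>n. norm (v (f $$ int n) * r ^ n) \<le> B" by (auto simp: Bseq_def)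
  define S where "S = (\<Sum>n\<in>{fls_subdegree f..<0}. v (f $$ n))"
  define C where "C = 1 + \<bar>B\<bar> + 1 / r + S"
  define N where "N = max 1 (1 - fls_subdegree f)"
  have S: "0 \<le> S" unfolding S_def by (intro sum_nonneg nonneg)
  have C: "1 \<le> C" "\<bar>B\<bar> \<le> C" "1 / r \<le> C" "S \<le> C" using r S by (auto simp: C_def)
  have "v (f $$ n) \<le> C ^ nat (n + N)" for n
  proof (cases "n < fls_subdegree f")
    case False
    then have nN: "1 \<le> nat (n + N)" by (auto simp: N_def)
    show ?thesis
    proof (cases "n < 0")
      case True
      then have "v (f $$ n) \<le> S" unfolding S_def using False nonneg by (intro member_le_sum) auto
      also have "\<dots> \<le> C ^ 1" using C by simp
      also have "\<dots> \<le> C ^ nat (n + N)" using C nN by (intro power_increasing) auto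
      finally show ?thesis .
    next
      case False
      define m where "m = nat n"
      have n: "n = int m" using False by (simp add: m_def)
      have "v (f $$ n) * r ^ m \<le> \<bar>B\<bar>" using B[of m] nonneg r by (simp add: n abs_mult)
      then have "v (f $$ n) \<le> \<bar>B\<bar> * (1 / r) ^ m" using r by (simp add: field_simps)
      also have "\<dots> \<le> C * C ^ m" using C r by (intro mult_mono power_mono) auto
      also have "\<dots> = C ^ (m + 1)" by simp
      also have "\<dots> \<le> C ^ nat (n + N)" using C by (intro power_increasing) (auto simp: n N_def)
      finally show ?thesis .
    qed
  qed (use C in auto)
  moreover have "f $$ n = 0" if "n < - N" for n using that by (auto simp: N_def)
  ultimately show ?thesis unfolding growth_def using C(1) by blast
qed

lemma convergent_iff_growth: "f \<in> convergent_series \<longleftrightarrow> (\<exists>C N. growth C N f)"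
  using growth_imp_convergent convergent_imp_growth by blast

lemma convergent_add:
  assumes "f \<in> convergent_series" "g \<in> convergent_series"
  shows "f + g \<in> convergent_series"
proof -
  obtain C\<^sub>1 N\<^sub>1 C\<^sub>2 N\<^sub>2 where fg: "growth C\<^sub>1 N\<^sub>1 f" "growth C\<^sub>2 N\<^sub>2 g"
    using assms unfolding convergent_iff_growth by blast
  define C N where "C = max C\<^sub>1 C\<^sub>2" and "N = max N\<^sub>1 N\<^sub>2"
  have f: "growth C N f" and g: "growth C N g" using growth_common[OF fg] by (simp_all add: C_def N_def)
  have "v (f $$ n + g $$ n) \<le> C ^ nat (n + N)" for n
    using f g order_trans[OF ultrametric[of "f $$ n" "g $$ n"]] unfolding growth_def by simp
  then have "growth C N (f + g)" using f g by (simp add: growth_def)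
  then show ?thesis unfolding convergent_iff_growth by blast
qed

lemma convergent_uminus: "f \<in> convergent_series \<Longrightarrow> - f \<in> convergent_series"
  by (simp add: convergent_series_def)

lemma convergent_finite:
  assumes "\<exists>L. \<forall>l\<ge>L. f $$ l = 0"
  shows "f \<in> convergent_series"
proof -
  obtain L where L: "\<And>l. l \<ge> L \<Longrightarrow> f $$ l = 0" using assms by blast
  have "eventually (\<lambda>n. v (f $$ int n) = 0) sequentially"
    using eventually_ge_at_top[of "nat L"] by eventually_elim (auto simp: L)
  then have "conv_radius (\<lambda>n. v (f $$ int n)) = conv_radius (\<lambda>_. 0 :: real)" by (rule conv_radius_cong')
  then show ?thesis by (simp add: convergent_series_def)
qed

text \<open>
  By the ultrametric inequality a coefficient of the product is bounded by the largest of the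
  summands \<open>f\<^sub>m\<^sub>-\<^sub>j g\<^sub>j\<close>, whose exponents \<open>m - j + N\<close> and \<open>j + N\<close> add up to \<open>m + 2 N\<close>.
\<close>

lemma convergent_mult:
  assumes "f \<in> convergent_series" "g \<in> convergent_series"
  shows "f * g \<in> convergent_series"
proof -
  obtain C\<^sub>1 N\<^sub>1 C\<^sub>2 N\<^sub>2 where fg: "growth C\<^sub>1 N\<^sub>1 f" "growth C\<^sub>2 N\<^sub>2 g"
    using assms unfolding convergent_iff_growth by blast
  define C N where "C = max C\<^sub>1 C\<^sub>2" and "N = max N\<^sub>1 N\<^sub>2"
  have f: "growth C N f" and g: "growth C N g" using growth_common[OF fg] by (simp_all add: C_def N_def)
  have C: "1 \<le> C" using f by (simp add: growth_def)
  have prod: "(f * g) $$ m = (\<Sum>j=- N..m + N. f $$ (m - j) * g $$ j)" for m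
    using f g by (subst fls_times_nth_window[of "- N" _ "- N"]) (auto simp: growth_def)
  have "v ((f * g) $$ m) \<le> C ^ nat (m + 2 * N)" for m
    unfolding prod
  proof (rule v_sum_le)
    fix j assume j: "j \<in> {- N..m + N}"
    have "v (f $$ (m - j) * g $$ j) \<le> C ^ nat (m - j + N) * C ^ nat (j + N)"
      unfolding mult using f g C nonneg by (intro mult_mono) (auto simp: growth_def)
    also have "\<dots> = C ^ nat (m + 2 * N)"
      using j by (simp add: power_add[symmetric] nat_add_distrib[symmetric])
    finally show "v (f $$ (m - j) * g $$ j) \<le> C ^ nat (m + 2 * N)" .
  qed (use C in simp)
  moreover have "(f * g) $$ m = 0" if "m < - (2 * N)" for m
    using that by (simp add: prod)
  ultimately have "growth C (2 * N) (f * g)" using C by (simp add: growth_def)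
  then show ?thesis unfolding convergent_iff_growth by blast
qed

lemma convergent_deriv:
  assumes "f \<in> convergent_series"
  shows "fls_deriv f \<in> convergent_series"
proof -
  obtain C N where f: "growth C N f" using assms unfolding convergent_iff_growth by blast
  have "v (fls_deriv f $$ n) \<le> C ^ nat (n + (N + 1))" for n
  proof -
    have "v (fls_deriv f $$ n) = v (of_int (n + 1)) * v (f $$ (n + 1))" by (simp add: mult del: of_int_add)
    also have "\<dots> \<le> 1 * v (f $$ (n + 1))" by (intro mult_right_mono v_of_int_le nonneg)
    also have "\<dots> \<le> C ^ nat (n + 1 + N)" using f by (simp add: growth_def)
    finally show ?thesis by (simp add: ac_simps)
  qed
  then have "growth C (N + 1) (fls_deriv f)" using f by (simp add: growth_def)
  then show ?thesis unfolding convergent_iff_growth by blast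
qed

text \<open>
  With \<open>f\<^sub>k\<close> the leading coefficient and \<open>c = v f\<^sub>k\<close>, choose \<open>D\<close> such that \<open>v (f\<^sub>k\<^sub>+\<^sub>i) \<le> c D\<^sup>i\<close> for
  \<open>i \<ge> 1\<close>.  The recursion for the coefficients \<open>g\<close> of the inverse then gives \<open>v (g\<^sub>m\<^sub>-\<^sub>k) \<le> D\<^sup>m / c\<close> by
  induction and the ultrametric inequality.
\<close>

lemma convergent_inverse:
  assumes "f \<in> convergent_series"
  shows "inverse f \<in> convergent_series"
proof (cases "f = 0")
  case False
  obtain C N where f: "growth C N f" using assms unfolding convergent_iff_growth by blast
  have C: "1 \<le> C" using f by (simp add: growth_def)
  define k where "k = fls_subdegree f"
  define c where "c = v (f $$ k)"
  define g where "g = inverse f"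
  have fk: "f $$ k \<noteq> 0" using False by (simp add: k_def)
  have c: "0 < c" unfolding c_def using nonneg[of "f $$ k"] eq_0_iff[of "f $$ k"] fk by linarith
  have kN: "- N \<le> k" using f fk unfolding growth_def by (metis linorder_not_less)
  define K where "K = nat (k + N)"
  define D where "D = C ^ (K + 1) * max 1 (1 / c)"
  have "1 * 1 \<le> C ^ (K + 1) * max 1 (1 / c)" using one_le_power[OF C, of "K + 1"] by (intro mult_mono) auto
  then have D1: "1 \<le> D" by (simp add: D_def)
  have fbound: "v (f $$ (k + int i)) \<le> c * D ^ i" if "1 \<le> i" for i
  proof -
    have "v (f $$ (k + int i)) \<le> C ^ nat (k + int i + N)" using f by (simp add: growth_def)
    also have "nat (k + int i + N) = K + i" using kN by (simp add: K_def)
    also have "C ^ (K + i) \<le> C ^ ((K + 1) * i)" using C that by (intro power_increasing) (auto simp: algebra_simps)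
    also have "\<dots> = C ^ ((K + 1) * i) * (c * (1 / c))" using c by simp
    also have "\<dots> \<le> C ^ ((K + 1) * i) * (c * max 1 (1 / c) ^ i)"
    proof -
      have "1 / c \<le> max 1 (1 / c) ^ 1" by simp
      also have "\<dots> \<le> max 1 (1 / c) ^ i" using that by (intro power_increasing) auto
      finally show ?thesis using c C by (intro mult_left_mono) auto
    qed
    also have "\<dots> = c * D ^ i" by (simp add: D_def power_mult_distrib power_mult[symmetric] power_add mult_ac)
    finally show ?thesis .
  qed
  have gz: "g $$ j = 0" if "j < - k" for j
    using that False by (simp add: g_def k_def fls_inverse_subdegree)
  have rec: "f $$ k * g $$ (int m - k) = (if m = 0 then 1 else 0) - (\<Sum>i<m. f $$ (k + int (m - i)) * g $$ (int i - k))" for m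
  proof -
    have "(if m = 0 then 1 else 0) = (f * g) $$ int m" using False by (simp add: g_def)
    also have "\<dots> = (\<Sum>j=- k..int m - k. f $$ (int m - j) * g $$ j)"
      by (rule fls_times_nth_window) (auto simp: k_def gz[unfolded k_def])
    also have "\<dots> = (\<Sum>i\<le>m. f $$ (k + int (m - i)) * g $$ (int i - k))"
      by (rule sum.reindex_bij_witness[of _ "\<lambda>i. int i - k" "\<lambda>j. nat (j + k)"])
         (auto simp: of_nat_diff algebra_simps)
    finally show ?thesis by (simp add: lessThan_Suc_atMost[symmetric] algebra_simps)
  qed
  have gbound: "v (g $$ (int m - k)) \<le> D ^ m / c" for m
  proof (induction m rule: less_induct)
    case (less m)
    have "v ((if m = 0 then 1 else 0) + - (\<Sum>i<m. f $$ (k + int (m - i)) * g $$ (int i - k))) \<le> D ^ m"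
    proof -
      have "v (\<Sum>i<m. f $$ (k + int (m - i)) * g $$ (int i - k)) \<le> D ^ m"
      proof (rule v_sum_le)
        fix i assume i: "i \<in> {..<m}"
        have "v (f $$ (k + int (m - i)) * g $$ (int i - k)) \<le> (c * D ^ (m - i)) * (D ^ i / c)"
          unfolding mult using i less fbound[of "m - i"] c D1 nonneg by (intro mult_mono) auto
        also have "\<dots> = D ^ m" using c i by (simp add: power_add[symmetric])
        finally show "v (f $$ (k + int (m - i)) * g $$ (int i - k)) \<le> D ^ m" .
      qed (use D1 in simp)
      moreover have "v (if m = 0 then 1 else 0) \<le> D ^ m" using D1 by simp
      ultimately show ?thesis
        by (intro order_trans[OF ultrametric]) simp
    qed
    then have "c * v (g $$ (int m - k)) \<le> D ^ m" using rec[of m] by (simp add: c_def mult[symmetric])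
    then show ?case using c by (simp add: field_simps)
  qed
  define E where "E = max D (1 / c)"
  have E: "1 \<le> E" "D \<le> E" "1 / c \<le> E" using D1 by (auto simp: E_def)
  have "v (g $$ n) \<le> E ^ nat (n + (k + 1))" for n
  proof (cases "n < - k")
    case False
    define m where "m = nat (n + k)"
    have n: "n = int m - k" using False by (simp add: m_def)
    have "v (g $$ n) \<le> D ^ m * (1 / c)" using gbound[of m] by (simp add: n)
    also have "\<dots> \<le> E ^ m * E" using E c D1 by (intro mult_mono power_mono) auto
    also have "\<dots> = E ^ nat (n + (k + 1))" using False by (simp add: n power_Suc2[symmetric] nat_add_distrib del: power_Suc)
    finally show ?thesis .
  qed (use E gz in auto)
  moreover have "g $$ n = 0" if "n < - (k + 1)" for n using that gz by simp
  ultimately have "growth E (k + 1) g" using E by (simp add: growth_def)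
  then show ?thesis unfolding convergent_iff_growth g_def by blast
qed (simp add: convergent_finite)

end

lemma convergent_laurent_subfield:
  fixes v :: "'k::field_char_0 \<Rightarrow> real"
  assumes "complete_nonarch_abs v"
  shows "laurent_subfield (complete_nonarch_abs.convergent_series v)"
proof -
  interpret complete_nonarch_abs v by fact
  have fin: "f \<in> convergent_series" if "\<exists>L. \<forall>l\<ge>L. f $$ l = 0" for f using that by (rule convergent_finite)
  show ?thesis
  proof unfold_locales
    show "0 \<in> convergent_series" by (rule fin) auto
    show "1 \<in> convergent_series" by (rule fin, rule exI[of _ 1]) simp
    show "fls_const c \<in> convergent_series" for c by (rule fin, rule exI[of _ 1]) simp
    show "fls_X_intpow n \<in> convergent_series" for n by (rule fin, rule exI[of _ "n + 1"]) simp
  qed (auto intro: convergent_add convergent_uminus convergent_mult convergent_inverse convergent_deriv fin)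
qed

section \<open>Full faithfulness, extension groups and stability\<close>

lemma (in laurent_subfield) infinite_A: "infinite A"
proof
  assume "finite A"
  then have "finite (range (\<lambda>n::nat. fls_const (of_nat n :: 'k)))" by (rule finite_subset[rotated]) auto
  moreover have "inj (\<lambda>n::nat. fls_const (of_nat n :: 'k))"
    by (intro injI, drule arg_cong[of _ _ "\<lambda>f. f $$ 0"]) simp
  ultimately show False using finite_imageD infinite_UNIV_nat by blast
qed

context laurent_hom
begin

text \<open>
  Injective since \<open>1 \<otimes> g x\<close> determines \<open>g x\<close>, surjective since formal morphisms are convergent.
\<close>

theorem ext_map_bij_hom:
  assumes bM: "M.coord_basis I e" and bN: "N.coord_basis J f" and ind: index_zero
  shows "bij_betw (scalar_ext_map (subfield_ring A) (subfield_ring UNIV) fls_deriv M N)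
    (dmod_hom (subfield_ring A) M N) (dmod_hom (subfield_ring UNIV) M.ext N.ext)"
  unfolding bij_betw_def
proof (intro conjI equalityI subsetI)
  show "inj_on (scalar_ext_map (subfield_ring A) (subfield_ring UNIV) fls_deriv M N) (dmod_hom (subfield_ring A) M N)"
  proof (rule inj_onI)
    fix g h assume g: "g \<in> dmod_hom (subfield_ring A) M N" and h: "h \<in> dmod_hom (subfield_ring A) M N"
      and eq: "ext_map g = ext_map h"
    note gl = dmod_homD(1)[OF g] and hl = dmod_homD(1)[OF h]
    show "g = h"
    proof (rule lin_maps_eqI[OF gl hl])
      fix x assume x: "x \<in> carrier M"
      have "N.pure 1 (g x) = N.pure 1 (h x)"
        using fun_cong[OF eq, of "M.pure 1 x"] by (simp add: ext_map_pure[OF gl x] ext_map_pure[OF hl x])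
      then show "g x = h x" by (rule N.pure_inj[OF bN lin_in[OF gl x] lin_in[OF hl x]])
    qed
  qed
qed (use ext_map_hom horizontal_hom_descends[OF bM bN ind] in auto)

lemma ext_map_add:
  assumes y: "y \<in> lin_maps (subfield_ring A) M N" and y': "y' \<in> lin_maps (subfield_ring A) M N"
  shows "ext_map (y \<oplus>\<^bsub>Hom\<^esub> y') = ext_map y \<oplus>\<^bsub>MN.Hom\<^esub> ext_map y'"
proof (rule M.ext_lin_maps_eqI)
  show "ext_map (y \<oplus>\<^bsub>Hom\<^esub> y') \<in> lin_maps (subfield_ring UNIV) M.ext N.ext"
    by (rule ext_map_lin[OF Hom_add_closed[OF y y']])
  show "ext_map y \<oplus>\<^bsub>MN.Hom\<^esub> ext_map y' \<in> lin_maps (subfield_ring UNIV) M.ext N.ext"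
    by (rule MN.Hom_add_closed[OF ext_map_lin[OF y] ext_map_lin[OF y']])
  fix x assume x: "x \<in> carrier M"
  then show "ext_map (y \<oplus>\<^bsub>Hom\<^esub> y') (M.pure 1 x) = (ext_map y \<oplus>\<^bsub>MN.Hom\<^esub> ext_map y') (M.pure 1 x)"
    by (simp add: ext_map_pure[OF y x] ext_map_pure[OF y' x] ext_map_pure[OF Hom_add_closed[OF y y'] x]
        N.pure_add lin_in[OF y x] lin_in[OF y' x])
qed

lemma ext_map_congruent_mod_exact:
  assumes bM: "M.coord_basis I e" and bN: "N.coord_basis J f" and ind: index_zero
    and y: "y \<in> lin_maps (subfield_ring A) M N" and y': "y' \<in> lin_maps (subfield_ring A) M N"
    and \<phi>: "\<phi> \<in> lin_maps (subfield_ring UNIV) M.ext N.ext" and eq: "ext_map y = ext_map y' \<oplus>\<^bsub>MN.Hom\<^esub> nabla MN.Hom \<phi>"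
  shows "\<exists>z\<in>lin_maps (subfield_ring A) M N. y = y' \<oplus>\<^bsub>Hom\<^esub> nabla Hom z"
proof -
  define w where "w = y \<oplus>\<^bsub>Hom\<^esub> ((- 1) \<odot>\<^bsub>Hom\<^esub> y')"
  have w: "w \<in> lin_maps (subfield_ring A) M N"
    unfolding w_def by (intro Hom_add_closed Hom_smult_closed y y') simp
  have w_eq: "w x = y x \<ominus>\<^bsub>N\<^esub> y' x" if "x \<in> carrier M" for x
    using that lin_in[OF y' that] by (simp add: w_def a_minus_def N.smult_uminus)
  have yw: "y x = y' x \<oplus>\<^bsub>N\<^esub> w x" if "x \<in> carrier M" for x
    using lin_in[OF y that] lin_in[OF y' that] by (simp add: w_eq[OF that] N.D.M.add_minus_self)
  have "ext_map w = nabla MN.Hom \<phi>"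
  proof (rule M.ext_lin_maps_eqI[OF ext_map_lin[OF w] MN.Hom_nabla_closed[OF \<phi>]])
    fix x assume x: "x \<in> carrier M"
    let ?D = "nabla MN.Hom \<phi> (M.pure 1 x)"
    have D: "?D \<in> carrier N.ext" using MN.lin_in[OF MN.Hom_nabla_closed[OF \<phi>], of "M.pure 1 x"] x by simp
    have "N.pure 1 (y' x) \<oplus>\<^bsub>N.ext\<^esub> N.pure 1 (w x) = N.pure 1 (y x)"
      unfolding yw[OF x] by (rule N.pure_add[OF lin_in[OF y' x] lin_in[OF w x], symmetric])
    also have "\<dots> = N.pure 1 (y' x) \<oplus>\<^bsub>N.ext\<^esub> ?D"
      using fun_cong[OF eq, of "M.pure 1 x"]
      unfolding ext_map_pure[OF y x] internal_hom_simps(3)[OF M.pure_closed[OF x]] ext_map_pure[OF y' x] .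
    finally have "N.pure 1 (w x) = ?D"
      using D N.pure_closed[OF lin_in[OF y' x]] N.pure_closed[OF lin_in[OF w x]]
      by (metis MN.N.D.M.add.l_cancel)
    then show "ext_map w (M.pure 1 x) = ?D" by (simp only: ext_map_pure[OF w x])
  qed
  from exact_hom_descends[OF bM bN ind w \<phi> this] obtain z where z: "z \<in> lin_maps (subfield_ring A) M N" "w = nabla Hom z"
    by blast
  have "y = y' \<oplus>\<^bsub>Hom\<^esub> nabla Hom z"
    by (rule Hom_eqI[OF y Hom_add_closed[OF y' Hom_nabla_closed[OF z(1)]]]) (simp add: yw z(2)[symmetric])
  then show ?thesis using z(1) by blast
qed

end

locale laurent_ext = laurent_hom A M N + base: ext_setting A fls_deriv M N I e
  for A :: "'k::field_char_0 fls set" and M :: "('k fls, 'm) dmod" and N :: "('k fls, 'm) dmod"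
    and I :: "'m set" and e +
  fixes J :: "'m set" and f
  assumes basis_N: "N.coord_basis J f" and index_zero: index_zero

sublocale laurent_ext \<subseteq> formal: ext_setting UNIV fls_deriv M.ext N.ext I "\<lambda>i. M.pure 1 (e i)"
proof (intro ext_setting.intro MN.diff_vector_spaces_axioms ext_setting_axioms.intro)
  show "MN.M.coord_basis I (\<lambda>i. M.pure 1 (e i))" by (rule M.ext_coord_basis[OF base.basis])
  show "infinite (UNIV :: 'k fls set)" using infinite_A finite_subset[OF subset_UNIV] by blast
qed

context laurent_ext
begin

abbreviation "extension_map \<equiv> Ext_map (subfield_ring A) (subfield_ring UNIV) fls_deriv M N"

lemma cocycle_of_scalar_extension:
  assumes y: "y \<in> lin_maps (subfield_ring A) M N" and x: "x \<in> cocycle_class (subfield_ring A) fls_deriv M N y"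
  shows "ext_scalar_ext (subfield_ring A) (subfield_ring UNIV) fls_deriv M N x
    \<in> cocycle_class (subfield_ring UNIV) fls_deriv M.ext N.ext (ext_map y)"
proof -
  obtain E i p where xe: "x = (E, i, p)" by (cases x) auto
  have x': "(E, i, p) \<in> extensions (subfield_ring A) fls_deriv M N"
    "ext_equiv (subfield_ring A) M N (split_ext M N y) (E, i, p)"
    using x by (simp_all add: cocycle_class_def xe)
  interpret X: dmod_extension A fls_deriv M N E i p by (rule dmod_extensionI[OF x'(1)])
  show ?thesis
    using X.scalar_extension_of_extension[OF y x'(2)] by (simp add: xe cocycle_class_def)
qed

lemma extension_map_class:
  assumes y: "y \<in> lin_maps (subfield_ring A) M N"
  shows "extension_map (base.cls y) = formal.cls (ext_map y)"
proof -
  let ?S = "subfield_ring (UNIV :: 'k fls set)"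
  note fy = ext_map_lin[OF y]
  note data = formal.split_data[OF fy]
  have *: "{e' \<in> extensions ?S fls_deriv M.ext N.ext.
      ext_equiv ?S M.ext N.ext (ext_scalar_ext (subfield_ring A) ?S fls_deriv M N x) e'} = formal.cls (ext_map y)"
    if x: "x \<in> base.cls y" for x
    using cocycle_of_scalar_extension[OF y x] unfolding cocycle_class_def[of ?S fls_deriv M.ext N.ext "ext_map y"]
    by (intro formal.equivalent_in_class[OF fy, unfolded cocycle_class_def]) auto
  obtain x0 where x0: "x0 \<in> base.cls y" using base.cocycle_class_nonempty[OF y] by blast
  have "extension_map (base.cls y) = (\<Union>x\<in>base.cls y. {e' \<in> extensions ?S fls_deriv M.ext N.ext.
      ext_equiv ?S M.ext N.ext (ext_scalar_ext (subfield_ring A) ?S fls_deriv M N x) e'})"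
    unfolding Ext_map_def by blast
  also have "\<dots> = (\<Union>x\<in>base.cls y. formal.cls (ext_map y))" by (intro SUP_cong refl *)
  also have "\<dots> = formal.cls (ext_map y)" using x0 by blast
  finally show ?thesis .
qed

text \<open>
  In terms of cocycles the map sends the class of \<open>y\<close> to the class of its scalar extension.  It is
  additive; it is injective because a cocycle that becomes exact over the formal series is exact, and
  surjective because each formal cocycle is convergent up to an exact one.
\<close>

theorem extension_map_iso:
  "extension_map \<in> iso (Ext (subfield_ring A) fls_deriv M N) (Ext (subfield_ring UNIV) fls_deriv M.ext N.ext)"
proof -
  let ?G = "Ext (subfield_ring A) fls_deriv M N" and ?H = "Ext (subfield_ring UNIV) fls_deriv M.ext N.ext"
  have cl: "ext_map y \<in> formal.lin" if "y \<in> base.lin" for y using ext_map_lin[OF that] .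
  have "extension_map \<in> hom ?G ?H"
  proof (rule homI)
    fix C assume "C \<in> carrier ?G"
    then obtain y where y: "y \<in> base.lin" "C = base.cls y" unfolding base.carrier_Ext by blast
    show "extension_map C \<in> carrier ?H"
      unfolding y(2) extension_map_class[OF y(1)] formal.carrier_Ext using cl[OF y(1)] by blast
    fix D assume "D \<in> carrier ?G"
    then obtain y' where y': "y' \<in> base.lin" "D = base.cls y'" unfolding base.carrier_Ext by blast
    show "extension_map (C \<otimes>\<^bsub>?G\<^esub> D) = extension_map C \<otimes>\<^bsub>?H\<^esub> extension_map D"
      unfolding y(2) y'(2) base.mult_Ext[OF y(1) y'(1)] extension_map_class[OF y(1)] extension_map_class[OF y'(1)]
        extension_map_class[OF Hom_add_closed[OF y(1) y'(1)]] formal.mult_Ext[OF cl[OF y(1)] cl[OF y'(1)]]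
        ext_map_add[OF y(1) y'(1)] ..
  qed
  moreover have "inj_on extension_map (carrier ?G)"
  proof (rule inj_onI)
    fix C D assume C: "C \<in> carrier ?G" and D: "D \<in> carrier ?G" and eq: "extension_map C = extension_map D"
    obtain y where y: "y \<in> base.lin" "C = base.cls y" using C unfolding base.carrier_Ext by blast
    obtain y' where y': "y' \<in> base.lin" "D = base.cls y'" using D unfolding base.carrier_Ext by blast
    have "formal.cls (ext_map y) = formal.cls (ext_map y')"
      using eq unfolding y(2) y'(2) extension_map_class[OF y(1)] extension_map_class[OF y'(1)] .
    from formal.cocycle_class_eqD[OF cl[OF y(1)] cl[OF y'(1)] this] obtain \<phi> where
      \<phi>: "\<phi> \<in> formal.lin" "ext_map y = ext_map y' \<oplus>\<^bsub>MN.Hom\<^esub> nabla MN.Hom \<phi>" by blast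
    from ext_map_congruent_mod_exact[OF base.basis basis_N index_zero y(1) y'(1) \<phi>] obtain z where
      z: "z \<in> base.lin" "y = y' \<oplus>\<^bsub>Hom\<^esub> nabla Hom z" by blast
    show "C = D" unfolding y(2) y'(2) by (rule base.cocycle_class_eqI[OF y(1) y'(1) z])
  qed
  moreover have "carrier ?H \<subseteq> extension_map ` carrier ?G"
  proof
    fix C assume "C \<in> carrier ?H"
    then obtain \<psi> where \<psi>: "\<psi> \<in> formal.lin" "C = formal.cls \<psi>" unfolding formal.carrier_Ext by blast
    from hom_is_convergent_modulo_exact[OF base.basis basis_N \<psi>(1)] obtain y \<phi> where
      y: "y \<in> base.lin" and \<phi>: "\<phi> \<in> formal.lin" "\<psi> = ext_map y \<oplus>\<^bsub>MN.Hom\<^esub> nabla MN.Hom \<phi>" by blast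
    have "C = extension_map (base.cls y)"
      unfolding \<psi>(2) extension_map_class[OF y] by (rule formal.cocycle_class_eqI[OF \<psi>(1) cl[OF y] \<phi>])
    then show "C \<in> extension_map ` carrier ?G" unfolding base.carrier_Ext using y by blast
  qed
  ultimately show ?thesis
    unfolding iso_def bij_betw_def by (auto dest: hom_in_carrier)
qed

lemma extension_descends:
  assumes x: "(E, i, p) \<in> extensions (subfield_ring UNIV) fls_deriv M.ext N.ext"
  shows "\<exists>(E0 :: ('k fls, 'm) dmod) i0 p0. (E0, i0, p0) \<in> extensions (subfield_ring A) fls_deriv M N \<and>
    dmod_iso (subfield_ring UNIV) (scalar_ext (subfield_ring A) (subfield_ring UNIV) fls_deriv E0) E \<noteq> {}"
proof -
  let ?S = "subfield_ring (UNIV :: 'k fls set)"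
  obtain \<psi> where \<psi>: "\<psi> \<in> formal.lin" "ext_equiv ?S M.ext N.ext (split_ext M.ext N.ext \<psi>) (E, i, p)"
    using formal.cocycle_exists[OF x] by blast
  from hom_is_convergent_modulo_exact[OF base.basis basis_N \<psi>(1)] obtain y \<phi> where
    y: "y \<in> base.lin" and \<phi>: "\<phi> \<in> formal.lin" "\<psi> = ext_map y \<oplus>\<^bsub>MN.Hom\<^esub> nabla MN.Hom \<phi>" by blast
  obtain x0 where x0: "x0 \<in> base.cls y" using base.cocycle_class_nonempty[OF y] by blast
  obtain E0 i0 p0 where x0e: "x0 = (E0, i0, p0)" by (cases x0) auto
  have "(E, i, p) \<in> cocycle_class ?S fls_deriv M.ext N.ext \<psi>" using x \<psi>(2) by (simp add: cocycle_class_def)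
  then have "(E, i, p) \<in> cocycle_class ?S fls_deriv M.ext N.ext (ext_map y)"
    using formal.cocycle_class_eqI[OF \<psi>(1) ext_map_lin[OF y] \<phi>] by blast
  then have 1: "ext_equiv ?S M.ext N.ext (split_ext M.ext N.ext (ext_map y)) (E, i, p)" by (simp add: cocycle_class_def)
  let ?x = "ext_scalar_ext (subfield_ring A) ?S fls_deriv M N x0"
  have 2: "?x \<in> extensions ?S fls_deriv M.ext N.ext" "ext_equiv ?S M.ext N.ext (split_ext M.ext N.ext (ext_map y)) ?x"
    using cocycle_of_scalar_extension[OF y x0] by (simp_all add: cocycle_class_def)
  have "ext_equiv ?S M.ext N.ext ?x (E, i, p)"
    by (rule extension_equiv_trans[OF extension_data_extension[OF 2(1)]
          extension_equiv_sym[OF formal.split_data[OF ext_map_lin[OF y]] 2(2)] 1])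
  then have "dmod_iso ?S (scalar_ext (subfield_ring A) ?S fls_deriv E0) E \<noteq> {}"
    by (auto simp: x0e ext_scalar_ext_def ext_equiv_def)
  moreover have "(E0, i0, p0) \<in> extensions (subfield_ring A) fls_deriv M N"
    using x0 by (simp add: x0e cocycle_class_def)
  ultimately show ?thesis by blast
qed

end

text \<open>
  The essential image consists of modules isomorphic to scalar extensions; composing with the
  isomorphisms replaces the ends of an exact sequence by the scalar extensions themselves.
\<close>

lemma extension_of_isomorphic_ends:
  assumes M: "diff_module R d M" and N: "diff_module R d N"
    and \<gamma>: "\<gamma> \<in> dmod_iso R M M'" and \<beta>: "\<beta> \<in> dmod_iso R N N'"
    and E: "diff_module R d E" and M': "diff_module R d M'" and ext: "short_exact R N' i E p M'"
  shows "\<exists>i' p'. (E, i', p') \<in> extensions R d M N"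
proof -
  interpret M: diff_module R d M by fact
  interpret N: diff_module R d N by fact
  interpret E: diff_module R d E by fact
  interpret M': diff_module R d M' by fact
  have "(E, i, p) \<in> extensions R d M' N'" using E ext by (simp add: extensions_def)
  note x = extensionsD[OF this]
  let ?h = "\<lambda>y\<in>carrier M'. inv_into (carrier M) \<gamma> y"
  have h: "?h \<in> dmod_iso R M' M" by (rule dmod_iso_inverse[OF M \<gamma>])
  note \<beta>D = dmod_isoD[OF \<beta>] and \<gamma>D = dmod_isoD[OF \<gamma>] and hD = dmod_isoD[OF h]
  note iD = dmod_homD[OF x(2)] and pD = dmod_homD[OF x(3)]
  have \<beta>_in: "\<beta> n \<in> carrier N'" if "n \<in> carrier N" for n using lin_mapsD(1)[OF \<beta>D(2) that] .
  have i_in: "i n \<in> carrier E" if "n \<in> carrier N'" for n using lin_mapsD(1)[OF iD(1) that] .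
  have p_in: "p y \<in> carrier M'" if "y \<in> carrier E" for y using lin_mapsD(1)[OF pD(1) that] .
  have h\<gamma>: "?h (\<gamma> m) = m" if "m \<in> carrier M" for m
    using that \<gamma>D(3) lin_mapsD(1)[OF \<gamma>D(2) that] by simp
  have \<gamma>h: "\<gamma> (?h m) = m" if "m \<in> carrier M'" for m
    using that \<gamma>D(4) by (simp add: f_inv_into_f)
  have \<gamma>0: "\<gamma> \<zero>\<^bsub>M\<^esub> = \<zero>\<^bsub>M'\<^esub>"
  proof -
    have "\<gamma> \<zero>\<^bsub>M\<^esub> \<oplus>\<^bsub>M'\<^esub> \<gamma> \<zero>\<^bsub>M\<^esub> = \<gamma> \<zero>\<^bsub>M\<^esub>"
      using lin_mapsD(2)[OF \<gamma>D(2), of "\<zero>\<^bsub>M\<^esub>" "\<zero>\<^bsub>M\<^esub>"] by simp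
    then show ?thesis using lin_mapsD(1)[OF \<gamma>D(2), of "\<zero>\<^bsub>M\<^esub>"] by (metis M'.M.add.l_cancel_one M.M.zero_closed)
  qed
  let ?i = "\<lambda>n\<in>carrier N. i (\<beta> n)" and ?p = "\<lambda>y\<in>carrier E. ?h (p y)"
  have "(E, ?i, ?p) \<in> extensions R d M N"
  proof (rule extensionsI[OF E])
    show "?i \<in> dmod_hom R N E"
    proof (rule dmod_homI)
      show "?i \<in> lin_maps R N E" by (rule lin_maps_comp[OF \<beta>D(2) iD(1)]) auto
      show "?i (nabla N n) = nabla E (?i n)" if "n \<in> carrier N" for n
        using that dmod_homD(2)[OF \<beta>D(1) that] iD(2)[OF \<beta>_in[OF that]] by (simp add: N.nabla_closed)
    qed
    show "?p \<in> dmod_hom R E M"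
    proof (rule dmod_homI)
      show "?p \<in> lin_maps R E M" by (rule lin_maps_comp[OF pD(1) hD(2)]) auto
      show "?p (nabla E y) = nabla M (?p y)" if "y \<in> carrier E" for y
        unfolding restrict_apply'[OF that] restrict_apply'[OF E.nabla_closed[OF that]] pD(2)[OF that]
        by (rule dmod_homD(2)[OF hD(1) p_in[OF that]])
    qed
    show "inj_on ?i (carrier N)"
      using \<beta>D(3) x(4) \<beta>_in by (simp add: inj_on_def)
    show "?i ` carrier N = {y \<in> carrier E. ?p y = \<zero>\<^bsub>M\<^esub>}"
    proof (intro equalityI subsetI)
      fix y assume "y \<in> ?i ` carrier N"
      then obtain n where n: "n \<in> carrier N" "y = i (\<beta> n)" by auto
      have y: "y \<in> carrier E" "p y = \<zero>\<^bsub>M'\<^esub>" using x(5) \<beta>_in[OF n(1)] n(2) by auto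
      have "?h (p y) = \<zero>\<^bsub>M\<^esub>" using h\<gamma>[of "\<zero>\<^bsub>M\<^esub>"] unfolding y(2) \<gamma>0 by simp
      then show "y \<in> {y \<in> carrier E. ?p y = \<zero>\<^bsub>M\<^esub>}" using y(1) by simp
    next
      fix y assume "y \<in> {y \<in> carrier E. ?p y = \<zero>\<^bsub>M\<^esub>}"
      then have y: "y \<in> carrier E" "?h (p y) = \<zero>\<^bsub>M\<^esub>" by auto
      have "p y = \<zero>\<^bsub>M'\<^esub>" using \<gamma>h[OF p_in[OF y(1)]] unfolding y(2) \<gamma>0 by simp
      then obtain n' where n': "n' \<in> carrier N'" "y = i n'" using x(5) y(1) by blast
      then obtain n where "n \<in> carrier N" "n' = \<beta> n" using \<beta>D(4) by blast
      then show "y \<in> ?i ` carrier N" using n' by (intro image_eqI[of _ _ n]) auto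
    qed
    show "?p ` carrier E = carrier M"
    proof (intro equalityI subsetI)
      fix m assume m: "m \<in> carrier M"
      have "\<gamma> m \<in> carrier M'" using lin_mapsD(1)[OF \<gamma>D(2) m] .
      then obtain y where y: "y \<in> carrier E" "p y = \<gamma> m" using x(6) by (metis imageE)
      have "?p y = ?h (p y)" by (rule restrict_apply'[OF y(1)])
      also have "\<dots> = m" unfolding y(2) by (rule h\<gamma>[OF m])
      finally show "m \<in> ?p ` carrier E" using y(1) by blast
    next
      fix m assume "m \<in> ?p ` carrier E"
      then obtain y where y: "y \<in> carrier E" "m = ?h (p y)" by auto
      show "m \<in> carrier M" unfolding y(2) by (rule lin_mapsD(1)[OF hD(2) p_in[OF y(1)]])
    qed
  qed
  then show ?thesis by blast
qed

theorem corollary4p1p25: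
  fixes v :: "'k::field_char_0 \<Rightarrow> real"
    and Bs :: "('k fls, 'm) dmod set"
  assumes "complete_nonarch_abs v"
    and "\<And>M. M \<in> Bs \<Longrightarrow>
           diff_module (conv_laurent_ring v) fls_deriv M \<and> fin_dim (conv_laurent_ring v) M"
    and "\<And>M N. M \<in> Bs \<Longrightarrow> N \<in> Bs \<Longrightarrow>
           fin_dim const_field (H0_dR (internal_hom (conv_laurent_ring v) M N)) \<and>
           fin_dim const_field (H1_dR (internal_hom (conv_laurent_ring v) M N)) \<and>
           chi_dR (internal_hom (conv_laurent_ring v) M N) = 0"
  shows "scalar_ext_fully_faithful (conv_laurent_ring v) laurent_ring fls_deriv Bs \<and>
    (\<forall>M\<in>Bs. \<forall>N\<in>Bs.
       Ext_map (conv_laurent_ring v) laurent_ring fls_deriv M N \<in>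
         iso (Ext (conv_laurent_ring v) fls_deriv M N)
             (Ext laurent_ring fls_deriv
                (scalar_ext (conv_laurent_ring v) laurent_ring fls_deriv M)
                (scalar_ext (conv_laurent_ring v) laurent_ring fls_deriv N))) \<and>
    (stable_by_extensions (conv_laurent_ring v) fls_deriv Bs \<longrightarrow>
       stable_by_extensions laurent_ring fls_deriv
         (scalar_ext_ess_image (conv_laurent_ring v) laurent_ring fls_deriv Bs
            :: ('k fls, 'u) dmod set))"
proof -
  define A where "A = complete_nonarch_abs.convergent_series v"
  interpret A: laurent_subfield A unfolding A_def by (rule convergent_laurent_subfield[OF assms(1)])
  let ?R = "subfield_ring A" and ?S = "subfield_ring (UNIV :: 'k fls set)"
  have R: "conv_laurent_ring v = ?R"
    by (simp add: conv_laurent_ring_def A_def complete_nonarch_abs.convergent_series_def[OF assms(1)])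
  have dvs: "diff_vector_space A fls_deriv M" if "M \<in> Bs" for M
    using assms(2)[OF that] A.diff_subfield_axioms by (intro diff_vector_space.intro) (auto simp: R)
  have setting: "\<exists>I e J f. laurent_ext A M N I e J f" if M: "M \<in> Bs" and N: "N \<in> Bs" for M N
  proof -
    interpret M: diff_vector_space A fls_deriv M by (rule dvs[OF M])
    interpret N: diff_vector_space A fls_deriv N by (rule dvs[OF N])
    interpret laurent_hom A M N by unfold_locales
    have fM: "fin_dim ?R M" and fN: "fin_dim ?R N" using assms(2)[OF M] assms(2)[OF N] by (simp_all add: R)
    obtain I where "mod_basis ?R M I" using fM by (auto simp: fin_dim_def)
    then have bM: "M.coord_basis I (\<lambda>b. b)" by (rule M.mod_basis_coord_basis[OF fM])
    obtain J where "mod_basis ?R N J" using fN by (auto simp: fin_dim_def)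
    then have bN: "N.coord_basis J (\<lambda>b. b)" by (rule N.mod_basis_coord_basis[OF fN])
    have "laurent_ext A M N I (\<lambda>b. b) J (\<lambda>b. b)"
      by unfold_locales
         (use bM bN A.infinite_A assms(3)[OF M N] assms(3)[OF N M] in \<open>simp_all add: R\<close>)
    then show ?thesis by blast
  qed
  have faithful: "scalar_ext_fully_faithful ?R ?S fls_deriv Bs"
    unfolding scalar_ext_fully_faithful_def
  proof (intro ballI)
    fix M N assume MN: "M \<in> Bs" "N \<in> Bs"
    obtain I e J f where "laurent_ext A M N I e J f" using setting[OF MN] by blast
    then interpret laurent_ext A M N I e J f .
    show "bij_betw (scalar_ext_map ?R ?S fls_deriv M N) (dmod_hom ?R M N)
        (dmod_hom ?S (scalar_ext ?R ?S fls_deriv M) (scalar_ext ?R ?S fls_deriv N))"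
      by (rule ext_map_bij_hom[OF base.basis basis_N index_zero])
  qed
  have exts: "Ext_map ?R ?S fls_deriv M N \<in> iso (Ext ?R fls_deriv M N)
      (Ext ?S fls_deriv (scalar_ext ?R ?S fls_deriv M) (scalar_ext ?R ?S fls_deriv N))"
    if MN: "M \<in> Bs" "N \<in> Bs" for M N
  proof -
    obtain I e J f where "laurent_ext A M N I e J f" using setting[OF MN] by blast
    then interpret laurent_ext A M N I e J f .
    show ?thesis by (rule extension_map_iso)
  qed
  have stable: "stable_by_extensions ?S fls_deriv
      (scalar_ext_ess_image ?R ?S fls_deriv Bs :: ('k fls, 'u) dmod set)"
    if st: "stable_by_extensions ?R fls_deriv Bs"
    unfolding stable_by_extensions_def
  proof (intro ballI allI impI)
    fix N' M' E :: "('k fls, 'u) dmod" and i p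
    assume N': "N' \<in> scalar_ext_ess_image ?R ?S fls_deriv Bs"
      and M': "M' \<in> scalar_ext_ess_image ?R ?S fls_deriv Bs"
      and E: "diff_module ?S fls_deriv E \<and> short_exact ?S N' i E p M'"
    obtain N \<beta> where N: "N \<in> Bs" "\<beta> \<in> dmod_iso ?S (scalar_ext ?R ?S fls_deriv N) N'"
      using N' by (auto simp: scalar_ext_ess_image_def)
    obtain M \<gamma> where M: "M \<in> Bs" "\<gamma> \<in> dmod_iso ?S (scalar_ext ?R ?S fls_deriv M) M'"
        "diff_module ?S fls_deriv M'"
      using M' by (auto simp: scalar_ext_ess_image_def)
    obtain I e J f where "laurent_ext A M N I e J f" using setting[OF M(1) N(1)] by blast
    then interpret laurent_ext A M N I e J f .
    obtain i' p' where "(E, i', p') \<in> extensions ?S fls_deriv M.ext N.ext"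
      using extension_of_isomorphic_ends[OF MN.M.D.diff_module_axioms MN.N.D.diff_module_axioms M(2) N(2) _ M(3)] E
      by blast
    from extension_descends[OF this] obtain E0 :: "('k fls, 'm) dmod" and i0 p0 where
      E0: "(E0, i0, p0) \<in> extensions ?R fls_deriv M N" "dmod_iso ?S (scalar_ext ?R ?S fls_deriv E0) E \<noteq> {}"
      by blast
    have "E0 \<in> Bs"
      using st M(1) N(1) E0(1) unfolding stable_by_extensions_def extensions_def by blast
    then show "E \<in> scalar_ext_ess_image ?R ?S fls_deriv Bs"
      using E E0(2) unfolding scalar_ext_ess_image_def by blast
  qed
  show ?thesis
    unfolding R using faithful exts stable by (simp only: subfield_ring_UNIV) blast
qed

end
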